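(* Let $G$ be a uniform unitary reflection group of rank two. The structure of $H^1(F_0,\mathbb C)$ as a $\mu_d$-module, where $\mu_d$ ($=1\times\mu_d$) is the monodromy subgroup of $\Gamma_0$, is given by $$H^1(F_0,\mathbb C)=(d-1)\gamma_0+(d-2)\sum_{i=1}^{d-1}\gamma_i .$$
   Context: $V=\mathbb C^2$; $G\subset GL(V)$ is an irreducible finite complex (unitary) reflection group with set of reflecting hyperplanes $\mathcal A$. Uniform means that the order $e_H$ of the pointwise stabiliser of $H$ is the same number $e$ for all $H\in\mathcal A$. For $H\in\mathcal A$, $\ell_H\in V^*$ is a linear form with kernel $H$; $Q_0=\prod_{H\in\mathcal A}\ell_H$, $d=\deg Q_0=|\mathcal A|$, $m=de$, $F_0=\{v\in V:Q_0(v)=1\}$. The group $\Gamma=G\times\mu_m$ acts on $V$ by $(g,\xi)v=\xi^{-1}gv$, and $\Gamma_0\supseteq 1\times\mu_d$ is the stabiliser of $F_0$; $\gamma\in\Gamma_0$ acts on cohomology as the inverse of pullback along $x\mapsto\gamma x$. $\gamma_i$ is the character $\xi\mapsto\xi^i$ of $\mu_d$, and the equation is in the Grothendieck ring of $\mu_d$. *)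

theory Defs
  imports "HOL-Analysis.Analysis" "HOL-Homology.Homology"
    "Jordan_Normal_Form.Missing_VectorSpace"
begin

section \<open>Complex reflection groups\<close>

definition GL :: "(complex^'n^'n) monoid" where
  "GL = \<lparr>carrier = {A. invertible A}, monoid.mult = (**), one = Finite_Cartesian_Product.mat 1\<rparr>"

definition fixed_space :: "complex^'n^'n \<Rightarrow> (complex^'n) set" where
  "fixed_space g = {v. g *v v = v}"

definition complex_reflection :: "complex^'n^'n \<Rightarrow> bool" where
  "complex_reflection g \<longleftrightarrow> g \<in> carrier GL \<and> (\<exists>k>0. g [^]\<^bsub>GL\<^esub> (k::nat) = \<one>\<^bsub>GL\<^esub>) \<and>
     vec.dim (fixed_space g) + 1 = CARD('n)"

definition finite_reflection_group :: "(complex^'n^'n) set \<Rightarrow> bool" where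
  "finite_reflection_group G \<longleftrightarrow> subgroup G GL \<and> finite G \<and>
     G = generate GL {s \<in> G. complex_reflection s}"

definition irreducible_linear_group :: "(complex^'n^'n) set \<Rightarrow> bool" where
  "irreducible_linear_group G \<longleftrightarrow>
     (\<forall>W. vec.subspace W \<and> (\<forall>g\<in>G. (*v) g ` W \<subseteq> W) \<longrightarrow> W = {0} \<or> W = UNIV)"

definition arrangement :: "(complex^'n^'n) set \<Rightarrow> (complex^'n) set set" where
  "arrangement G = fixed_space ` {s \<in> G. complex_reflection s}"

definition pointwise_stabiliser ::
    "(complex^'n^'n) set \<Rightarrow> (complex^'n) set \<Rightarrow> (complex^'n^'n) set" where
  "pointwise_stabiliser G H = {g \<in> G. \<forall>v\<in>H. g *v v = v}"

definition uniform :: "(complex^'n^'n) set \<Rightarrow> nat \<Rightarrow> bool" where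
  "uniform G e \<longleftrightarrow> (\<forall>H\<in>arrangement G. card (pointwise_stabiliser G H) = e)"

definition defining_forms ::
    "(complex^'n^'n) set \<Rightarrow> ((complex^'n) set \<Rightarrow> complex^'n \<Rightarrow> complex) \<Rightarrow> bool" where
  "defining_forms G l \<longleftrightarrow>
     (\<forall>H\<in>arrangement G. Vector_Spaces.linear (*s) (*) (l H) \<and> {v. l H v = 0} = H)"

definition Q\<^sub>0 ::
    "(complex^'n^'n) set \<Rightarrow> ((complex^'n) set \<Rightarrow> complex^'n \<Rightarrow> complex) \<Rightarrow> complex^'n \<Rightarrow> complex" where
  "Q\<^sub>0 G l v = (\<Prod>H\<in>arrangement G. l H v)"

definition F\<^sub>0 ::
    "(complex^'n^'n) set \<Rightarrow> ((complex^'n) set \<Rightarrow> complex^'n \<Rightarrow> complex) \<Rightarrow> (complex^'n) set" where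
  "F\<^sub>0 G l = {v. Q\<^sub>0 G l v = 1}"

definition mu :: "nat \<Rightarrow> complex monoid" where
  "mu k = \<lparr>carrier = {z. z ^ k = 1}, monoid.mult = (*), one = 1\<rparr>"

definition \<Gamma> :: "(complex^'n^'n) set \<Rightarrow> nat \<Rightarrow> ((complex^'n^'n) \<times> complex) monoid" where
  "\<Gamma> G m = GL\<lparr>carrier := G\<rparr> \<times>\<times> mu m"

definition \<Gamma>_act :: "(complex^'n^'n) \<times> complex \<Rightarrow> complex^'n \<Rightarrow> complex^'n" where
  "\<Gamma>_act \<gamma> v = inverse (snd \<gamma>) *s (fst \<gamma> *v v)"

definition \<Gamma>\<^sub>0 ::
    "(complex^'n^'n) set \<Rightarrow> nat \<Rightarrow> ((complex^'n) set \<Rightarrow> complex^'n \<Rightarrow> complex) \<Rightarrow>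
     ((complex^'n^'n) \<times> complex) set" where
  "\<Gamma>\<^sub>0 G m l = {\<gamma> \<in> carrier (\<Gamma> G m). \<Gamma>_act \<gamma> ` F\<^sub>0 G l = F\<^sub>0 G l}"


section \<open>Singular cohomology with complex coefficients\<close>

definition complex_field :: "complex ring" where
  "complex_field = \<lparr>carrier = UNIV, monoid.mult = (*), one = 1, zero = 0, add = (+)\<rparr>"

text \<open>The cochain space is $\mathrm{Hom}_{\mathbb Z}(C_p(X), \mathbb C)$, a subspace of the space of
  all complex functions on the set of singular chains. The ring multiplication that the record of a
  module carries has no meaning, here and below.\<close>

definition cochains :: "nat \<Rightarrow> 'a topology \<Rightarrow> (complex, 'a chain \<Rightarrow> complex) module" where
  "cochains p X = (ring.func_space complex_field (singular_chain_set p X))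
     \<lparr>carrier := hom (chain_group p X) (add_monoid complex_field) \<inter>
        extensional (singular_chain_set p X)\<rparr>"

definition coboundary :: "nat \<Rightarrow> 'a topology \<Rightarrow> ('a chain \<Rightarrow> complex) \<Rightarrow> 'a chain \<Rightarrow> complex" where
  "coboundary p X \<phi> = (\<lambda>c\<in>singular_chain_set (Suc p) X. \<phi> (chain_boundary (Suc p) c))"

definition cocycles :: "nat \<Rightarrow> 'a topology \<Rightarrow> ('a chain \<Rightarrow> complex) set" where
  "cocycles p X = {\<phi> \<in> carrier (cochains p X). coboundary p X \<phi> = \<zero>\<^bsub>cochains (Suc p) X\<^esub>}"

definition coboundaries :: "nat \<Rightarrow> 'a topology \<Rightarrow> ('a chain \<Rightarrow> complex) set" where
  "coboundaries p X = (case p of 0 \<Rightarrow> {\<zero>\<^bsub>cochains 0 X\<^esub>}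
     | Suc q \<Rightarrow> coboundary q X ` carrier (cochains q X))"

definition quotient_module :: "('r, 'v) module \<Rightarrow> 'v set \<Rightarrow> ('r, 'v set) module" where
  "quotient_module M N = \<lparr>carrier = a_rcosets\<^bsub>M\<^esub> N, monoid.mult = undefined, one = undefined,
     zero = N, add = (\<lambda>A B. A <+>\<^bsub>M\<^esub> B), smult = (\<lambda>c A. \<Union>x\<in>A. N +>\<^bsub>M\<^esub> (c \<odot>\<^bsub>M\<^esub> x))\<rparr>"

definition cohomology :: "nat \<Rightarrow> 'a topology \<Rightarrow> (complex, ('a chain \<Rightarrow> complex) set) module" where
  "cohomology p X = quotient_module ((cochains p X)\<lparr>carrier := cocycles p X\<rparr>) (coboundaries p X)"

definition cochain_pullback ::
    "nat \<Rightarrow> 'a topology \<Rightarrow> ('a \<Rightarrow> 'b) \<Rightarrow> ('b chain \<Rightarrow> complex) \<Rightarrow> 'a chain \<Rightarrow> complex" where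
  "cochain_pullback p X f \<phi> = (\<lambda>c\<in>singular_chain_set p X. \<phi> (chain_map p f c))"

text \<open>For a continuous \<open>f : X \<rightarrow> Y\<close>, the class of a cocycle \<open>\<phi>\<close> of \<open>Y\<close> goes to the class of its
  pullback; every \<open>\<phi>\<close> in the class contributes the same coset to the union.\<close>

definition cohomology_pullback ::
    "nat \<Rightarrow> 'a topology \<Rightarrow> ('a \<Rightarrow> 'b) \<Rightarrow> ('b chain \<Rightarrow> complex) set \<Rightarrow> ('a chain \<Rightarrow> complex) set" where
  "cohomology_pullback p X f A =
     (\<Union>\<phi>\<in>A. coboundaries p X +>\<^bsub>cochains p X\<^esub> cochain_pullback p X f \<phi>)"

definition H_F\<^sub>0 ::
    "nat \<Rightarrow> (complex^'n^'n) set \<Rightarrow> ((complex^'n) set \<Rightarrow> complex^'n \<Rightarrow> complex) \<Rightarrow>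
     (complex, ((complex^'n) chain \<Rightarrow> complex) set) module" where
  "H_F\<^sub>0 p G l = cohomology p (top_of_set (F\<^sub>0 G l))"

definition \<Gamma>\<^sub>0_act_H ::
    "nat \<Rightarrow> (complex^'n^'n) set \<Rightarrow> ((complex^'n) set \<Rightarrow> complex^'n \<Rightarrow> complex) \<Rightarrow>
     (complex^'n^'n) \<times> complex \<Rightarrow>
     ((complex^'n) chain \<Rightarrow> complex) set \<Rightarrow> ((complex^'n) chain \<Rightarrow> complex) set" where
  "\<Gamma>\<^sub>0_act_H p G l \<gamma> =
     inv_into (carrier (H_F\<^sub>0 p G l)) (cohomology_pullback p (top_of_set (F\<^sub>0 G l)) (\<Gamma>_act \<gamma>))"


section \<open>Representations and the Grothendieck group\<close>

definition representation :: "'g monoid \<Rightarrow> (complex, 'v) module \<Rightarrow> ('g \<Rightarrow> 'v \<Rightarrow> 'v) \<Rightarrow> bool" where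
  "representation K V \<rho> \<longleftrightarrow> group K \<and> vectorspace complex_field V \<and>
     (\<forall>g\<in>carrier K. linear_map complex_field V V (\<rho> g)) \<and>
     (\<forall>v\<in>carrier V. \<rho> \<one>\<^bsub>K\<^esub> v = v) \<and>
     (\<forall>g\<in>carrier K. \<forall>h\<in>carrier K. \<forall>v\<in>carrier V. \<rho> (g \<otimes>\<^bsub>K\<^esub> h) v = \<rho> g (\<rho> h v))"

definition intertwiner ::
    "'g monoid \<Rightarrow> (complex, 'v) module \<Rightarrow> ('g \<Rightarrow> 'v \<Rightarrow> 'v) \<Rightarrow>
     (complex, 'w) module \<Rightarrow> ('g \<Rightarrow> 'w \<Rightarrow> 'w) \<Rightarrow> ('v \<Rightarrow> 'w) \<Rightarrow> bool" where
  "intertwiner K V \<rho> W \<sigma> f \<longleftrightarrow> linear_map complex_field V W f \<and>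
     (\<forall>g\<in>carrier K. \<forall>v\<in>carrier V. f (\<rho> g v) = \<sigma> g (f v))"

definition coord_space :: "nat \<Rightarrow> (complex, nat \<Rightarrow> complex) module" where
  "coord_space n = ring.func_space complex_field {..<n}"

text \<open>A finite-dimensional representation is isomorphic to one whose space is some $\mathbb C^n$.
  These coordinate representations form a set that meets every isomorphism class, so the
  Grothendieck group is built from them: the free abelian group on them modulo the relations that
  come from short exact sequences. Isomorphic representations are identified because the zero
  representation is one of the generators.\<close>

type_synonym 'g coord_rep = "nat \<times> ('g \<Rightarrow> (nat \<Rightarrow> complex) \<Rightarrow> nat \<Rightarrow> complex)"

definition coord_reps :: "'g monoid \<Rightarrow> 'g coord_rep set" where
  "coord_reps K = {(n, \<rho>). representation K (coord_space n) \<rho>}"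

definition short_exact ::
    "'g monoid \<Rightarrow> 'g coord_rep \<Rightarrow> 'g coord_rep \<Rightarrow> 'g coord_rep \<Rightarrow> bool" where
  "short_exact K A B C \<longleftrightarrow> A \<in> coord_reps K \<and> B \<in> coord_reps K \<and> C \<in> coord_reps K \<and>
     (let V\<^sub>A = coord_space (fst A); V\<^sub>B = coord_space (fst B); V\<^sub>C = coord_space (fst C) in
      \<exists>f h. intertwiner K V\<^sub>A (snd A) V\<^sub>B (snd B) f \<and> intertwiner K V\<^sub>B (snd B) V\<^sub>C (snd C) h \<and>
        inj_on f (carrier V\<^sub>A) \<and> h ` carrier V\<^sub>B = carrier V\<^sub>C \<and>
        f ` carrier V\<^sub>A = {v \<in> carrier V\<^sub>B. h v = \<zero>\<^bsub>V\<^sub>C\<^esub>})"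

definition grothendieck_relations :: "'g monoid \<Rightarrow> ('g coord_rep \<Rightarrow>\<^sub>0 int) set" where
  "grothendieck_relations K = generate (free_Abelian_group (coord_reps K))
     {frag_of B - frag_of A - frag_of C | A B C. short_exact K A B C}"

text \<open>The element of the Grothendieck group that a formal integer combination represents. This map
  is additive, and the statement uses only the additive structure of the Grothendieck ring.\<close>

definition grothendieck_class ::
    "'g monoid \<Rightarrow> ('g coord_rep \<Rightarrow>\<^sub>0 int) \<Rightarrow> ('g coord_rep \<Rightarrow>\<^sub>0 int) set" where
  "grothendieck_class K x = grothendieck_relations K #>\<^bsub>free_Abelian_group (coord_reps K)\<^esub> x"

text \<open>The representation \<open>\<rho>\<close> of \<open>K\<close> on \<open>V\<close> is finite-dimensional and its class is \<open>x\<close>.\<close>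

definition has_grothendieck_class ::
    "'g monoid \<Rightarrow> (complex, 'v) module \<Rightarrow> ('g \<Rightarrow> 'v \<Rightarrow> 'v) \<Rightarrow> ('g coord_rep \<Rightarrow>\<^sub>0 int) set \<Rightarrow> bool" where
  "has_grothendieck_class K V \<rho> x \<longleftrightarrow> representation K V \<rho> \<and>
     (\<exists>n \<sigma> f. (n, \<sigma>) \<in> coord_reps K \<and> intertwiner K V \<rho> (coord_space n) \<sigma> f \<and>
        bij_betw f (carrier V) (carrier (coord_space n)) \<and>
        x = grothendieck_class K (frag_of (n, \<sigma>)))"

text \<open>The character \<open>\<xi> \<mapsto> \<xi> ^ i\<close> of the group of roots of unity, on $\mathbb C^1$.\<close>

definition mu_character :: "nat \<Rightarrow> complex coord_rep" where
  "mu_character i = (1, \<lambda>\<xi> v. (\<xi> ^ i) \<odot>\<^bsub>coord_space 1\<^esub> v)"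

lemma one_times_mu_subset_\<Gamma>\<^sub>0:
  fixes G :: "(complex^'n^'n) set"
  assumes "finite_reflection_group G" and "defining_forms G l"
    and d: "d = card (arrangement G)" and "d > 0"
  shows "{Finite_Cartesian_Product.mat 1} \<times> carrier (mu d) \<subseteq> \<Gamma>\<^sub>0 G (d * e) l"
proof clarify
  fix \<xi> assume "\<xi> \<in> carrier (mu d)"
  then have x: "\<xi> ^ d = 1" and x0: "\<xi> \<noteq> 0" using \<open>d > 0\<close> by (auto simp: mu_def power_0_left)
  have hom: "Q\<^sub>0 G l (c *s v) = c ^ d * Q\<^sub>0 G l v" for c v
  proof -
    have "l H (c *s v) = c * l H v" if "H \<in> arrangement G" for H
    proof -
      interpret Vector_Spaces.linear "(*s)" "(*)" "l H"
        using assms(2) that by (auto simp: defining_forms_def)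
      show ?thesis by (rule scale)
    qed
    then show ?thesis
      by (simp add: Q\<^sub>0_def d prod.distrib)
  qed
  have one: "Finite_Cartesian_Product.mat 1 \<in> G"
    using assms(1) subgroup.one_closed[of G GL] by (auto simp: finite_reflection_group_def GL_def)
  have "\<Gamma>_act (Finite_Cartesian_Product.mat 1, \<xi>) ` F\<^sub>0 G l = F\<^sub>0 G l"
  proof
    show "\<Gamma>_act (Finite_Cartesian_Product.mat 1, \<xi>) ` F\<^sub>0 G l \<subseteq> F\<^sub>0 G l"
      using x by (auto simp: \<Gamma>_act_def F\<^sub>0_def hom power_inverse)
    show "F\<^sub>0 G l \<subseteq> \<Gamma>_act (Finite_Cartesian_Product.mat 1, \<xi>) ` F\<^sub>0 G l"
    proof
      fix v assume "v \<in> F\<^sub>0 G l"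
      then have "\<xi> *s v \<in> F\<^sub>0 G l" using x by (simp add: F\<^sub>0_def hom)
      moreover have "v = \<Gamma>_act (Finite_Cartesian_Product.mat 1, \<xi>) (\<xi> *s v)"
        using x0 by (simp add: \<Gamma>_act_def)
      ultimately show "v \<in> \<Gamma>_act (Finite_Cartesian_Product.mat 1, \<xi>) ` F\<^sub>0 G l" by blast
    qed
  qed
  then show "(Finite_Cartesian_Product.mat 1, \<xi>) \<in> \<Gamma>\<^sub>0 G (d * e) l"
    using one x by (simp add: \<Gamma>\<^sub>0_def \<Gamma>_def mu_def DirProd_def power_mult)
qed

end

theory Submission
  imports Defs
begin

text \<open>Let \<open>x\<close> be one of the \<open>d\<close> linear forms and \<open>y\<close> another one. In the coordinates \<open>u = 1 / x\<close>,
  \<open>t = y / x\<close> the fibre \<open>F\<^sub>0\<close> is the curve \<open>u ^ d = \<kappa> * (\<Prod>j. t - a j)\<close> with \<open>d - 1\<close> distinct roots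
  \<open>a j\<close>, a cyclic cover of the punctured plane. Scale \<open>y\<close> such that the roots have distinct real
  parts. The plane slit along the upward rays from the roots and the plane slit along the downward rays
  are contractible, so the cover is trivial over them, and they meet in \<open>d\<close> vertical strips. By
  Mayer--Vietoris, \<open>H\<^sup>1(F\<^sub>0)\<close> is the first cohomology of a bipartite graph: the vertices
  are the \<open>2 * d\<close> sheets over the slit planes, the edges are the \<open>d * d\<close> strips, and the group
  \<open>\<mu>\<^sub>d\<close> permutes them freely. Crossing a puncture multiplies the ratio of the two branches of the
  root by a primitive \<open>d\<close>-th root of unity, which determines the graph. Fourier transformation over
  \<open>\<mu>\<^sub>d\<close> then computes, for each character, the quotient of a \<open>d\<close>-dimensional space by two vectors, which
  are linearly dependent only for the trivial character.\<close>

section \<open>Representations of groups of roots of unity\<close>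

text \<open>In place of the Mayer--Vietoris sequence there is one map on cocycles: evaluation on a
  fixed path for each edge of the graph. Coboundaries have graph coboundaries as values. If the
  values of a cocycle form a graph coboundary, its primitives on the sheets can be shifted by
  constants until they agree on the strips; as the sheets are an open cover, subdivision makes the
  glued function a primitive. Surjectivity needs actual cocycles, and each strip supplies one, the
  change of logarithm of a function that winds once across it. The paths over all sheets are
  translates of a few by the group, so the map is equivariant on the nose and the Fourier transform
  applies to it. Distinct real parts keep the slits disjoint and order the punctures from left to
  right. Strip number \<open>k\<close> then has exactly \<open>k\<close> punctures to its left, and
  there the two branches differ by the \<open>k\<close>-th power of the primitive root; on the
  Fourier side these powers become the vector \<open>j \<mapsto> t ^ j\<close>. Three inverses have
  to be tracked: \<xi> scales \<open>v\<close> by its inverse, \<open>u\<close> is an inverse of a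
  linear form, and the group acts on cohomology by the inverse of the pullback.\<close>

lemma field_complex_field: "Ring.field complex_field"
proof -
  have "abelian_group complex_field"
    by (rule abelian_groupI) (auto simp: complex_field_def intro: exI[of _ "- _"] left_minus)
  moreover have "comm_monoid complex_field"
    by (rule comm_monoidI) (auto simp: complex_field_def)
  ultimately have "cring complex_field"
    by (rule cringI) (simp add: complex_field_def distrib_right)
  moreover have "Units complex_field = carrier complex_field - {\<zero>\<^bsub>complex_field\<^esub>}"
  proof -
    have "\<exists>y. y * x = 1 \<and> x * y = 1" if "x \<noteq> 0" for x :: complex
      by (rule exI[of _ "inverse x"]) (use that in simp)
    then show ?thesis by (auto simp: complex_field_def Units_def)
  qed
  ultimately show ?thesis
    by (rule cring.cring_fieldI)
qed

lemma ring_complex_field: "ring complex_field"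
  by (rule cring.axioms(1)[OF fieldE(1)[OF field_complex_field]])

lemma coord_space_eq:
  "coord_space n = \<lparr>carrier = {..<n} \<rightarrow>\<^sub>E UNIV, monoid.mult = \<lambda>f g. \<lambda>v\<in>{..<n}. 0,
     one = \<lambda>v\<in>{..<n}. 0, zero = \<lambda>v\<in>{..<n}. 0, add = \<lambda>f g. \<lambda>v\<in>{..<n}. f v + g v,
     smult = \<lambda>c f. \<lambda>v\<in>{..<n}. c * f v\<rparr>"
  by (simp add: coord_space_def ring.func_space_def[OF ring_complex_field])
     (simp add: complex_field_def)

lemma vectorspace_coord_space: "vectorspace complex_field (coord_space n)"
  unfolding vectorspace_def coord_space_def
  using cring.func_space_is_module[OF fieldE(1)[OF field_complex_field]] field_complex_field by blast

text \<open>Spares a verification of the module axioms on cosets: the axioms are equations, and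
  equations in \<open>V\<close> can be tested after the injective map \<open>f\<close>. Surjectivity
  supplies the negatives.\<close>

lemma vectorspace_transport:
  assumes W: "vectorspace K W" and f: "bij_betw f (carrier V) (carrier W)"
    and add: "\<And>x y. x \<in> carrier V \<Longrightarrow> y \<in> carrier V \<Longrightarrow>
      x \<oplus>\<^bsub>V\<^esub> y \<in> carrier V \<and> f (x \<oplus>\<^bsub>V\<^esub> y) = f x \<oplus>\<^bsub>W\<^esub> f y"
    and zero: "\<zero>\<^bsub>V\<^esub> \<in> carrier V" "f \<zero>\<^bsub>V\<^esub> = \<zero>\<^bsub>W\<^esub>"
    and smult: "\<And>c x. c \<in> carrier K \<Longrightarrow> x \<in> carrier V \<Longrightarrow>
      c \<odot>\<^bsub>V\<^esub> x \<in> carrier V \<and> f (c \<odot>\<^bsub>V\<^esub> x) = c \<odot>\<^bsub>W\<^esub> f x"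
  shows "vectorspace K V"
proof -
  interpret W: vectorspace K W by (rule W)
  have fc: "f x \<in> carrier W" if "x \<in> carrier V" for x
    using f that by (auto simp: bij_betw_def)
  have eqI: "x = y" if "x \<in> carrier V" "y \<in> carrier V" "f x = f y" for x y
    using f that by (auto simp: bij_betw_def dest: inj_onD)
  have "abelian_group V"
  proof (rule abelian_groupI)
    fix x assume x: "x \<in> carrier V"
    obtain y where y: "y \<in> carrier V" "f y = \<ominus>\<^bsub>W\<^esub> f x"
      using f fc[OF x] by (metis W.a_inv_closed bij_betw_iff_bijections)
    have "y \<oplus>\<^bsub>V\<^esub> x = \<zero>\<^bsub>V\<^esub>"
      by (rule eqI) (use x y add zero fc W.M.l_neg in auto)
    then show "\<exists>y\<in>carrier V. y \<oplus>\<^bsub>V\<^esub> x = \<zero>\<^bsub>V\<^esub>" using y by blast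
  next
    fix x y z assume "x \<in> carrier V" "y \<in> carrier V" "z \<in> carrier V"
    then show "x \<oplus>\<^bsub>V\<^esub> y \<oplus>\<^bsub>V\<^esub> z = x \<oplus>\<^bsub>V\<^esub> (y \<oplus>\<^bsub>V\<^esub> z)"
      by (intro eqI) (auto simp: add fc W.M.a_assoc)
  next
    fix x y assume "x \<in> carrier V" "y \<in> carrier V"
    then show "x \<oplus>\<^bsub>V\<^esub> y = y \<oplus>\<^bsub>V\<^esub> x"
      by (intro eqI) (auto simp: add fc W.M.a_comm)
  next
    fix x assume "x \<in> carrier V"
    then show "\<zero>\<^bsub>V\<^esub> \<oplus>\<^bsub>V\<^esub> x = x"
      by (intro eqI) (auto simp: add fc zero)
  qed (use add zero in auto)
  then have "module K V"
  proof (rule moduleI[OF W.R.is_cring])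
    fix a b x assume "a \<in> carrier K" "b \<in> carrier K" "x \<in> carrier V"
    then show "(a \<oplus>\<^bsub>K\<^esub> b) \<odot>\<^bsub>V\<^esub> x = a \<odot>\<^bsub>V\<^esub> x \<oplus>\<^bsub>V\<^esub> b \<odot>\<^bsub>V\<^esub> x"
      "a \<otimes>\<^bsub>K\<^esub> b \<odot>\<^bsub>V\<^esub> x = a \<odot>\<^bsub>V\<^esub> (b \<odot>\<^bsub>V\<^esub> x)"
      by (auto intro!: eqI simp: add smult fc W.smult_l_distr W.smult_assoc1)
  next
    fix a x y assume "a \<in> carrier K" "x \<in> carrier V" "y \<in> carrier V"
    then show "a \<odot>\<^bsub>V\<^esub> (x \<oplus>\<^bsub>V\<^esub> y) = a \<odot>\<^bsub>V\<^esub> x \<oplus>\<^bsub>V\<^esub> a \<odot>\<^bsub>V\<^esub> y"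
      by (auto intro!: eqI simp: add smult fc W.smult_r_distr)
  next
    fix x assume "x \<in> carrier V"
    then show "\<one>\<^bsub>K\<^esub> \<odot>\<^bsub>V\<^esub> x = x"
      by (auto intro!: eqI simp: smult fc)
  qed (use smult in auto)
  then show ?thesis
    by (simp add: vectorspace_def W.field_axioms)
qed

text \<open>The same device for an action. The two conclusions are what
  \<open>has_grothendieck_class\<close> asks of an isomorphism with a coordinate
  representation.\<close>

lemma representation_transport:
  assumes W: "representation K W \<sigma>" and f: "bij_betw f (carrier V) (carrier W)"
    and add: "\<And>x y. x \<in> carrier V \<Longrightarrow> y \<in> carrier V \<Longrightarrow>
      x \<oplus>\<^bsub>V\<^esub> y \<in> carrier V \<and> f (x \<oplus>\<^bsub>V\<^esub> y) = f x \<oplus>\<^bsub>W\<^esub> f y"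
    and zero: "\<zero>\<^bsub>V\<^esub> \<in> carrier V" "f \<zero>\<^bsub>V\<^esub> = \<zero>\<^bsub>W\<^esub>"
    and smult: "\<And>c x. x \<in> carrier V \<Longrightarrow>
      c \<odot>\<^bsub>V\<^esub> x \<in> carrier V \<and> f (c \<odot>\<^bsub>V\<^esub> x) = c \<odot>\<^bsub>W\<^esub> f x"
    and act: "\<And>g x. g \<in> carrier K \<Longrightarrow> x \<in> carrier V \<Longrightarrow>
      \<rho> g x \<in> carrier V \<and> f (\<rho> g x) = \<sigma> g (f x)"
  shows "representation K V \<rho>" and "intertwiner K V \<rho> W \<sigma> f"
proof -
  have vW: "vectorspace complex_field W" using W by (simp add: representation_def)
  have vV: "vectorspace complex_field V"
    by (rule vectorspace_transport[OF vW f]) (use add zero smult in auto)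
  have fc: "f x \<in> carrier W" if "x \<in> carrier V" for x
    using f that by (auto simp: bij_betw_def)
  have eqI: "x = y" if "x \<in> carrier V" "y \<in> carrier V" "f x = f y" for x y
    using f that by (auto simp: bij_betw_def dest: inj_onD)
  have \<sigma>: "\<sigma> g \<in> module_hom complex_field W W" if "g \<in> carrier K" for g
    using W that by (auto simp: representation_def linear_map_def mod_hom_def mod_hom_axioms_def)
  have "linear_map complex_field V V (\<rho> g)" if g: "g \<in> carrier K" for g
  proof -
    have "\<rho> g \<in> module_hom complex_field V V"
      unfolding module_hom_def
      using g \<sigma>[OF g] by (auto intro!: eqI simp: act add smult fc module_hom_def)
    then show ?thesis
      using vV by (auto simp: linear_map_def mod_hom_def mod_hom_axioms_def vectorspace_def)
  qed
  moreover have "group K" using W by (simp add: representation_def)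
  moreover have "\<rho> \<one>\<^bsub>K\<^esub> v = v" if "v \<in> carrier V" for v
    using W that group.is_monoid[OF \<open>group K\<close>]
    by (auto intro!: eqI simp: act fc representation_def monoid.one_closed)
  moreover have "\<rho> (g \<otimes>\<^bsub>K\<^esub> h) v = \<rho> g (\<rho> h v)"
    if "g \<in> carrier K" "h \<in> carrier K" "v \<in> carrier V" for g h v
    using W that group.is_monoid[OF \<open>group K\<close>]
    by (auto intro!: eqI simp: act fc representation_def monoid.m_closed)
  ultimately show "representation K V \<rho>"
    using vV by (simp add: representation_def)
  have "f \<in> module_hom complex_field V W"
    unfolding module_hom_def using add smult fc by auto
  then have "linear_map complex_field V W f"
    using vV vW by (auto simp: linear_map_def mod_hom_def mod_hom_axioms_def vectorspace_def)
  then show "intertwiner K V \<rho> W \<sigma> f"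
    using act by (simp add: intertwiner_def)
qed

lemma group_mu:
  assumes "d > 0"
  shows "group (mu d)"
proof (rule groupI)
  fix x assume x: "x \<in> carrier (mu d)"
  then have "x \<noteq> 0" using assms by (auto simp: mu_def power_0_left)
  then show "\<exists>y\<in>carrier (mu d). y \<otimes>\<^bsub>mu d\<^esub> x = \<one>\<^bsub>mu d\<^esub>"
    using x by (intro bexI[of _ "inverse x"]) (auto simp: mu_def power_inverse)
qed (auto simp: mu_def power_mult_distrib)

text \<open>The direct sum of the characters \<open>mu_character (c k)\<close> for
  \<open>k < n\<close>, written as a single coordinate representation so that exact sequences can
  split off its last summand.\<close>

definition diag_rep :: "nat \<Rightarrow> (nat \<Rightarrow> nat) \<Rightarrow> complex coord_rep" where
  "diag_rep n c = (n, \<lambda>\<xi> v. \<lambda>k\<in>{..<n}. \<xi> ^ c k * v k)"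

lemma mu_character_eq_diag_rep: "mu_character i = diag_rep 1 (\<lambda>_. i)"
  by (simp add: mu_character_def diag_rep_def coord_space_eq)

lemma linear_map_coord_spaceI:
  assumes "f \<in> carrier (coord_space n) \<rightarrow> carrier (coord_space m)"
    and "\<And>x y. x \<in> carrier (coord_space n) \<Longrightarrow> y \<in> carrier (coord_space n) \<Longrightarrow>
      f (x \<oplus>\<^bsub>coord_space n\<^esub> y) = f x \<oplus>\<^bsub>coord_space m\<^esub> f y"
    and "\<And>c x. x \<in> carrier (coord_space n) \<Longrightarrow>
      f (c \<odot>\<^bsub>coord_space n\<^esub> x) = c \<odot>\<^bsub>coord_space m\<^esub> f x"
  shows "linear_map complex_field (coord_space n) (coord_space m) f"
  using assms vectorspace_coord_space[of n] vectorspace_coord_space[of m]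
  by (auto simp: linear_map_def mod_hom_def mod_hom_axioms_def vectorspace_def module_hom_def)

lemma diag_rep_coord_reps:
  assumes "d > 0"
  shows "diag_rep n c \<in> coord_reps (mu d)"
proof -
  have "linear_map complex_field (coord_space n) (coord_space n) (\<lambda>v. \<lambda>k\<in>{..<n}. \<xi> ^ c k * v k)" for \<xi>
    by (rule linear_map_coord_spaceI) (auto simp: coord_space_eq fun_eq_iff algebra_simps)
  moreover have "(\<lambda>k\<in>{..<n}. 1 ^ c k * v k) = v" if "v \<in> carrier (coord_space n)" for v
    using that by (auto simp: coord_space_eq fun_eq_iff PiE_iff extensional_def)
  ultimately show ?thesis
    using vectorspace_coord_space[of n] group_mu[OF assms]
    by (auto simp: coord_reps_def diag_rep_def representation_def power_mult_distrib mu_def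
        algebra_simps fun_eq_iff)
qed

text \<open>The vectors with vanishing last coordinate form a subrepresentation; the quotient by it
  is the last coordinate, on which \<xi> acts as \<open>\<xi> ^ c n\<close>.\<close>

lemma short_exact_diag_rep:
  assumes "d > 0"
  shows "short_exact (mu d) (diag_rep n c) (diag_rep (Suc n) c) (mu_character (c n))"
proof -
  define f :: "(nat \<Rightarrow> complex) \<Rightarrow> nat \<Rightarrow> complex"
    where "f v = (\<lambda>k\<in>{..<Suc n}. if k < n then v k else 0)" for v
  define h :: "(nat \<Rightarrow> complex) \<Rightarrow> nat \<Rightarrow> complex" where "h v = (\<lambda>k\<in>{..<1}. v n)" for v
  have "linear_map complex_field (coord_space n) (coord_space (Suc n)) f"
    by (rule linear_map_coord_spaceI) (auto simp: coord_space_eq f_def fun_eq_iff)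
  then have f: "intertwiner (mu d) (coord_space n) (snd (diag_rep n c))
      (coord_space (Suc n)) (snd (diag_rep (Suc n) c)) f"
    by (auto simp: intertwiner_def f_def diag_rep_def fun_eq_iff)
  have "linear_map complex_field (coord_space (Suc n)) (coord_space 1) h"
    by (rule linear_map_coord_spaceI) (auto simp: coord_space_eq h_def fun_eq_iff)
  then have h: "intertwiner (mu d) (coord_space (Suc n)) (snd (diag_rep (Suc n) c))
      (coord_space 1) (snd (mu_character (c n))) h"
    by (auto simp: intertwiner_def h_def diag_rep_def fun_eq_iff mu_character_eq_diag_rep)
  have inj: "inj_on f (carrier (coord_space n))"
  proof (rule inj_onI)
    fix x y assume x: "x \<in> carrier (coord_space n)" "y \<in> carrier (coord_space n)" and "f x = f y"
    have "x k = y k" if "k < n" for k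
      using fun_cong[OF \<open>f x = f y\<close>, of k] that by (simp add: f_def)
    then show "x = y"
      using x by (auto simp: coord_space_eq PiE_iff intro!: extensionalityI[of x "{..<n}" y])
  qed
  have surj: "h ` carrier (coord_space (Suc n)) = carrier (coord_space 1)"
  proof (intro equalityI subsetI)
    fix y assume y: "y \<in> carrier (coord_space 1)"
    then have "y = h (\<lambda>k\<in>{..<Suc n}. y 0)"
      by (auto simp: h_def coord_space_eq fun_eq_iff PiE_iff extensional_def)
    moreover have "(\<lambda>k\<in>{..<Suc n}. y 0) \<in> carrier (coord_space (Suc n))"
      by (simp add: coord_space_eq)
    ultimately show "y \<in> h ` carrier (coord_space (Suc n))"
      by (rule rev_image_eqI[rotated])
  qed (auto simp: h_def coord_space_eq)
  have ker: "f ` carrier (coord_space n) = {v \<in> carrier (coord_space (Suc n)). h v = \<zero>\<^bsub>coord_space 1\<^esub>}"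
  proof (intro equalityI subsetI)
    fix v assume v: "v \<in> {v \<in> carrier (coord_space (Suc n)). h v = \<zero>\<^bsub>coord_space 1\<^esub>}"
    then have "h v 0 = \<zero>\<^bsub>coord_space 1\<^esub> 0" by simp
    then have "v n = 0" by (simp add: h_def coord_space_eq)
    then have "v = f (restrict v {..<n})"
      using v by (auto simp: f_def coord_space_eq fun_eq_iff PiE_iff extensional_def less_Suc_eq)
    moreover have "restrict v {..<n} \<in> carrier (coord_space n)"
      by (simp add: coord_space_eq)
    ultimately show "v \<in> f ` carrier (coord_space n)"
      by (rule rev_image_eqI[rotated])
  next
    fix v assume "v \<in> f ` carrier (coord_space n)"
    then obtain x where "v = f x" by blast
    then show "v \<in> {v \<in> carrier (coord_space (Suc n)). h v = \<zero>\<^bsub>coord_space 1\<^esub>}"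
      by (simp add: f_def h_def coord_space_eq)
  qed
  have "mu_character (c n) \<in> coord_reps (mu d)"
    by (simp add: mu_character_eq_diag_rep diag_rep_coord_reps[OF assms])
  then show ?thesis
    using f h inj surj ker diag_rep_coord_reps[OF assms]
    unfolding short_exact_def Let_def
    by (simp add: mu_character_def diag_rep_def) blast
qed

section \<open>Classes of diagonal representations in the Grothendieck group\<close>

lemma subgroup_grothendieck_relations:
  "subgroup (grothendieck_relations K) (free_Abelian_group (coord_reps K))"
  unfolding grothendieck_relations_def
proof (rule group.generate_is_subgroup)
  have "frag_of B - frag_of A - frag_of C \<in> carrier (free_Abelian_group (coord_reps K))"
    if "short_exact K A B C" for A B C
    using that by (auto simp: short_exact_def free_Abelian_group_def dest!: subsetD[OF keys_diff])
  then show "{frag_of B - frag_of A - frag_of C |A B C. short_exact K A B C}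
      \<subseteq> carrier (free_Abelian_group (coord_reps K))"
    by blast
qed simp

lemma grothendieck_class_eqI:
  assumes "x - y \<in> grothendieck_relations K"
  shows "grothendieck_class K x = grothendieck_class K y"
proof -
  interpret subgroup "grothendieck_relations K" "free_Abelian_group (coord_reps K)"
    by (rule subgroup_grothendieck_relations)
  have add: "a + b \<in> grothendieck_relations K"
    if "a \<in> grothendieck_relations K" "b \<in> grothendieck_relations K" for a b
    using m_closed[OF that] by (simp add: free_Abelian_group_def)
  have minus: "- a \<in> grothendieck_relations K" if "a \<in> grothendieck_relations K" for a
    using m_inv_closed[OF that] subsetD[OF subset that] by simp
  have eq: "grothendieck_class K z = (\<lambda>r. r + z) ` grothendieck_relations K" for z
    by (auto simp: grothendieck_class_def r_coset_def free_Abelian_group_def)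
  have "r + x \<in> (\<lambda>r. r + y) ` grothendieck_relations K" if "r \<in> grothendieck_relations K" for r
    by (rule image_eqI[OF _ add[OF that assms]]) simp
  moreover have "r + y \<in> (\<lambda>r. r + x) ` grothendieck_relations K" if "r \<in> grothendieck_relations K" for r
    by (rule image_eqI[OF _ add[OF that minus[OF assms]]]) simp
  ultimately show ?thesis
    unfolding eq by blast
qed

text \<open>Induction on the assertion that the difference of the two sides is a relation: each step
  adds the relation of one extension by a character.\<close>

lemma grothendieck_class_diag_rep:
  assumes "d > 0"
  shows "grothendieck_class (mu d) (frag_of (diag_rep n c)) =
    grothendieck_class (mu d) (\<Sum>k<n. frag_of (mu_character (c k)))"
proof (rule grothendieck_class_eqI, induction n)
  let ?R = "grothendieck_relations (mu d)"
  interpret subgroup ?R "free_Abelian_group (coord_reps (mu d))"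
    by (rule subgroup_grothendieck_relations)
  have rel: "frag_of B - frag_of A - frag_of C \<in> ?R" if "short_exact (mu d) A B C" for A B C
    unfolding grothendieck_relations_def by (rule generate.incl) (use that in blast)
  {
    case 0
    have "linear_map complex_field (coord_space 0) (coord_space 0) (\<lambda>v. v)"
      by (rule linear_map_coord_spaceI) auto
    then have "intertwiner (mu d) (coord_space 0) (snd (diag_rep 0 c))
        (coord_space 0) (snd (diag_rep 0 c)) (\<lambda>v. v)"
      by (simp add: intertwiner_def)
    moreover have "fst (diag_rep 0 c) = 0" by (simp add: diag_rep_def)
    \<comment> \<open>With the zero representation in all three places the relation reads
      \<open>- frag_of (diag_rep 0 c)\<close>; its inverse shows that the zero representation has
      class zero.\<close>
    ultimately have "short_exact (mu d) (diag_rep 0 c) (diag_rep 0 c) (diag_rep 0 c)"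
      unfolding short_exact_def Let_def
      by (intro conjI exI[of _ "\<lambda>v. v"] diag_rep_coord_reps[OF assms])
         (simp_all, auto simp: coord_space_eq)
    from m_inv_closed[OF rel[OF this]] show ?case
      using diag_rep_coord_reps[OF assms, of 0 c] by simp
  next
    case (Suc n)
    from m_closed[OF rel[OF short_exact_diag_rep[OF assms, of n c]] Suc.IH] show ?case
      by (simp add: free_Abelian_group_def algebra_simps)
  }
qed

section \<open>Cochains and cohomology\<close>

lemma cochains_simps:
  "carrier (cochains p X) = hom (chain_group p X) (add_monoid complex_field) \<inter>
     extensional (singular_chain_set p X)"
  "\<phi> \<oplus>\<^bsub>cochains p X\<^esub> \<psi> = (\<lambda>c\<in>singular_chain_set p X. \<phi> c + \<psi> c)"
  "\<zero>\<^bsub>cochains p X\<^esub> = (\<lambda>c\<in>singular_chain_set p X. 0)"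
  "a \<odot>\<^bsub>cochains p X\<^esub> \<phi> = (\<lambda>c\<in>singular_chain_set p X. a * \<phi> c)"
  by (simp_all add: cochains_def ring.func_space_def[OF ring_complex_field])
     (simp_all add: complex_field_def)

lemma in_cochains_iff:
  "\<phi> \<in> carrier (cochains p X) \<longleftrightarrow> \<phi> \<in> extensional (singular_chain_set p X) \<and>
    (\<forall>a b. singular_chain p X a \<longrightarrow> singular_chain p X b \<longrightarrow> \<phi> (a + b) = \<phi> a + \<phi> b)"
proof -
  have "a \<otimes>\<^bsub>chain_group p X\<^esub> b = a + b" for a b
    by (simp add: chain_group_def)
  then show ?thesis
    unfolding cochains_simps by (auto simp: hom_def complex_field_def)
qed

lemma in_cocycles_iff:
  "\<phi> \<in> cocycles p X \<longleftrightarrow> \<phi> \<in> carrier (cochains p X) \<and>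
    (\<forall>c. singular_chain (Suc p) X c \<longrightarrow> \<phi> (chain_boundary (Suc p) c) = 0)"
proof -
  have "coboundary p X \<phi> = \<zero>\<^bsub>cochains (Suc p) X\<^esub> \<longleftrightarrow>
      (\<forall>c. singular_chain (Suc p) X c \<longrightarrow> \<phi> (chain_boundary (Suc p) c) = 0)"
    unfolding coboundary_def cochains_simps fun_eq_iff by (auto simp: restrict_def)
  then show ?thesis
    by (simp add: cocycles_def)
qed

lemma cochain_0:
  assumes "\<phi> \<in> carrier (cochains p X)"
  shows "\<phi> 0 = 0"
  using assms unfolding in_cochains_iff by (metis add.right_neutral add_cancel_left_right singular_chain_0)

lemma cochain_minus:
  assumes "\<phi> \<in> carrier (cochains p X)" "singular_chain p X a"
  shows "\<phi> (- a) = - \<phi> a"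
proof -
  have "\<phi> (a + - a) = \<phi> a + \<phi> (- a)"
    using assms singular_chain_minus[of p X a] unfolding in_cochains_iff by blast
  then show ?thesis
    using cochain_0[OF assms(1)] by (simp add: eq_neg_iff_add_eq_0 add.commute)
qed

lemma cochain_add:
  assumes "\<phi> \<in> carrier (cochains p X)" "singular_chain p X a" "singular_chain p X b"
  shows "\<phi> (a + b) = \<phi> a + \<phi> b"
  using assms by (simp add: in_cochains_iff)

lemma cochain_diff:
  assumes "\<phi> \<in> carrier (cochains p X)" "singular_chain p X a" "singular_chain p X b"
  shows "\<phi> (a - b) = \<phi> a - \<phi> b"
  using cochain_add[OF assms(1,2), of "- b"] cochain_minus[OF assms(1,3)] singular_chain_minus assms(3)
  by force

lemma cocycles_add:
  assumes "\<phi> \<in> cocycles p X" "\<psi> \<in> cocycles p X"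
  shows "\<phi> \<oplus>\<^bsub>cochains p X\<^esub> \<psi> \<in> cocycles p X"
  using assms
  by (auto simp: in_cocycles_iff in_cochains_iff cochains_simps(2) singular_chain_add
      singular_chain_boundary_alt)

lemma cocycles_smult:
  assumes "\<phi> \<in> cocycles p X"
  shows "a \<odot>\<^bsub>cochains p X\<^esub> \<phi> \<in> cocycles p X"
  using assms
  by (auto simp: in_cocycles_iff in_cochains_iff cochains_simps(4) singular_chain_add
      singular_chain_boundary_alt distrib_left)

lemma coboundaries_subset_cocycles: "coboundaries (Suc q) X \<subseteq> cocycles (Suc q) X"
proof
  fix \<psi> assume "\<psi> \<in> coboundaries (Suc q) X"
  then obtain \<phi> where \<phi>: "\<phi> \<in> carrier (cochains q X)" and \<psi>: "\<psi> = coboundary q X \<phi>"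
    by (auto simp: coboundaries_def)
  have "\<psi> (chain_boundary (Suc (Suc q)) c) = 0" if "singular_chain (Suc (Suc q)) X c" for c
    using singular_chain_boundary_alt[OF that] chain_boundary_boundary_alt[OF that] cochain_0[OF \<phi>]
    by (simp add: \<psi> coboundary_def)
  moreover have "\<psi> \<in> carrier (cochains (Suc q) X)"
    using cochain_add[OF \<phi>]
    by (auto simp: in_cochains_iff \<psi> coboundary_def chain_boundary_add singular_chain_add
        singular_chain_boundary_alt)
  ultimately show "\<psi> \<in> cocycles (Suc q) X"
    by (simp add: in_cocycles_iff)
qed

lemma cochain_pullback_cocycles:
  assumes "\<phi> \<in> cocycles p Y" and f: "continuous_map X Y f"
  shows "cochain_pullback p X f \<phi> \<in> cocycles p X"
proof -
  have "\<phi> (chain_map p f (chain_boundary (Suc p) c)) = 0" if "singular_chain (Suc p) X c" for c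
    using assms singular_chain_chain_map[OF that f] that chain_boundary_chain_map[OF that, of f]
    by (auto simp: in_cocycles_iff)
  then show ?thesis
    using assms
    by (auto simp: in_cocycles_iff in_cochains_iff cochain_pullback_def singular_chain_boundary_alt
        singular_chain_add chain_map_add singular_chain_chain_map)
qed

text \<open>The group element \<open>\<xi>\<close> acts by the inverse of the pullback, so \<open>\<xi> ^ c k\<close> stands on the side of
  the pullback in the last hypothesis.\<close>

lemma has_grothendieck_class_cohomology:
  assumes d: "d > 0"
    and \<Phi>: "\<And>\<phi>. \<phi> \<in> cocycles (Suc q) X \<Longrightarrow> \<Phi> \<phi> \<in> carrier (coord_space N)"
    and add: "\<And>\<phi> \<psi>. \<phi> \<in> cocycles (Suc q) X \<Longrightarrow> \<psi> \<in> cocycles (Suc q) X \<Longrightarrow>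
      \<Phi> (\<phi> \<oplus>\<^bsub>cochains (Suc q) X\<^esub> \<psi>) = \<Phi> \<phi> \<oplus>\<^bsub>coord_space N\<^esub> \<Phi> \<psi>"
    and smult: "\<And>a \<phi>. \<phi> \<in> cocycles (Suc q) X \<Longrightarrow>
      \<Phi> (a \<odot>\<^bsub>cochains (Suc q) X\<^esub> \<phi>) = a \<odot>\<^bsub>coord_space N\<^esub> \<Phi> \<phi>"
    and surj: "carrier (coord_space N) \<subseteq> \<Phi> ` cocycles (Suc q) X"
    and ker: "\<And>\<phi>. \<phi> \<in> cocycles (Suc q) X \<Longrightarrow>
      \<Phi> \<phi> = \<zero>\<^bsub>coord_space N\<^esub> \<longleftrightarrow> \<phi> \<in> coboundaries (Suc q) X"
    and cont: "\<And>\<xi>. \<xi> \<in> carrier (mu d) \<Longrightarrow> continuous_map X X (A \<xi>)"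
    and pullback: "\<And>\<xi> \<phi> k. \<xi> \<in> carrier (mu d) \<Longrightarrow> \<phi> \<in> cocycles (Suc q) X \<Longrightarrow> k < N \<Longrightarrow>
      \<xi> ^ c k * \<Phi> (cochain_pullback (Suc q) X (A \<xi>) \<phi>) k = \<Phi> \<phi> k"
  shows "has_grothendieck_class (mu d) (cohomology (Suc q) X)
    (\<lambda>\<xi>. inv_into (carrier (cohomology (Suc q) X)) (cohomology_pullback (Suc q) X (A \<xi>)))
    (grothendieck_class (mu d) (\<Sum>k<N. frag_of (mu_character (c k))))"
proof -
  define W where "W = coord_space N"
  define Z where "Z = cocycles (Suc q) X"
  define B where "B = coboundaries (Suc q) X"
  define C where "C = cochains (Suc q) X"
  define H where "H = cohomology (Suc q) X"
  define M where "M = C\<lparr>carrier := Z\<rparr>"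
  define \<sigma> where "\<sigma> = snd (diag_rep N c)"
  \<comment> \<open>By \<open>ker\<close>, the cosets of the coboundaries are the fibres of \<Phi>.
    Cohomology is thereby identified with \<open>W\<close>, and every operation on it is computed on
    fibres; \<open>f\<close> will be the inverse of \<open>fib\<close>.\<close>
  define fib where "fib v = {\<psi> \<in> Z. \<Phi> \<psi> = v}" for v
  define f where "f A = the_elem (\<Phi> ` A)" for A
  note defs = W_def Z_def B_def C_def
  interpret W: vectorspace complex_field W
    unfolding W_def by (rule vectorspace_coord_space)
  have \<Phi>W: "\<Phi> \<phi> \<in> carrier W" if "\<phi> \<in> Z" for \<phi>
    using \<Phi> that by (simp add: defs)
  have Zadd: "\<phi> \<oplus>\<^bsub>C\<^esub> \<psi> \<in> Z" "\<Phi> (\<phi> \<oplus>\<^bsub>C\<^esub> \<psi>) = \<Phi> \<phi> \<oplus>\<^bsub>W\<^esub> \<Phi> \<psi>" if "\<phi> \<in> Z" "\<psi> \<in> Z" for \<phi> \<psi>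
    using that cocycles_add add by (auto simp: defs)
  have Zsmult: "a \<odot>\<^bsub>C\<^esub> \<phi> \<in> Z" "\<Phi> (a \<odot>\<^bsub>C\<^esub> \<phi>) = a \<odot>\<^bsub>W\<^esub> \<Phi> \<phi>" if "\<phi> \<in> Z" for a \<phi>
    using that cocycles_smult smult by (auto simp: defs)
  have BZ: "B \<subseteq> Z"
    unfolding defs by (rule coboundaries_subset_cocycles)
  have kerB: "\<phi> \<in> B \<longleftrightarrow> \<Phi> \<phi> = \<zero>\<^bsub>W\<^esub>" if "\<phi> \<in> Z" for \<phi>
    using ker that by (simp add: defs)
  have extZ: "\<phi> \<in> extensional (singular_chain_set (Suc q) X)" if "\<phi> \<in> Z" for \<phi>
    using that by (simp add: defs in_cocycles_iff in_cochains_iff)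
  \<comment> \<open>Serves as subtraction of cocycles: the difference is built as
    \<open>\<psi>\<close> plus \<open>- 1\<close> times \<open>\<phi>\<close>.\<close>
  have diff: "\<exists>\<delta>\<in>Z. \<psi> = \<delta> \<oplus>\<^bsub>C\<^esub> \<phi> \<and> \<psi> = \<phi> \<oplus>\<^bsub>C\<^esub> \<delta> \<and> \<Phi> \<psi> = \<Phi> \<delta> \<oplus>\<^bsub>W\<^esub> \<Phi> \<phi>"
    if \<phi>: "\<phi> \<in> Z" and \<psi>: "\<psi> \<in> Z" for \<phi> \<psi>
  proof -
    let ?\<delta> = "\<psi> \<oplus>\<^bsub>C\<^esub> ((-1) \<odot>\<^bsub>C\<^esub> \<phi>)"
    have "?\<delta> \<in> Z" by (intro Zadd Zsmult \<phi> \<psi>)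
    moreover have "\<psi> = ?\<delta> \<oplus>\<^bsub>C\<^esub> \<phi>" "\<psi> = \<phi> \<oplus>\<^bsub>C\<^esub> ?\<delta>"
      using extZ[OF \<psi>] by (auto simp: C_def cochains_simps extensional_def fun_eq_iff)
    ultimately show ?thesis
      using Zadd(2)[OF \<open>?\<delta> \<in> Z\<close> \<phi>] by metis
  qed
  have coset: "B +>\<^bsub>C\<^esub> \<phi> = fib (\<Phi> \<phi>)" if \<phi>: "\<phi> \<in> Z" for \<phi>
  proof (intro equalityI subsetI)
    fix \<psi> assume "\<psi> \<in> B +>\<^bsub>C\<^esub> \<phi>"
    then obtain b where b: "b \<in> B" "\<psi> = b \<oplus>\<^bsub>C\<^esub> \<phi>"
      by (auto simp: a_r_coset_def')
    then have "b \<in> Z" "\<Phi> b = \<zero>\<^bsub>W\<^esub>" using BZ kerB by auto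
    then show "\<psi> \<in> fib (\<Phi> \<phi>)"
      using Zadd[OF \<open>b \<in> Z\<close> \<phi>] \<Phi>W[OF \<phi>] by (simp add: fib_def b)
  next
    fix \<psi> assume "\<psi> \<in> fib (\<Phi> \<phi>)"
    then have \<psi>: "\<psi> \<in> Z" "\<Phi> \<psi> = \<Phi> \<phi>" by (auto simp: fib_def)
    obtain \<delta> where \<delta>: "\<delta> \<in> Z" "\<psi> = \<delta> \<oplus>\<^bsub>C\<^esub> \<phi>" "\<Phi> \<psi> = \<Phi> \<delta> \<oplus>\<^bsub>W\<^esub> \<Phi> \<phi>"
      using diff[OF \<phi> \<psi>(1)] by blast
    then have "\<Phi> \<delta> \<oplus>\<^bsub>W\<^esub> \<Phi> \<phi> = \<zero>\<^bsub>W\<^esub> \<oplus>\<^bsub>W\<^esub> \<Phi> \<phi>"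
      using \<psi>(2) \<Phi>W[OF \<phi>] by simp
    then have "\<Phi> \<delta> = \<zero>\<^bsub>W\<^esub>"
      using W.M.add.right_cancel[OF \<Phi>W[OF \<phi>] \<Phi>W[OF \<delta>(1)] W.M.zero_closed] by simp
    then have "\<delta> \<in> B" using kerB \<delta> by blast
    then show "\<psi> \<in> B +>\<^bsub>C\<^esub> \<phi>"
      using \<delta>(2) by (auto simp: a_r_coset_def')
  qed
  have fib_ne: "\<exists>\<phi>\<in>Z. \<Phi> \<phi> = v" if "v \<in> carrier W" for v
    using surj that by (auto simp: defs)
  have f_fib: "f (fib v) = v" if "v \<in> carrier W" for v
  proof -
    have "\<Phi> ` fib v = {v}" using fib_ne[OF that] by (auto simp: fib_def)
    then show ?thesis by (simp add: f_def)
  qed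
  have H: "carrier H = (\<lambda>\<phi>. B +>\<^bsub>C\<^esub> \<phi>) ` Z" "\<zero>\<^bsub>H\<^esub> = B" "P \<oplus>\<^bsub>H\<^esub> Q = P <+>\<^bsub>C\<^esub> Q"
    "a \<odot>\<^bsub>H\<^esub> P = (\<Union>x\<in>P. B +>\<^bsub>C\<^esub> (a \<odot>\<^bsub>C\<^esub> x))" for P Q a
    by (auto simp: H_def cohomology_def quotient_module_def A_RCOSETS_def' a_r_coset_def' set_add_def'
        Z_def B_def C_def)
  have carrier_H: "carrier H = fib ` carrier W"
  proof (intro equalityI subsetI)
    fix x assume "x \<in> carrier H"
    then show "x \<in> fib ` carrier W" using coset \<Phi>W by (auto simp: H)
  next
    fix x assume "x \<in> fib ` carrier W"
    then obtain v where v: "v \<in> carrier W" "x = fib v" by blast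
    then obtain \<phi> where "\<phi> \<in> Z" "\<Phi> \<phi> = v" using fib_ne by blast
    then show "x \<in> carrier H" using coset[of \<phi>] by (auto simp: H v)
  qed
  have bij: "bij_betw f (carrier H) (carrier W)"
    by (rule bij_betwI[where g = fib]) (auto simp: carrier_H f_fib)
  have H_add: "fib v \<oplus>\<^bsub>H\<^esub> fib w = fib (v \<oplus>\<^bsub>W\<^esub> w)" if v: "v \<in> carrier W" and w: "w \<in> carrier W" for v w
  proof (intro equalityI subsetI)
    fix \<psi> assume "\<psi> \<in> fib v \<oplus>\<^bsub>H\<^esub> fib w"
    then show "\<psi> \<in> fib (v \<oplus>\<^bsub>W\<^esub> w)"
      by (auto simp: H set_add_def' fib_def Zadd)
  next
    fix \<psi> assume "\<psi> \<in> fib (v \<oplus>\<^bsub>W\<^esub> w)"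
    then have \<psi>: "\<psi> \<in> Z" "\<Phi> \<psi> = v \<oplus>\<^bsub>W\<^esub> w" by (auto simp: fib_def)
    obtain \<phi> where \<phi>: "\<phi> \<in> Z" "\<Phi> \<phi> = v" using fib_ne[OF v] by blast
    obtain \<delta> where \<delta>: "\<delta> \<in> Z" "\<psi> = \<phi> \<oplus>\<^bsub>C\<^esub> \<delta>" "\<Phi> \<psi> = \<Phi> \<delta> \<oplus>\<^bsub>W\<^esub> \<Phi> \<phi>"
      using diff[OF \<phi>(1) \<psi>(1)] by blast
    then have "\<Phi> \<delta> \<oplus>\<^bsub>W\<^esub> v = w \<oplus>\<^bsub>W\<^esub> v"
      using \<psi>(2) \<phi>(2) W.M.a_comm[OF v w] by simp
    then have "\<Phi> \<delta> = w"
      using W.M.add.right_cancel[OF v \<Phi>W[OF \<delta>(1)] w] by simp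
    then show "\<psi> \<in> fib v \<oplus>\<^bsub>H\<^esub> fib w"
      using \<delta> \<phi> by (auto simp: H set_add_def' fib_def)
  qed
  have H_zero: "\<zero>\<^bsub>H\<^esub> = fib \<zero>\<^bsub>W\<^esub>"
    using BZ kerB by (auto simp: H fib_def)
  have H_smult: "a \<odot>\<^bsub>H\<^esub> fib v = fib (a \<odot>\<^bsub>W\<^esub> v)" if v: "v \<in> carrier W" for a v
    using fib_ne[OF v] by (auto simp: H coset Zsmult fib_def)
  have ax: "a \<odot>\<^bsub>W\<^esub> v \<in> carrier W" if "v \<in> carrier W" for a v
    using that by (simp add: complex_field_def)
  have rep: "representation (mu d) W \<sigma>"
    using diag_rep_coord_reps[OF d, of N c] by (simp add: coord_reps_def W_def \<sigma>_def diag_rep_def)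
  have \<sigma>: "\<sigma> \<xi> v \<in> carrier W" "v \<in> carrier W \<Longrightarrow> w \<in> carrier W \<Longrightarrow> \<sigma> \<xi> v = \<sigma> \<xi> w \<Longrightarrow> v = w"
    if \<xi>: "\<xi> \<in> carrier (mu d)" for \<xi> v w
  proof -
    show "\<sigma> \<xi> v \<in> carrier W" by (simp add: \<sigma>_def diag_rep_def W_def coord_space_eq)
    have \<xi>0: "\<xi> \<noteq> 0" using \<xi> d by (auto simp: mu_def power_0_left)
    assume vw: "v \<in> carrier W" "w \<in> carrier W" and eq: "\<sigma> \<xi> v = \<sigma> \<xi> w"
    have "v k = w k" if "k < N" for k
      using fun_cong[OF eq, of k] that \<xi>0 by (simp add: \<sigma>_def diag_rep_def)
    then show "v = w"
      using vw by (auto simp: W_def coord_space_eq PiE_iff intro!: extensionalityI[of v "{..<N}" w])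
  qed
  \<comment> \<open>Since \<open>\<sigma> \<xi>\<close> is injective, all cocycles of one fibre are
    pulled back into one fibre, and the pullback acts on \<open>W\<close> as the inverse of
    \<open>\<sigma> \<xi>\<close>.\<close>
  have pb: "\<exists>w\<in>carrier W. cohomology_pullback (Suc q) X (A \<xi>) (fib v) = fib w \<and> \<sigma> \<xi> w = v"
    if \<xi>: "\<xi> \<in> carrier (mu d)" and v: "v \<in> carrier W" for \<xi> v
  proof -
    have pbZ: "cochain_pullback (Suc q) X (A \<xi>) \<phi> \<in> Z" if "\<phi> \<in> Z" for \<phi>
      using cochain_pullback_cocycles cont[OF \<xi>] that by (auto simp: Z_def)
    have \<sigma>pb: "\<sigma> \<xi> (\<Phi> (cochain_pullback (Suc q) X (A \<xi>) \<phi>)) = \<Phi> \<phi>" if "\<phi> \<in> Z" for \<phi>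
      using \<Phi>W[OF that] pullback[OF \<xi>] that
      by (auto simp: \<sigma>_def diag_rep_def Z_def W_def coord_space_eq fun_eq_iff PiE_iff extensional_def)
    obtain \<phi> where \<phi>: "\<phi> \<in> Z" "\<Phi> \<phi> = v" using fib_ne[OF v] by blast
    define w where "w = \<Phi> (cochain_pullback (Suc q) X (A \<xi>) \<phi>)"
    have w: "w \<in> carrier W" "\<sigma> \<xi> w = v"
      using \<Phi>W[OF pbZ[OF \<phi>(1)]] \<sigma>pb[OF \<phi>(1)] \<phi>(2) by (auto simp: w_def)
    have "B +>\<^bsub>C\<^esub> cochain_pullback (Suc q) X (A \<xi>) \<psi> = fib w" if "\<psi> \<in> fib v" for \<psi>
    proof -
      have \<psi>: "\<psi> \<in> Z" "\<Phi> \<psi> = v" using that by (auto simp: fib_def)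
      have "\<Phi> (cochain_pullback (Suc q) X (A \<xi>) \<psi>) = w"
        by (rule \<sigma>(2)[OF \<xi>]) (use \<Phi>W[OF pbZ[OF \<psi>(1)]] w \<sigma>pb[OF \<psi>(1)] \<psi>(2) in auto)
      then show ?thesis using coset[OF pbZ[OF \<psi>(1)]] by simp
    qed
    moreover have "fib v \<noteq> {}" using \<phi> by (auto simp: fib_def)
    ultimately have "cohomology_pullback (Suc q) X (A \<xi>) (fib v) = fib w"
      unfolding cohomology_pullback_def B_def C_def by auto
    then show ?thesis using w by blast
  qed
  define \<rho> where "\<rho> \<xi> = inv_into (carrier H) (cohomology_pullback (Suc q) X (A \<xi>))" for \<xi>
  \<comment> \<open>Inverting the pullback therefore gives \<open>\<sigma> \<xi>\<close> itself, and
    the characters appear with exponent \<open>c k\<close> instead of its negative.\<close>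
  have \<rho>: "\<rho> \<xi> (fib w) = fib (\<sigma> \<xi> w)" if \<xi>: "\<xi> \<in> carrier (mu d)" and w: "w \<in> carrier W" for \<xi> w
    unfolding \<rho>_def
  proof (rule inv_into_f_eq)
    show "inj_on (cohomology_pullback (Suc q) X (A \<xi>)) (carrier H)"
      unfolding carrier_H by (rule inj_onI) (use pb[OF \<xi>] f_fib in \<open>metis imageE\<close>)
    show "fib (\<sigma> \<xi> w) \<in> carrier H"
      using \<sigma>(1)[OF \<xi>] by (simp add: carrier_H)
    show "cohomology_pullback (Suc q) X (A \<xi>) (fib (\<sigma> \<xi> w)) = fib w"
      using pb[OF \<xi> \<sigma>(1)[OF \<xi>]] \<sigma>(2)[OF \<xi>] w by metis
  qed
  have H1: "x \<oplus>\<^bsub>H\<^esub> y \<in> carrier H \<and> f (x \<oplus>\<^bsub>H\<^esub> y) = f x \<oplus>\<^bsub>W\<^esub> f y"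
    if "x \<in> carrier H" "y \<in> carrier H" for x y
    using that by (auto simp: carrier_H H_add f_fib)
  have H2: "\<zero>\<^bsub>H\<^esub> \<in> carrier H" "f \<zero>\<^bsub>H\<^esub> = \<zero>\<^bsub>W\<^esub>"
    by (auto simp: carrier_H H_zero f_fib)
  have H3: "a \<odot>\<^bsub>H\<^esub> x \<in> carrier H \<and> f (a \<odot>\<^bsub>H\<^esub> x) = a \<odot>\<^bsub>W\<^esub> f x" if "x \<in> carrier H" for a x
    using that by (auto simp: carrier_H H_smult f_fib ax)
  have H4: "\<rho> \<xi> x \<in> carrier H \<and> f (\<rho> \<xi> x) = \<sigma> \<xi> (f x)"
    if "\<xi> \<in> carrier (mu d)" "x \<in> carrier H" for \<xi> x
    using that by (auto simp: carrier_H \<rho> f_fib \<sigma>(1))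
  note tr = representation_transport[OF rep bij H1 H2 H3 H4]
  have cr: "(N, \<sigma>) \<in> coord_reps (mu d)"
    using diag_rep_coord_reps[OF d, of N c] by (simp add: \<sigma>_def diag_rep_def)
  have "grothendieck_class (mu d) (\<Sum>k<N. frag_of (mu_character (c k))) =
      grothendieck_class (mu d) (frag_of (N, \<sigma>))"
    using grothendieck_class_diag_rep[OF d, of N c] by (simp add: \<sigma>_def diag_rep_def)
  then show ?thesis
    using tr cr bij unfolding has_grothendieck_class_def \<rho>_def W_def H_def by blast
qed

section \<open>Fourier analysis on the roots of unity\<close>

definition unity_root :: "nat \<Rightarrow> complex" where
  "unity_root d = cis (2 * pi / real d)"

text \<open>Not normalised. The sign of the exponent is the one that gives
  \<open>fourier_shift\<close> the shape of the hypothesis \<open>pullback\<close> in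
  \<open>has_grothendieck_class_cohomology\<close>.\<close>

definition fourier :: "nat \<Rightarrow> (complex \<Rightarrow> complex) \<Rightarrow> nat \<Rightarrow> complex" where
  "fourier d D i = (\<Sum>\<xi> | \<xi> ^ d = 1. \<xi> ^ i * D \<xi>)"

lemma unity_root_power: "unity_root d ^ k = cis (2 * pi * real k / real d)"
  by (simp add: unity_root_def Complex.DeMoivre mult_ac)

lemma unity_root_nonzero [simp]: "unity_root d \<noteq> 0"
  by (simp add: unity_root_def)

lemma unity_root_power_self [simp]: "d > 0 \<Longrightarrow> unity_root d ^ d = 1"
  by (simp add: unity_root_power)

lemma bij_betw_unity_root:
  assumes "d > 0"
  shows "bij_betw (\<lambda>k. unity_root d ^ k) {..<d} {\<xi>. \<xi> ^ d = 1}"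
  using Complex.bij_betw_roots_unity[OF assms] by (simp add: unity_root_power)

lemma unity_root_power_eq_iff:
  assumes "i < d" "j < d"
  shows "unity_root d ^ i = unity_root d ^ j \<longleftrightarrow> i = j"
  using bij_betw_unity_root[of d] assms by (auto simp: bij_betw_def dest: inj_onD)

lemma sum_powers_root_of_unity:
  assumes "\<eta> ^ d = (1::complex)"
  shows "(\<Sum>i<d. \<eta> ^ i) = (if \<eta> = 1 then of_nat d else 0)"
  using assms by (auto simp: geometric_sum)

lemma root_of_unity_nonzero:
  assumes "d > 0" "\<xi> ^ d = (1::complex)"
  shows "\<xi> \<noteq> 0"
  using assms by (auto simp: power_0_left)

text \<open>Orthogonality of characters: along the powers of the primitive root the summands form a
  geometric progression whose ratio is a \<open>d\<close>-th root of unity.\<close>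

lemma sum_characters:
  assumes "i < d" "i' < d"
  shows "(\<Sum>\<xi> | \<xi> ^ d = 1. \<xi> ^ i * inverse \<xi> ^ i') = (if i = i' then of_nat d else 0 :: complex)"
proof -
  have d: "d > 0" using assms by simp
  let ?\<eta> = "unity_root d ^ i * inverse (unity_root d) ^ i'"
  have "(\<Sum>\<xi> | \<xi> ^ d = 1. \<xi> ^ i * inverse \<xi> ^ i') =
      (\<Sum>k<d. (unity_root d ^ k) ^ i * inverse (unity_root d ^ k) ^ i')"
    by (rule sum.reindex_bij_betw[OF bij_betw_unity_root[OF d], symmetric])
  also have "\<dots> = (\<Sum>k<d. ?\<eta> ^ k)"
    by (simp add: power_mult_distrib power_mult[symmetric] mult.commute power_inverse)
  also have "\<dots> = (if ?\<eta> = 1 then of_nat d else 0)"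
  proof (rule sum_powers_root_of_unity)
    have "?\<eta> ^ d = (unity_root d ^ d) ^ i * inverse (unity_root d ^ d) ^ i'"
      by (simp add: power_mult_distrib power_mult[symmetric] mult.commute power_inverse)
    then show "?\<eta> ^ d = 1" using d by simp
  qed
  also have "?\<eta> = 1 \<longleftrightarrow> unity_root d ^ i = unity_root d ^ i'"
    by (simp add: power_inverse field_simps)
  finally show ?thesis
    using unity_root_power_eq_iff[OF assms] by simp
qed

lemma fourier_add: "fourier d (\<lambda>\<xi>. D \<xi> + E \<xi>) i = fourier d D i + fourier d E i"
  by (simp add: fourier_def distrib_left sum.distrib)

lemma fourier_diff: "fourier d (\<lambda>\<xi>. D \<xi> - E \<xi>) i = fourier d D i - fourier d E i"
  by (simp add: fourier_def right_diff_distrib sum_subtractf)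

lemma fourier_cmult: "fourier d (\<lambda>\<xi>. c * D \<xi>) i = c * fourier d D i"
  by (simp add: fourier_def sum_distrib_left mult_ac)

lemma fourier_shift:
  assumes "d > 0" "\<eta> ^ d = 1"
  shows "\<eta> ^ i * fourier d (\<lambda>\<xi>. D (\<xi> * \<eta>)) i = fourier d D i"
proof -
  have \<eta>: "\<eta> \<noteq> 0" using root_of_unity_nonzero[OF assms] .
  have "bij_betw (\<lambda>\<xi>. \<xi> * \<eta>) {\<xi>. \<xi> ^ d = 1} {\<xi>. \<xi> ^ d = 1}"
    by (rule bij_betwI[where g = "\<lambda>\<xi>. \<xi> / \<eta>"])
       (use assms \<eta> in \<open>auto simp: power_mult_distrib power_divide\<close>)
  from sum.reindex_bij_betw[OF this, of "\<lambda>\<xi>. \<xi> ^ i * D \<xi>"]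
  show ?thesis
    by (simp add: fourier_def power_mult_distrib sum_distrib_left mult_ac)
qed

text \<open>Injectivity of the transform through the inversion formula \<open>inv\<close>: summation
  over \<open>i\<close> isolates the value at \<eta>.\<close>

lemma fourier_eqI:
  assumes "d > 0" "\<And>i. i < d \<Longrightarrow> fourier d D i = fourier d E i" "\<eta> ^ d = 1"
  shows "D \<eta> = E \<eta>"
proof -
  have \<eta>: "\<eta> \<noteq> 0" using root_of_unity_nonzero[OF assms(1,3)] .
  have fin: "finite {\<xi>::complex. \<xi> ^ d = 1}" using finite_roots_unity[of d] assms(1) by auto
  have inv: "of_nat d * D \<eta> = (\<Sum>i<d. inverse \<eta> ^ i * fourier d D i)" for D
  proof -
    have "(\<Sum>i<d. inverse \<eta> ^ i * fourier d D i) =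
        (\<Sum>i<d. \<Sum>\<xi> | \<xi> ^ d = 1. D \<xi> * (\<xi> / \<eta>) ^ i)"
      by (simp add: fourier_def sum_distrib_left power_divide field_simps power_inverse)
    also have "\<dots> = (\<Sum>\<xi> | \<xi> ^ d = 1. D \<xi> * (\<Sum>i<d. (\<xi> / \<eta>) ^ i))"
      by (subst sum.swap) (simp add: sum_distrib_left)
    also have "\<dots> = (\<Sum>\<xi> | \<xi> ^ d = 1. if \<xi> = \<eta> then D \<eta> * of_nat d else 0)"
      by (rule sum.cong[OF refl], subst sum_powers_root_of_unity)
         (use assms(3) \<eta> in \<open>auto simp: power_divide\<close>)
    also have "\<dots> = of_nat d * D \<eta>"
      using fin assms(3) by (simp add: sum.delta mult.commute)
    finally show ?thesis by simp
  qed
  have "of_nat d * D \<eta> = of_nat d * E \<eta>"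
    unfolding inv using assms(2) by (intro sum.cong) auto
  then show ?thesis using assms(1) by simp
qed

lemma fourier_surj:
  "\<exists>D. \<forall>i<d. fourier d D i = y i"
proof (intro exI allI impI)
  fix i assume i: "i < d"
  \<comment> \<open>The witness is the inverse transform of \<open>y\<close>, which carries the
    factor \<open>1 / d\<close>.\<close>
  have "fourier d (\<lambda>\<xi>. (\<Sum>k<d. y k * inverse \<xi> ^ k) / of_nat d) i =
      (\<Sum>\<xi> | \<xi> ^ d = 1. \<Sum>k<d. y k / of_nat d * (\<xi> ^ i * inverse \<xi> ^ k))"
    by (simp add: fourier_def sum_distrib_left sum_divide_distrib mult_ac)
  also have "\<dots> = (\<Sum>k<d. y k / of_nat d * (\<Sum>\<xi> | \<xi> ^ d = 1. \<xi> ^ i * inverse \<xi> ^ k))"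
    by (subst sum.swap) (simp add: sum_distrib_left)
  also have "\<dots> = (\<Sum>k<d. if k = i then y i else 0)"
    by (rule sum.cong[OF refl], subst sum_characters) (use i in auto)
  also have "\<dots> = y i" using i by simp
  finally show "fourier d (\<lambda>\<xi>. (\<Sum>k<d. y k * inverse \<xi> ^ k) / of_nat d) i = y i" .
qed

text \<open>A function \<open>h\<close> on \<open>{..<d} \<times> \<mu>\<^sub>d\<close> is a 1-cochain of the bipartite graph with an edge from
  \<open>\<xi>\<close> to \<open>\<xi> * unity_root d ^ j\<close> for every pair \<open>(j, \<xi>)\<close>. The Fourier coefficients of index \<open>i\<close>
  of the coboundaries \<open>a \<xi> - b (\<xi> * unity_root d ^ j)\<close> are the combinations of \<open>1\<close> and
  \<open>j \<mapsto> t ^ j\<close>, where \<open>t = unity_root d ^ (- i)\<close>. The functionals below cut these out; they are a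
  basis of the annihilator.\<close>

definition graph_index :: "nat \<Rightarrow> (nat \<times> nat) set" where
  "graph_index d = {(i, j). i < d \<and> j < d \<and> 1 \<le> j \<and> (i > 0 \<longrightarrow> 2 \<le> j)}"

text \<open>For \<open>i > 0\<close> the value is the determinant with rows
  \<open>(1, 1, 1)\<close>, \<open>(1, t, t ^ j)\<close> and the \<open>i\<close>-th Fourier
  coefficients of \<open>h 0\<close>, \<open>h 1\<close>, \<open>h j\<close>. It vanishes
  identically for \<open>j = 0\<close> and \<open>j = 1\<close>, which is why
  \<open>graph_index\<close> omits these. For \<open>i = 0\<close> we have \<open>t = 1\<close>, and
  the determinant with rows \<open>(1, 1)\<close> and the coefficients of \<open>h 0\<close>,
  \<open>h j\<close> takes its place.\<close>

definition graph_functional :: "nat \<Rightarrow> (nat \<Rightarrow> complex \<Rightarrow> complex) \<Rightarrow> nat \<times> nat \<Rightarrow> complex" where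
  "graph_functional d h p = (let i = fst p; j = snd p; t = inverse (unity_root d) ^ i in
     if i = 0 then fourier d (h j) 0 - fourier d (h 0) 0
     else (t - 1) * (fourier d (h j) i - fourier d (h 0) i)
        - (t ^ j - 1) * (fourier d (h 1) i - fourier d (h 0) i))"

lemma graph_functional_add:
  "graph_functional d (\<lambda>j \<xi>. g j \<xi> + h j \<xi>) p = graph_functional d g p + graph_functional d h p"
  by (simp add: graph_functional_def Let_def fourier_add algebra_simps)

lemma graph_functional_cmult:
  "graph_functional d (\<lambda>j \<xi>. c * h j \<xi>) p = c * graph_functional d h p"
  by (simp add: graph_functional_def Let_def fourier_cmult algebra_simps)

lemma graph_functional_cong:
  assumes "p \<in> graph_index d" "\<And>j \<xi>. j < d \<Longrightarrow> \<xi> ^ d = 1 \<Longrightarrow> g j \<xi> = h j \<xi>"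
  shows "graph_functional d g p = graph_functional d h p"
proof -
  have "fourier d (g j) i = fourier d (h j) i" if "j < d" for i j
    unfolding fourier_def by (rule sum.cong) (use assms(2) that in auto)
  then show ?thesis
    using assms(1) by (auto simp: graph_functional_def graph_index_def Let_def)
qed

lemma graph_functional_shift:
  assumes "d > 0" "\<eta> ^ d = 1"
  shows "\<eta> ^ fst p * graph_functional d (\<lambda>j \<xi>. h j (\<xi> * \<eta>)) p = graph_functional d h p"
proof -
  have "graph_functional d h p = \<eta> ^ fst p * graph_functional d (\<lambda>j \<xi>. h j (\<xi> * \<eta>)) p"
    unfolding graph_functional_def Let_def
    by (subst (1 2 3 4 5 6) fourier_shift[OF assms, symmetric]) (simp add: algebra_simps)
  then show ?thesis by simp
qed

lemma fourier_coboundary: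
  assumes "d > 0"
  shows "fourier d (\<lambda>\<xi>. a \<xi> - b (\<xi> * unity_root d ^ j)) i =
    fourier d a i - (inverse (unity_root d) ^ i) ^ j * fourier d b i"
proof -
  have "(unity_root d ^ j) ^ d = 1"
    using assms by (metis power_commutes power_mult power_one unity_root_power_self mult.commute)
  from fourier_shift[OF assms this, of i b]
  have "fourier d b i = (unity_root d ^ j) ^ i * fourier d (\<lambda>\<xi>. b (\<xi> * unity_root d ^ j)) i" by simp
  then have "fourier d (\<lambda>\<xi>. b (\<xi> * unity_root d ^ j)) i =
      (inverse (unity_root d) ^ i) ^ j * fourier d b i"
    by (simp add: power_inverse power_mult[symmetric] mult.commute)
  then show ?thesis by (simp add: fourier_diff)
qed

lemma graph_functional_coboundary:
  assumes "d > 0"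
  shows "graph_functional d (\<lambda>j \<xi>. a \<xi> - b (\<xi> * unity_root d ^ j)) p = 0"
  unfolding graph_functional_def Let_def fourier_coboundary[OF assms]
  by (simp add: algebra_simps)

lemma inverse_unity_root_power_neq_1:
  assumes "0 < i" "i < d"
  shows "inverse (unity_root d) ^ i \<noteq> 1"
  using unity_root_power_eq_iff[of i d 0] assms by (auto simp: power_inverse)

text \<open>At each frequency the coefficients of \<open>a\<close> and \<open>b\<close> are found
  from \<open>h 0\<close> and \<open>h 1\<close>; the vanishing of the determinants then says that
  they fit all other \<open>h j\<close>.\<close>

lemma graph_functional_eq_0D:
  assumes d: "d > 0" and 0: "\<And>p. p \<in> graph_index d \<Longrightarrow> graph_functional d h p = 0"
  obtains a b where "\<And>j \<xi>. j < d \<Longrightarrow> \<xi> ^ d = 1 \<Longrightarrow> h j \<xi> = a \<xi> - b (\<xi> * unity_root d ^ j)"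
proof -
  let ?t = "\<lambda>i. inverse (unity_root d) ^ i"
  \<comment> \<open>The coefficients of \<open>h j\<close> should be those of \<open>a\<close> minus
    \<open>t ^ j\<close> times those of \<open>b\<close>. Subtracting the cases \<open>j = 0\<close>
    and \<open>j = 1\<close> leaves \<open>t - 1\<close> times the coefficient of \<open>b\<close>.
    At \<open>i = 0\<close> only the difference of the two coefficients matters, and that of
    \<open>b\<close> is set to 0.\<close>
  define \<beta> where "\<beta> i = (if i = 0 then 0 else (fourier d (h 0) i - fourier d (h 1) i) / (?t i - 1))" for i
  obtain a where a: "\<And>i. i < d \<Longrightarrow> fourier d a i = fourier d (h 0) i + \<beta> i"
    using fourier_surj[of d "\<lambda>i. fourier d (h 0) i + \<beta> i"] by blast
  obtain b where b: "\<And>i. i < d \<Longrightarrow> fourier d b i = \<beta> i"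
    using fourier_surj[of d \<beta>] by blast
  have "fourier d (h j) i = fourier d (\<lambda>\<xi>. a \<xi> - b (\<xi> * unity_root d ^ j)) i"
    if j: "j < d" and i: "i < d" for i j
  proof -
    have "fourier d (h j) i = fourier d (h 0) i + \<beta> i - ?t i ^ j * \<beta> i"
    proof (cases "i = 0")
      case True
      then show ?thesis
        using 0[of "(0, j)"] j by (cases "j = 0") (auto simp: graph_index_def graph_functional_def \<beta>_def)
    next
      case False
      then have t: "?t i \<noteq> 1" using inverse_unity_root_power_neq_1[of i d] i by simp
      have \<beta>: "(?t i - 1) * \<beta> i = fourier d (h 0) i - fourier d (h 1) i"
        using False t by (simp add: \<beta>_def)
      consider "j = 0" | "j = 1" | "j \<ge> 2" by linarith
      then have "(?t i - 1) * (fourier d (h j) i - fourier d (h 0) i) =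
          (?t i ^ j - 1) * (fourier d (h 1) i - fourier d (h 0) i)"
        using 0[of "(i, j)"] False i j by cases (auto simp: graph_index_def graph_functional_def Let_def)
      also have "\<dots> = (?t i - 1) * (\<beta> i - ?t i ^ j * \<beta> i)"
      proof -
        have e: "fourier d (h 1) i - fourier d (h 0) i = - ((?t i - 1) * \<beta> i)"
          unfolding \<beta> by simp
        show ?thesis unfolding e by (simp add: algebra_simps)
      qed
      finally have "fourier d (h j) i - fourier d (h 0) i = \<beta> i - ?t i ^ j * \<beta> i"
        using t by simp
      then show ?thesis by (simp add: algebra_simps)
    qed
    then show ?thesis
      using a[OF i] b[OF i] by (simp add: fourier_coboundary[OF d])
  qed
  then have "h j \<xi> = a \<xi> - b (\<xi> * unity_root d ^ j)" if "j < d" "\<xi> ^ d = 1" for j \<xi>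
    by (rule fourier_eqI[OF d, of "h j" "\<lambda>\<xi>. a \<xi> - b (\<xi> * unity_root d ^ j)"]) (use that in auto)
  then show ?thesis by (rule that)
qed

text \<open>With all coefficients outside \<open>graph_index\<close> equal to zero,
  \<open>h 0\<close> and, for \<open>i > 0\<close>, \<open>h 1\<close> drop out. The functional is
  then one coefficient, multiplied by the nonzero number \<open>t - 1\<close> if
  \<open>i > 0\<close>.\<close>

lemma graph_functional_surj:
  obtains h where "\<And>p. p \<in> graph_index d \<Longrightarrow> graph_functional d h p = y p"
proof -
  let ?t = "\<lambda>i. inverse (unity_root d) ^ i"
  have "\<exists>D. \<forall>i<d. fourier d D i =
      (if (i, j) \<in> graph_index d then if i = 0 then y (i, j) else y (i, j) / (?t i - 1) else 0)" for j
    by (rule fourier_surj)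
  then obtain h where h: "\<And>i j. i < d \<Longrightarrow> fourier d (h j) i =
      (if (i, j) \<in> graph_index d then if i = 0 then y (i, j) else y (i, j) / (?t i - 1) else 0)"
    by metis
  show ?thesis
  proof (rule that)
    fix p assume "p \<in> graph_index d"
    moreover obtain i j where "p = (i, j)" by (cases p)
    ultimately show "graph_functional d h p = y p"
      using inverse_unity_root_power_neq_1[of i d]
      by (auto simp: graph_functional_def Let_def h graph_index_def)
  qed
qed

section \<open>Counting the functionals for each character\<close>

lemma finite_graph_index: "finite (graph_index d)"
  by (rule finite_subset[of _ "{..<d} \<times> {..<d}"]) (auto simp: graph_index_def)

lemma sum_graph_index:
  fixes g :: "nat \<Rightarrow> 'a \<Rightarrow>\<^sub>0 int"
  assumes "d > 0"
  shows "(\<Sum>p\<in>graph_index d. g (fst p)) =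
    frag_cmul (int d - 1) (g 0) + frag_cmul (int d - 2) (\<Sum>i=1..d-1. g i)"
proof -
  have const: "(\<Sum>x\<in>S. c) = frag_cmul (int (card S)) c" if "finite S"
    for S :: "nat set" and c :: "'a \<Rightarrow>\<^sub>0 int"
    using that by induction (auto simp: frag_cmul_distrib)
  have "graph_index d = {0} \<times> {1..<d} \<union> {1..<d} \<times> {2..<d}"
    using assms by (auto simp: graph_index_def)
  moreover have "({0} \<times> {1..<d}) \<inter> ({1..<d} \<times> {2..<d}) = {}" by auto
  ultimately have "(\<Sum>p\<in>graph_index d. g (fst p)) =
      (\<Sum>p\<in>{0} \<times> {1..<d}. g (fst p)) + (\<Sum>p\<in>{1..<d} \<times> {2..<d}. g (fst p))"
    by (simp only:) (rule sum.union_disjoint, auto)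
  also have "(\<Sum>p\<in>{0} \<times> {1..<d}. g (fst p)) = frag_cmul (int d - 1) (g 0)"
    using assms by (simp add: const sum.cartesian_product' of_nat_diff)
  also have "(\<Sum>p\<in>{1..<d} \<times> {2..<d}. g (fst p)) = (\<Sum>i\<in>{1..<d}. frag_cmul (int (d - 2)) (g i))"
    by (simp add: const sum.cartesian_product')
  also have "\<dots> = frag_cmul (int (d - 2)) (\<Sum>i\<in>{1..<d}. g i)"
    by (simp add: frag_cmul_sum)
  also have "\<dots> = frag_cmul (int d - 2) (\<Sum>i=1..d-1. g i)"
  \<comment> \<open>For \<open>d = 1\<close> the coefficients differ, 0 on the natural numbers and
    -1 on the integers, but both sums are empty.\<close>
  proof (cases "d = 1")
    case False
    then have "{1..<d} = {1..d - 1}" "int (d - 2) = int d - 2" using assms by auto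
    then show ?thesis by simp
  qed simp
  finally show ?thesis .
qed

section \<open>Singular 1-cocycles\<close>

definition vtx :: "nat \<Rightarrow> nat \<Rightarrow> real" where
  "vtx i = (\<lambda>j. if j = i then 1 else 0)"

definition point_simplex :: "'a \<Rightarrow> (nat \<Rightarrow> real) \<Rightarrow> 'a" where
  "point_simplex x = (\<lambda>_\<in>standard_simplex 0. x)"

lemma vtx_in_standard_simplex [simp]: "i \<le> p \<Longrightarrow> vtx i \<in> standard_simplex p"
  unfolding vtx_def by (rule basis_in_standard_simplex[THEN iffD2])

lemma vtx_apply: "vtx i j = (if j = i then 1 else 0)"
  by (simp add: vtx_def)

lemma standard_simplex_0_vtx: "standard_simplex 0 = {vtx 0}"
  by (simp add: standard_simplex_0 vtx_def)

lemma point_simplex_apply [simp]: "point_simplex x (vtx 0) = x"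
  by (simp add: point_simplex_def)

lemma simplical_face_vtx:
  "simplical_face k (vtx i) = vtx (if i < k then i else Suc i)"
  by (auto simp: simplical_face_def vtx_def fun_eq_iff)

lemma singular_face_1:
  "singular_face 1 0 \<sigma> = point_simplex (\<sigma> (vtx 1))"
  "singular_face 1 1 \<sigma> = point_simplex (\<sigma> (vtx 0))"
  by (auto simp: singular_face_def point_simplex_def standard_simplex_0_vtx simplical_face_vtx
      restrict_def intro!: ext)

lemma chain_boundary_1:
  "chain_boundary 1 (frag_of \<sigma>) =
    frag_of (point_simplex (\<sigma> (vtx 1))) - frag_of (point_simplex (\<sigma> (vtx 0)))"
proof -
  have "{..1::nat} = {0, 1}" by auto
  then show ?thesis
    by (simp add: chain_boundary_of singular_face_1[unfolded One_nat_def])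
qed

lemma chain_boundary_2:
  "chain_boundary 2 (frag_of \<tau>) =
    frag_of (singular_face 2 0 \<tau>) - frag_of (singular_face 2 1 \<tau>) + frag_of (singular_face 2 2 \<tau>)"
proof -
  have "{..2::nat} = {0, 1, 2}" by auto
  then show ?thesis
    by (simp add: chain_boundary_of)
qed

lemma singular_simplex_point: "x \<in> topspace X \<Longrightarrow> singular_simplex 0 X (point_simplex x)"
  by (auto simp: singular_simplex_def point_simplex_def)

lemma singular_simplex_top_of_set:
  "singular_simplex p (top_of_set S) \<sigma> \<longleftrightarrow> continuous_on (standard_simplex p) \<sigma> \<and>
    \<sigma> ` standard_simplex p \<subseteq> S \<and> \<sigma> \<in> extensional (standard_simplex p)"
  by (auto simp: singular_simplex_def euclidean_product_topology)

lemma singular_simplex_subset: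
  assumes "singular_simplex p (top_of_set S) \<sigma>" "S \<subseteq> T"
  shows "singular_simplex p (top_of_set T) \<sigma>"
  using assms by (auto simp: singular_simplex_top_of_set)

lemma singular_chain_of_subset:
  assumes "singular_simplex p (top_of_set S) \<sigma>" "S \<subseteq> T"
  shows "singular_chain p (top_of_set T) (frag_of \<sigma>)"
  using singular_simplex_subset[OF assms] by (simp add: singular_chain_of)

text \<open>The coordinate \<open>z 1\<close> serves as path parameter: it is 0 at
  \<open>vtx 0\<close> and 1 at \<open>vtx 1\<close>.\<close>

lemma path_connected_simplex:
  assumes "path_connected S" "x \<in> S" "y \<in> S"
  obtains \<sigma> where "singular_simplex 1 (top_of_set S) \<sigma>" "\<sigma> (vtx 0) = x" "\<sigma> (vtx 1) = y"
proof -
  obtain g where g: "path g" "path_image g \<subseteq> S" "pathstart g = x" "pathfinish g = y"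
    using assms unfolding path_connected_def by blast
  have z: "z 1 \<in> {0..1}" if "z \<in> standard_simplex 1" for z
    using standard_simplex_01[of 1] that by (auto simp: PiE_iff)
  have "continuous_on (standard_simplex 1) (\<lambda>z. g (z 1))"
    by (rule continuous_on_compose2[of "{0..1}" g])
       (use g z in \<open>auto simp: path_def intro: continuous_on_subset[OF continuous_on_product_coordinates]\<close>)
  then have "singular_simplex 1 (top_of_set S) (restrict (\<lambda>z. g (z 1)) (standard_simplex 1))"
    using g z by (auto simp: singular_simplex_top_of_set path_image_def)
  then show ?thesis
    by (rule that) (use g in \<open>auto simp: vtx_apply pathstart_def pathfinish_def\<close>)
qed

text \<open>The contraction makes the cycle homologous to its image in a single point, and in a
  point every 1-cycle bounds.\<close>

lemma contractible_cycle_bounds: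
  assumes "contractible S" "singular_chain 1 (top_of_set S) c" "chain_boundary 1 c = 0"
  obtains e where "singular_chain 2 (top_of_set S) e" "chain_boundary 2 e = c"
proof -
  let ?X = "top_of_set S"
  obtain a where a: "homotopic_with_canon (\<lambda>x. True) S S id (\<lambda>x. a)"
    using assms(1) by (auto simp: contractible_def)
  show ?thesis
  \<comment> \<open>The centre \<open>a\<close> of the contraction is sure to lie in
    \<open>S\<close> only if \<open>S\<close> is nonempty.\<close>
  proof (cases "S = {}")
    case True
    then have "c = 0" using assms(2) by (simp add: singular_chain_empty)
    then show ?thesis by (intro that[of 0]) auto
  next
    case False
    have "continuous_map (top_of_set S) (top_of_set S) (\<lambda>x. a)"
      using homotopic_with_imp_continuous_maps[OF a] by blast
    then have "(\<lambda>x. a) \<in> S \<rightarrow> S"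
      using continuous_map_funspace[of "top_of_set S" "top_of_set S" "\<lambda>x. a"] by simp
    then have aS: "a \<in> S" using False by auto
    have c: "singular_relcycle 1 ?X {} c"
      using assms by (simp add: singular_cycle)
    have "homologous_rel 1 ?X {} (chain_map 1 id c) (chain_map 1 (\<lambda>x. a) c)"
      by (rule homotopic_imp_homologous_rel_chain_maps[OF _ c])
         (use a in \<open>auto intro: homotopic_with_mono\<close>)
    moreover have "chain_map 1 id c = c"
      using chain_map_id_gen[OF assms(2), of id] by simp
    moreover have "singular_relboundary 1 ?X {} (chain_map 1 (\<lambda>x. a) c)"
    proof (rule singular_boundary_mono[of "{a}" S 1 euclidean])
      have "singular_relcycle 1 (top_of_set {a}) {} (chain_map 1 (\<lambda>x. a) c)"
        by (rule singular_relcycle_chain_map[OF c]) auto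
      then show "singular_relboundary 1 (top_of_set {a}) {} (chain_map 1 (\<lambda>x. a) c)"
        by (subst singular_boundary_eq_cycle_singleton) auto
    qed (use aS in auto)
    ultimately have "singular_relboundary 1 ?X {} c"
      unfolding homologous_rel_def
      by (metis diff_add_cancel singular_relboundary_add)
    then show ?thesis
      using that by (auto simp: singular_boundary numeral_2_eq_2)
  qed
qed

text \<open>Integration from a base point: \<open>f x\<close> is the value of \<phi> on a chosen
  path to \<open>x\<close>. The chosen path to the start of \<sigma>, followed by \<sigma> and by
  the chosen path back from its end, is a cycle in \<open>S\<close>, so it bounds and \<phi>
  vanishes on it.\<close>

lemma cocycle_primitive:
  fixes X :: "'a::real_normed_vector set"
  assumes \<phi>: "\<phi> \<in> cocycles 1 (top_of_set X)" and SX: "S \<subseteq> X" and S: "contractible S"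
  shows "\<exists>f. \<forall>\<sigma>. singular_simplex 1 (top_of_set S) \<sigma> \<longrightarrow>
    \<phi> (frag_of \<sigma>) = f (\<sigma> (vtx 1)) - f (\<sigma> (vtx 0))"
proof (cases "S = {}")
  case True
  then have "\<not> singular_simplex 1 (top_of_set S) \<sigma>" for \<sigma>
    by (intro singular_simplex_empty) simp
  then show ?thesis by blast
next
  case False
  then obtain a where a: "a \<in> S" by blast
  have pc: "path_connected S" using S by (rule contractible_imp_path_connected)
  have "\<exists>\<gamma>. \<forall>x\<in>S. singular_simplex 1 (top_of_set S) (\<gamma> x) \<and> \<gamma> x (vtx 0) = a \<and> \<gamma> x (vtx 1) = x"
    by (rule bchoice) (metis path_connected_simplex[OF pc a])
  then obtain \<gamma> where \<gamma>: "\<And>x. x \<in> S \<Longrightarrow> singular_simplex 1 (top_of_set S) (\<gamma> x)"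
    "\<And>x. x \<in> S \<Longrightarrow> \<gamma> x (vtx 0) = a" "\<And>x. x \<in> S \<Longrightarrow> \<gamma> x (vtx 1) = x" by blast
  have \<phi>c: "\<phi> \<in> carrier (cochains 1 (top_of_set X))"
    using \<phi> by (simp add: in_cocycles_iff)
  have "\<phi> (frag_of \<sigma>) = \<phi> (frag_of (\<gamma> (\<sigma> (vtx 1)))) - \<phi> (frag_of (\<gamma> (\<sigma> (vtx 0))))"
    if \<sigma>: "singular_simplex 1 (top_of_set S) \<sigma>" for \<sigma>
  proof -
    let ?x = "\<sigma> (vtx 0)" and ?y = "\<sigma> (vtx 1)"
    have xy: "?x \<in> S" "?y \<in> S" using \<sigma> by (auto simp: singular_simplex_top_of_set)
    let ?c = "frag_of \<sigma> - (frag_of (\<gamma> ?y) - frag_of (\<gamma> ?x))"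
    have "singular_chain 1 (top_of_set S) ?c"
      by (intro singular_chain_diff) (use \<sigma> \<gamma>(1) xy in \<open>auto simp: singular_chain_of\<close>)
    moreover have "chain_boundary 1 ?c = 0"
      by (simp add: chain_boundary_diff chain_boundary_1 \<gamma> xy del: One_nat_def)
    ultimately obtain e where e: "singular_chain 2 (top_of_set S) e" "chain_boundary 2 e = ?c"
      by (rule contractible_cycle_bounds[OF S])
    then have "singular_chain (Suc 1) (top_of_set X) e"
      using singular_chain_mono[of 2 euclidean S e X] SX by (simp add: numeral_2_eq_2)
    then have "\<phi> (chain_boundary (Suc 1) e) = 0"
      using \<phi> unfolding in_cocycles_iff by blast
    then have "\<phi> ?c = 0" using e by (simp add: numeral_2_eq_2)
    moreover have "singular_chain 1 (top_of_set X) (frag_of \<sigma>)"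
      "singular_chain 1 (top_of_set X) (frag_of (\<gamma> ?x))" "singular_chain 1 (top_of_set X) (frag_of (\<gamma> ?y))"
      using singular_chain_of_subset[OF _ SX] \<sigma> \<gamma>(1) xy by blast+
    ultimately show ?thesis
      by (simp add: cochain_diff[OF \<phi>c] singular_chain_diff)
  qed
  then show ?thesis by (intro exI[of _ "\<lambda>x. \<phi> (frag_of (\<gamma> x))"]) blast
qed

section \<open>Cocycles and small simplices\<close>

lemma cochain_eq_0_if_simplices:
  assumes "\<psi> \<in> carrier (cochains p X)" "\<And>\<sigma>. singular_simplex p X \<sigma> \<Longrightarrow> \<psi> (frag_of \<sigma>) = 0"
    "singular_chain p X c"
  shows "\<psi> c = 0"
proof -
  have "Poly_Mapping.keys c \<subseteq> Collect (singular_simplex p X)"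
    using assms by (simp add: singular_chain_def)
  then have "singular_chain p X c \<and> \<psi> c = 0"
  proof (induction c rule: frag_induction)
    case (diff a b)
    then show ?case by (simp add: cochain_diff[OF assms(1)] singular_chain_diff)
  qed (use assms cochain_0[OF assms(1)] in \<open>auto simp: singular_chain_of\<close>)
  then show ?thesis ..
qed

text \<open>Enough subdivisions turn \<sigma> into a chain of small simplices, where \<phi>
  vanishes. The chain homotopy \<open>h\<close> from the identity to the iterated subdivision
  compares this with \<sigma>: the error is a boundary, which the cocycle kills, plus
  \<open>h\<close> of the endpoints.\<close>

lemma cocycle_eq_0_if_small:
  assumes \<phi>: "\<phi> \<in> cocycles 1 X" and op: "\<And>U. U \<in> \<C> \<Longrightarrow> openin X U" and cov: "topspace X \<subseteq> \<Union>\<C>"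
    and small: "\<And>\<sigma> U. U \<in> \<C> \<Longrightarrow> singular_simplex 1 X \<sigma> \<Longrightarrow> \<sigma> ` standard_simplex 1 \<subseteq> U \<Longrightarrow>
      \<phi> (frag_of \<sigma>) = 0"
    and c: "singular_chain 1 X c"
  shows "\<phi> c = 0"
proof -
  have \<phi>c: "\<phi> \<in> carrier (cochains 1 X)" using \<phi> by (simp add: in_cocycles_iff)
  have vanish: "singular_chain 1 X c' \<and> \<phi> c' = 0"
    if "Poly_Mapping.keys c' \<subseteq> {\<sigma>. singular_simplex 1 X \<sigma> \<and> (\<exists>U\<in>\<C>. \<sigma> ` standard_simplex 1 \<subseteq> U)}" for c'
    using that
  proof (induction c' rule: frag_induction)
    case zero
    then show ?case by (simp add: cochain_0[OF \<phi>c])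
  next
    case (one \<sigma>)
    then show ?case using small by (auto simp: singular_chain_of)
  next
    case (diff a b)
    then show ?case by (simp add: cochain_diff[OF \<phi>c] singular_chain_diff)
  qed
  have simplex: "\<phi> (frag_of \<sigma>) = 0" if \<sigma>: "singular_simplex 1 X \<sigma>" for \<sigma>
  proof -
    let ?c = "frag_of \<sigma>"
    have c: "singular_chain 1 X ?c" using \<sigma> by (simp add: singular_chain_of)
    obtain n where n: "\<And>f. f \<in> Poly_Mapping.keys ((singular_subdivision 1 ^^ n) ?c) \<Longrightarrow>
        \<exists>V\<in>\<C>. f \<in> standard_simplex 1 \<rightarrow> V"
      using sufficient_iterated_singular_subdivision_exists[OF op cov c] by (metis order_refl)
    obtain h where h: "\<And>p. h p 0 = (0 :: 'a chain)" "\<And>p c1 c2. h p (c1 - c2) = h p c1 - h p c2"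
        "\<And>p X c. singular_chain p X c \<Longrightarrow> singular_chain (Suc p) X (h p c)"
        "\<And>p X c. singular_chain p X c \<Longrightarrow>
          chain_boundary (Suc p) (h p c) + h (p - Suc 0) (chain_boundary p c)
            = (singular_subdivision p ^^ n) c - c"
      using chain_homotopic_iterated_singular_subdivision[of n] by blast
    let ?b = "chain_boundary (Suc 1) (h 1 ?c)" and ?e = "h 0 (chain_boundary 1 ?c)"
    have eq: "?b + ?e = (singular_subdivision 1 ^^ n) ?c - ?c" using h(4)[OF c] by simp
    have sub: "singular_chain 1 X ((singular_subdivision 1 ^^ n) ?c)"
      by (induction n) (simp_all add: c singular_chain_singular_subdivision del: One_nat_def)
    have "\<exists>U\<in>\<C>. f ` standard_simplex 1 \<subseteq> U"
      if "f \<in> Poly_Mapping.keys ((singular_subdivision 1 ^^ n) ?c)" for f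
      using n[OF that] by (simp only: image_subset_iff_funcset)
    then have "\<phi> ((singular_subdivision 1 ^^ n) ?c) = 0"
      using vanish[of "(singular_subdivision 1 ^^ n) ?c"] sub unfolding singular_chain_def by blast
    moreover have "\<phi> ?b = 0" "singular_chain 1 X ?b"
      using \<phi> h(3)[OF c] singular_chain_boundary_alt[OF h(3)[OF c]]
      unfolding in_cocycles_iff by auto
    moreover have "singular_chain 1 X ?e \<and> \<phi> ?e = 0"
    proof -
      \<comment> \<open>The homotopy respects every topology at once. Applied in the subspace
        \<open>{x}\<close>, it yields simplices that are constant at \<open>x\<close>, and those are
        small.\<close>
      have pt: "singular_chain 1 X (h 0 (frag_of (point_simplex x))) \<and>
          \<phi> (h 0 (frag_of (point_simplex x))) = 0" if x: "x \<in> topspace X" for x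
      proof (rule vanish)
        have "singular_chain 0 (subtopology X {x}) (frag_of (point_simplex x))"
          using x by (auto simp: singular_chain_of intro!: singular_simplex_point)
        from h(3)[OF this]
        have "singular_chain 1 (subtopology X {x}) (h 0 (frag_of (point_simplex x)))" by simp
        then have *: "\<sigma> ` standard_simplex 1 \<subseteq> {x}" "singular_simplex 1 X \<sigma>"
          if "\<sigma> \<in> Poly_Mapping.keys (h 0 (frag_of (point_simplex x)))" for \<sigma>
          using that unfolding singular_chain_def singular_simplex_subtopology by blast+
        obtain U where "U \<in> \<C>" "x \<in> U" using cov x by blast
        then show "Poly_Mapping.keys (h 0 (frag_of (point_simplex x)))
            \<subseteq> {\<sigma>. singular_simplex 1 X \<sigma> \<and> (\<exists>U\<in>\<C>. \<sigma> ` standard_simplex 1 \<subseteq> U)}"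
          using * by blast
      qed
      have "\<sigma> (vtx 0) \<in> topspace X" "\<sigma> (vtx 1) \<in> topspace X"
        using \<sigma> by (auto simp: singular_simplex_def continuous_map_def Pi_iff)
      then show ?thesis
        using pt[of "\<sigma> (vtx 0)"] pt[of "\<sigma> (vtx 1)"]
        by (simp add: chain_boundary_1 h(2) cochain_diff[OF \<phi>c] singular_chain_diff del: One_nat_def)
    qed
    ultimately have "0 = \<phi> ((singular_subdivision 1 ^^ n) ?c) - \<phi> ?c"
      using cochain_add[OF \<phi>c, of ?b ?e] cochain_diff[OF \<phi>c sub c] unfolding eq by simp
    then show ?thesis
      using \<open>\<phi> ((singular_subdivision 1 ^^ n) ?c) = 0\<close> by simp
  qed
  then show ?thesis
    by (rule cochain_eq_0_if_simplices[OF \<phi>c _ c])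
qed

section \<open>Cocycles and coboundaries from values on simplices\<close>

definition extend_cochain :: "nat \<Rightarrow> 'a topology \<Rightarrow> (((nat \<Rightarrow> real) \<Rightarrow> 'a) \<Rightarrow> complex) \<Rightarrow> 'a chain \<Rightarrow> complex"
  where "extend_cochain p X \<theta> =
    (\<lambda>c\<in>singular_chain_set p X. \<Sum>\<sigma>\<in>Poly_Mapping.keys c. of_int (Poly_Mapping.lookup c \<sigma>) * \<theta> \<sigma>)"

lemma extend_cochain_of: "singular_simplex p X \<sigma> \<Longrightarrow> extend_cochain p X \<theta> (frag_of \<sigma>) = \<theta> \<sigma>"
  by (simp add: extend_cochain_def singular_chain_of)

lemma extend_cochain_cochains: "extend_cochain p X \<theta> \<in> carrier (cochains p X)"
  unfolding in_cochains_iff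
proof (intro conjI allI impI)
  fix a b assume ab: "singular_chain p X a" "singular_chain p X b"
  let ?S = "Poly_Mapping.keys a \<union> Poly_Mapping.keys b"
  have eq: "(\<Sum>\<sigma>\<in>Poly_Mapping.keys c. of_int (Poly_Mapping.lookup c \<sigma>) * \<theta> \<sigma>) =
      (\<Sum>\<sigma>\<in>?S. of_int (Poly_Mapping.lookup c \<sigma>) * \<theta> \<sigma>)" if "Poly_Mapping.keys c \<subseteq> ?S" for c
    by (rule sum.mono_neutral_left) (use that in \<open>auto simp: in_keys_iff\<close>)
  show "extend_cochain p X \<theta> (a + b) = extend_cochain p X \<theta> a + extend_cochain p X \<theta> b"
    using ab eq[OF keys_add[of a b]] eq[of a] eq[of b]
    by (simp add: extend_cochain_def singular_chain_add lookup_add distrib_right sum.distrib)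
qed (simp add: extend_cochain_def)

lemma extend_cochain_cocycles:
  assumes "\<And>\<tau>. singular_simplex 2 X \<tau> \<Longrightarrow>
    \<theta> (singular_face 2 0 \<tau>) - \<theta> (singular_face 2 1 \<tau>) + \<theta> (singular_face 2 2 \<tau>) = 0"
  shows "extend_cochain 1 X \<theta> \<in> cocycles 1 X"
proof -
  let ?\<phi> = "extend_cochain 1 X \<theta>"
  have \<phi>c: "?\<phi> \<in> carrier (cochains 1 X)" by (rule extend_cochain_cochains)
  have "coboundary 1 X ?\<phi> c = 0" if c: "singular_chain 2 X c" for c
  proof (rule cochain_eq_0_if_simplices[OF _ _ c])
    show "coboundary 1 X ?\<phi> \<in> carrier (cochains 2 X)"
      using cochain_add[OF \<phi>c] singular_chain_boundary_alt[of 1 X]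
      by (auto simp: in_cochains_iff coboundary_def chain_boundary_add singular_chain_add numeral_2_eq_2)
    fix \<tau> assume \<tau>: "singular_simplex 2 X \<tau>"
    have face: "singular_simplex 1 X (singular_face 2 k \<tau>)" if "k \<le> 2" for k
      using singular_simplex_singular_face[OF \<tau> _ that] by simp
    then have "singular_chain 1 X (frag_of (singular_face 2 k \<tau>))" if "k \<le> 2" for k
      using that by (simp add: singular_chain_of)
    then have "?\<phi> (chain_boundary 2 (frag_of \<tau>)) = 0"
      using assms[OF \<tau>] face
      by (simp add: chain_boundary_2 cochain_add[OF \<phi>c] cochain_diff[OF \<phi>c] singular_chain_diff
          extend_cochain_of del: One_nat_def)
    then show "coboundary 1 X ?\<phi> (frag_of \<tau>) = 0"
      using \<tau> by (simp add: coboundary_def singular_chain_of numeral_2_eq_2)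
  qed
  then show ?thesis
    using \<phi>c by (auto simp: in_cocycles_iff coboundary_def numeral_2_eq_2)
qed

text \<open>Read as a 0-cochain, \<open>f\<close> has a coboundary that agrees with \<phi> on small
  simplices. The difference is a cocycle to which \<open>cocycle_eq_0_if_small\<close>
  applies.\<close>

lemma coboundaryI_small:
  assumes \<phi>: "\<phi> \<in> cocycles 1 X" and op: "\<And>U. U \<in> \<C> \<Longrightarrow> openin X U" and cov: "topspace X \<subseteq> \<Union>\<C>"
    and small: "\<And>\<sigma> U. U \<in> \<C> \<Longrightarrow> singular_simplex 1 X \<sigma> \<Longrightarrow> \<sigma> ` standard_simplex 1 \<subseteq> U \<Longrightarrow>
      \<phi> (frag_of \<sigma>) = f (\<sigma> (vtx 1)) - f (\<sigma> (vtx 0))"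
  shows "\<phi> \<in> coboundaries 1 X"
proof -
  define g where "g = extend_cochain 0 X (\<lambda>s. f (s (vtx 0)))"
  have gc: "g \<in> carrier (cochains 0 X)" unfolding g_def by (rule extend_cochain_cochains)
  define \<delta> where "\<delta> = coboundary 0 X g"
  have \<delta>B: "\<delta> \<in> coboundaries 1 X"
    using gc by (simp add: \<delta>_def coboundaries_def)
  then have \<delta>Z: "\<delta> \<in> cocycles 1 X" using coboundaries_subset_cocycles[of 0] by auto
  have \<delta>1: "\<delta> (frag_of \<sigma>) = f (\<sigma> (vtx 1)) - f (\<sigma> (vtx 0))" if \<sigma>: "singular_simplex 1 X \<sigma>" for \<sigma>
  proof -
    have "\<sigma> (vtx 0) \<in> topspace X" "\<sigma> (vtx 1) \<in> topspace X"
      using \<sigma> by (auto simp: singular_simplex_def continuous_map_def Pi_iff)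
    then have pts: "singular_simplex 0 X (point_simplex (\<sigma> (vtx 0)))"
      "singular_simplex 0 X (point_simplex (\<sigma> (vtx 1)))"
      by (auto intro: singular_simplex_point)
    then have "g (chain_boundary 1 (frag_of \<sigma>)) = f (\<sigma> (vtx 1)) - f (\<sigma> (vtx 0))"
      unfolding chain_boundary_1
      by (subst cochain_diff[OF gc]) (auto simp: singular_chain_of g_def extend_cochain_of)
    then show ?thesis
      using \<sigma> by (simp add: \<delta>_def coboundary_def singular_chain_of)
  qed
  define \<psi> where "\<psi> = \<phi> \<oplus>\<^bsub>cochains 1 X\<^esub> ((-1) \<odot>\<^bsub>cochains 1 X\<^esub> \<delta>)"
  have \<psi>Z: "\<psi> \<in> cocycles 1 X"
    unfolding \<psi>_def by (intro cocycles_add cocycles_smult \<phi> \<delta>Z)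
  have \<psi>: "\<psi> c = \<phi> c - \<delta> c" if "singular_chain 1 X c" for c
    using that by (simp add: \<psi>_def cochains_simps)
  have "\<psi> c = 0" if c: "singular_chain 1 X c" for c
    by (rule cocycle_eq_0_if_small[OF \<psi>Z op cov _ c])
       (use small \<delta>1 \<psi> in \<open>auto simp: singular_chain_of\<close>)
  then have "\<phi> c = \<delta> c" if "singular_chain 1 X c" for c
    using \<psi> that by force
  moreover have "\<phi> \<in> extensional (singular_chain_set 1 X)" "\<delta> \<in> extensional (singular_chain_set 1 X)"
    using \<phi> \<delta>Z by (auto simp: in_cocycles_iff in_cochains_iff)
  ultimately have "\<phi> = \<delta>"
    by (intro extensionalityI[of \<phi> "singular_chain_set 1 X" \<delta>]) auto
  then show ?thesis using \<delta>B by simp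
qed

section \<open>Cocycles from continuous logarithms\<close>

lemma connected_standard_simplex: "connected (standard_simplex p)"
  using connectedin_standard_simplex[of p] by (simp add: euclidean_product_topology)

text \<open>The simplex lives in a space of functions. The maps \<open>pr\<close> and
  \<open>em\<close> identify it with a convex set in the complex plane, where a nonvanishing
  function has a logarithm. The bound on \<open>p\<close> makes the coordinates 1 and 2 sufficient,
  coordinate 0 being one minus their sum.\<close>

lemma continuous_logarithm_on_standard_simplex:
  assumes p: "p \<le> 2" and f: "continuous_on (standard_simplex p) f"
    and nz: "\<And>x. x \<in> standard_simplex p \<Longrightarrow> f x \<noteq> (0::complex)"
  obtains g where "continuous_on (standard_simplex p) g"
    "\<And>x. x \<in> standard_simplex p \<Longrightarrow> f x = exp (g x)"
proof -
  define pr where "pr x = Complex (x 1) (x 2)" for x :: "nat \<Rightarrow> real"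
  define em :: "complex \<Rightarrow> nat \<Rightarrow> real" where
    "em z i = (if i = 0 then 1 - Re z - Im z else if i = 1 then Re z else if i = 2 then Im z else 0)" for z i
  let ?T = "pr ` standard_simplex p"
  have em_pr: "em (pr x) = x" if "x \<in> standard_simplex p" for x
  proof -
    have x: "x \<in> standard_simplex 2" using standard_simplex_mono[OF p] that by auto
    have "{..2::nat} = {0, 1, 2}" by auto
    with x have "x 0 + x 1 + x 2 = 1" "\<And>i. i > 2 \<Longrightarrow> x i = 0"
      by (auto simp: standard_simplex_def)
    then show ?thesis by (auto simp: em_def pr_def fun_eq_iff)
  qed
  have "convex ?T"
    unfolding convex_alt
  proof (intro ballI allI impI)
    fix a b u assume "a \<in> ?T" "b \<in> ?T" and u: "0 \<le> (u::real) \<and> u \<le> 1"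
    then obtain x y where xy: "x \<in> standard_simplex p" "y \<in> standard_simplex p" "a = pr x" "b = pr y"
      by blast
    have "(1 - u) *\<^sub>R a + u *\<^sub>R b = pr (\<lambda>i. (1 - u) * x i + u * y i)"
      by (simp add: xy pr_def complex_eq_iff)
    then show "(1 - u) *\<^sub>R a + u *\<^sub>R b \<in> ?T"
      using convex_standard_simplex[of x p y u] xy u by auto
  qed
  then have "contractible ?T" by (rule convex_imp_contractible)
  moreover have "continuous_on ?T (\<lambda>z. f (em z))"
  proof (rule continuous_on_compose2[OF f])
    show "continuous_on ?T em"
    proof (rule continuous_on_coordinatewise_then_product)
      fix i show "continuous_on ?T (\<lambda>z. em z i)"
        unfolding em_def by (cases "i = 0"; cases "i = 1"; cases "i = 2") (auto intro!: continuous_intros)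
    qed
  qed (auto simp: em_pr)
  moreover have "f (em z) \<noteq> 0" if "z \<in> ?T" for z
    using that nz em_pr by auto
  ultimately obtain g where g: "continuous_on ?T g" "\<And>z. z \<in> ?T \<Longrightarrow> f (em z) = exp (g z)"
    using continuous_logarithm_on_contractible[of ?T "\<lambda>z. f (em z)"] by blast
  show ?thesis
  proof (rule that[of "g \<circ> pr"])
    have "continuous_on (standard_simplex p) pr"
      unfolding pr_def Complex_eq
      by (intro continuous_intros continuous_on_subset[OF continuous_on_product_coordinates]) auto
    then show "continuous_on (standard_simplex p) (g \<circ> pr)"
      by (rule continuous_on_compose) (rule g(1))
    show "f x = exp ((g \<circ> pr) x)" if "x \<in> standard_simplex p" for x
      using g(2)[of "pr x"] that by (simp add: em_pr)
  qed
qed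

text \<open>The integral of \<open>dw / w\<close> along \<sigma>, defined through a continuous
  logarithm because \<sigma> and \<open>w\<close> are merely continuous.\<close>

definition log_change :: "('a \<Rightarrow> complex) \<Rightarrow> ((nat \<Rightarrow> real) \<Rightarrow> 'a) \<Rightarrow> complex" where
  "log_change w \<sigma> = (THE z. \<exists>g. continuous_on (standard_simplex 1) g \<and>
     (\<forall>x\<in>standard_simplex 1. w (\<sigma> x) = exp (g x)) \<and> z = g (vtx 1) - g (vtx 0))"

text \<open>Two logarithms of the same function differ by a continuous function whose distinct
  values are at least \<open>2 * pi\<close> apart; on the connected simplex it is constant.\<close>

lemma log_change_eq:
  assumes g: "continuous_on (standard_simplex 1) g" "\<And>x. x \<in> standard_simplex 1 \<Longrightarrow> w (\<sigma> x) = exp (g x)"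
  shows "log_change w \<sigma> = g (vtx 1) - g (vtx 0)"
  unfolding log_change_def
proof (rule the_equality)
  fix z assume "\<exists>g. continuous_on (standard_simplex 1) g \<and>
     (\<forall>x\<in>standard_simplex 1. w (\<sigma> x) = exp (g x)) \<and> z = g (vtx 1) - g (vtx 0)"
  then obtain g' where g': "continuous_on (standard_simplex 1) g'"
    "\<And>x. x \<in> standard_simplex 1 \<Longrightarrow> w (\<sigma> x) = exp (g' x)" "z = g' (vtx 1) - g' (vtx 0)" by blast
  let ?D = "\<lambda>x. g' x - g x"
  have "?D constant_on standard_simplex 1"
  proof (rule continuous_discrete_range_constant[OF connected_standard_simplex])
    show "continuous_on (standard_simplex 1) ?D" by (intro continuous_intros g g')
    fix x assume x: "x \<in> standard_simplex 1"
    have "2 * pi \<le> norm (?D y - ?D x)" if y: "y \<in> standard_simplex 1" "?D y \<noteq> ?D x" for y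
    proof -
      have "exp (?D y) = exp (?D x)"
        using g(2) g'(2) x y by (simp add: exp_diff)
      then obtain n :: int where n: "?D y = ?D x + of_int (2 * n) * pi * \<i>"
        unfolding exp_eq by auto
      then have "n \<noteq> 0" using y(2) by auto
      then have "1 \<le> \<bar>real_of_int n\<bar>" by linarith
      moreover have "norm (?D y - ?D x) = 2 * \<bar>real_of_int n\<bar> * pi"
        unfolding n by (simp add: norm_mult)
      ultimately show ?thesis by simp
    qed
    then show "\<exists>e>0. \<forall>y. y \<in> standard_simplex 1 \<and> ?D y \<noteq> ?D x \<longrightarrow> e \<le> norm (?D y - ?D x)"
      by (intro exI[of _ "2 * pi"]) auto
  qed
  then obtain k where "\<And>x. x \<in> standard_simplex 1 \<Longrightarrow> g' x - g x = k"
    by (auto simp: constant_on_def)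
  from this[of "vtx 0"] this[of "vtx 1"] show "z = g (vtx 1) - g (vtx 0)"
    using g'(3) by (simp add: algebra_simps)
qed (use g in blast)

text \<open>One logarithm on the 2-simplex serves all three faces, and the alternating sum of its
  changes telescopes.\<close>

lemma log_change_cocycle:
  fixes X :: "'a::topological_space set"
  assumes w: "continuous_on X w" and nz: "\<And>x. x \<in> X \<Longrightarrow> w x \<noteq> 0"
  shows "extend_cochain 1 (top_of_set X) (log_change w) \<in> cocycles 1 (top_of_set X)"
proof (rule extend_cochain_cocycles)
  fix \<tau> assume "singular_simplex 2 (top_of_set X) \<tau>"
  then have \<tau>: "continuous_on (standard_simplex 2) \<tau>" "\<tau> ` standard_simplex 2 \<subseteq> X"
    by (auto simp: singular_simplex_top_of_set)
  have "continuous_on (standard_simplex 2) (\<lambda>x. w (\<tau> x))"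
    by (rule continuous_on_compose2[OF w \<tau>])
  then obtain g where g: "continuous_on (standard_simplex 2) g"
    "\<And>x. x \<in> standard_simplex 2 \<Longrightarrow> w (\<tau> x) = exp (g x)"
    by (rule continuous_logarithm_on_standard_simplex[rotated]) (use \<tau> nz in auto)
  have "log_change w (singular_face 2 k \<tau>) = g (simplical_face k (vtx 1)) - g (simplical_face k (vtx 0))"
    if k: "k \<le> 2" for k
  proof -
    have sub: "simplical_face k x \<in> standard_simplex 2" if "x \<in> standard_simplex 1" for x
      using simplical_face_in_standard_simplex[of 2 k x] that k by simp
    have cont: "continuous_on (standard_simplex 1) (simplical_face k :: (nat \<Rightarrow> real) \<Rightarrow> nat \<Rightarrow> real)"
    proof (rule continuous_on_coordinatewise_then_product)
      fix i
      show "continuous_on (standard_simplex 1) (\<lambda>x. simplical_face k x i :: real)"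
        unfolding simplical_face_def
        by (cases "i < k"; cases "i = k")
           (auto intro: continuous_on_subset[OF continuous_on_product_coordinates])
    qed
    show ?thesis
    proof (rule log_change_eq[where g = "\<lambda>x. g (simplical_face k x)"])
      show "continuous_on (standard_simplex 1) (\<lambda>x. g (simplical_face k x))"
        by (rule continuous_on_compose2[OF g(1) cont]) (use sub in auto)
      show "w (singular_face 2 k \<tau> x) = exp (g (simplical_face k x))" if "x \<in> standard_simplex 1" for x
        using that g(2)[OF sub[OF that]] by (simp add: singular_face_def)
    qed
  qed
  then show "log_change w (singular_face 2 0 \<tau>) - log_change w (singular_face 2 1 \<tau>)
      + log_change w (singular_face 2 2 \<tau>) = 0"
    by (simp add: simplical_face_vtx numeral_2_eq_2)
qed

section \<open>Spaces covered by two families of contractible sheets\<close>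

text \<open>Because the sets are disjoint, their primitives are restrictions of one function, which
  later makes one \<open>fP\<close> serve all sheets \<open>P \<xi>\<close>.\<close>

lemma cocycle_primitive_family:
  fixes X :: "'a::real_normed_vector set"
  assumes \<phi>: "\<phi> \<in> cocycles 1 (top_of_set X)"
    and S: "\<And>i. i \<in> I \<Longrightarrow> S i \<subseteq> X" "\<And>i. i \<in> I \<Longrightarrow> contractible (S i)"
    and disj: "\<And>i j x. i \<in> I \<Longrightarrow> j \<in> I \<Longrightarrow> x \<in> S i \<Longrightarrow> x \<in> S j \<Longrightarrow> i = j"
  obtains f where "\<And>i \<sigma>. i \<in> I \<Longrightarrow> singular_simplex 1 (top_of_set (S i)) \<sigma> \<Longrightarrow>
    \<phi> (frag_of \<sigma>) = f (\<sigma> (vtx 1)) - f (\<sigma> (vtx 0))"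
proof -
  have "\<exists>g. \<forall>i\<in>I. \<forall>\<sigma>. singular_simplex 1 (top_of_set (S i)) \<sigma> \<longrightarrow>
      \<phi> (frag_of \<sigma>) = g i (\<sigma> (vtx 1)) - g i (\<sigma> (vtx 0))"
    by (rule bchoice) (use cocycle_primitive[OF \<phi>] S in blast)
  then obtain g where g: "\<And>i \<sigma>. i \<in> I \<Longrightarrow> singular_simplex 1 (top_of_set (S i)) \<sigma> \<Longrightarrow>
      \<phi> (frag_of \<sigma>) = g i (\<sigma> (vtx 1)) - g i (\<sigma> (vtx 0))" by blast
  define f where "f x = g (THE i. i \<in> I \<and> x \<in> S i) x" for x
  have f: "f x = g i x" if "i \<in> I" "x \<in> S i" for i x
  proof -
    have "(THE i. i \<in> I \<and> x \<in> S i) = i" using that disj by blast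
    then show ?thesis by (simp add: f_def)
  qed
  show ?thesis
  proof (rule that)
    fix i \<sigma> assume i: "i \<in> I" and \<sigma>: "singular_simplex 1 (top_of_set (S i)) \<sigma>"
    then have "\<sigma> (vtx 0) \<in> S i" "\<sigma> (vtx 1) \<in> S i" by (auto simp: singular_simplex_top_of_set)
    then show "\<phi> (frag_of \<sigma>) = f (\<sigma> (vtx 1)) - f (\<sigma> (vtx 0))"
      using g[OF i \<sigma>] f[OF i] by simp
  qed
qed

text \<open>The index sets of the sheets \<open>P\<close>, \<open>Q\<close> and of the strips \<open>S j\<close> are the \<open>d\<close>-th roots of unity,
  on which \<open>A\<close> acts by translation. The incidence relation of sheets and strips is the graph of
  \<open>graph_functional\<close>.\<close>

locale sheet_cover =
  fixes X :: "'a::euclidean_space set" and d :: nat and A :: "complex \<Rightarrow> 'a \<Rightarrow> 'a"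
    and P Q :: "complex \<Rightarrow> 'a set" and S :: "nat \<Rightarrow> complex \<Rightarrow> 'a set"
  assumes d: "d > 0"
    and P_open: "\<xi> ^ d = 1 \<Longrightarrow> openin (top_of_set X) (P \<xi>)"
    and Q_open: "\<xi> ^ d = 1 \<Longrightarrow> openin (top_of_set X) (Q \<xi>)"
    and P_contractible: "\<xi> ^ d = 1 \<Longrightarrow> contractible (P \<xi>)"
    and Q_contractible: "\<xi> ^ d = 1 \<Longrightarrow> contractible (Q \<xi>)"
    and P_disjoint: "\<xi> ^ d = 1 \<Longrightarrow> \<eta> ^ d = 1 \<Longrightarrow> x \<in> P \<xi> \<Longrightarrow> x \<in> P \<eta> \<Longrightarrow> \<xi> = \<eta>"
    and Q_disjoint: "\<xi> ^ d = 1 \<Longrightarrow> \<eta> ^ d = 1 \<Longrightarrow> x \<in> Q \<xi> \<Longrightarrow> x \<in> Q \<eta> \<Longrightarrow> \<xi> = \<eta>"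
    and cover: "x \<in> X \<Longrightarrow> \<exists>\<xi>. \<xi> ^ d = 1 \<and> (x \<in> P \<xi> \<or> x \<in> Q \<xi>)"
    and S_sub_P: "j < d \<Longrightarrow> \<xi> ^ d = 1 \<Longrightarrow> S j \<xi> \<subseteq> P \<xi>"
    and S_sub_Q: "j < d \<Longrightarrow> \<xi> ^ d = 1 \<Longrightarrow> S j \<xi> \<subseteq> Q (\<xi> * unity_root d ^ j)"
    and S_cover: "\<xi> ^ d = 1 \<Longrightarrow> \<eta> ^ d = 1 \<Longrightarrow> x \<in> P \<xi> \<Longrightarrow> x \<in> Q \<eta> \<Longrightarrow> \<exists>j<d. x \<in> S j \<xi>"
    and S_open: "j < d \<Longrightarrow> \<xi> ^ d = 1 \<Longrightarrow> openin (top_of_set X) (S j \<xi>)"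
    and S_connected: "j < d \<Longrightarrow> \<xi> ^ d = 1 \<Longrightarrow> path_connected (S j \<xi>)"
    and S_nonempty: "j < d \<Longrightarrow> S j 1 \<noteq> {}"
    and S_disjoint: "j < d \<Longrightarrow> j' < d \<Longrightarrow> \<xi> ^ d = 1 \<Longrightarrow> x \<in> S j \<xi> \<Longrightarrow> x \<in> S j' \<xi> \<Longrightarrow> j = j'"
    and A_continuous: "\<xi> ^ d = 1 \<Longrightarrow> continuous_on X (A \<xi>)"
    and A_X: "\<xi> ^ d = 1 \<Longrightarrow> x \<in> X \<Longrightarrow> A \<xi> x \<in> X"
    and A_P: "\<xi> ^ d = 1 \<Longrightarrow> \<eta> ^ d = 1 \<Longrightarrow> x \<in> P \<eta> \<Longrightarrow> A \<xi> x \<in> P (\<eta> * \<xi>)"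
    and A_Q: "\<xi> ^ d = 1 \<Longrightarrow> \<eta> ^ d = 1 \<Longrightarrow> x \<in> Q \<eta> \<Longrightarrow> A \<xi> x \<in> Q (\<eta> * \<xi>)"
    and A_S: "j < d \<Longrightarrow> \<xi> ^ d = 1 \<Longrightarrow> \<eta> ^ d = 1 \<Longrightarrow> x \<in> S j \<eta> \<Longrightarrow> A \<xi> x \<in> S j (\<eta> * \<xi>)"
    and A_mult: "\<xi> ^ d = 1 \<Longrightarrow> \<eta> ^ d = 1 \<Longrightarrow> x \<in> X \<Longrightarrow> A \<xi> (A \<eta> x) = A (\<eta> * \<xi>) x"
begin

section \<open>Base points, paths and the graph cochain of a cocycle\<close>

lemma P_sub: "\<xi> ^ d = 1 \<Longrightarrow> P \<xi> \<subseteq> X"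
  using P_open openin_imp_subset by blast

lemma Q_sub: "\<xi> ^ d = 1 \<Longrightarrow> Q \<xi> \<subseteq> X"
  using Q_open openin_imp_subset by blast

lemma unity_root_power_unity [simp]: "(unity_root d ^ j) ^ d = 1"
  using d by (metis power_commutes power_mult power_one unity_root_power_self mult.commute)

lemma mult_unity: "\<xi> ^ d = 1 \<Longrightarrow> \<eta> ^ d = 1 \<Longrightarrow> (\<xi> * \<eta>) ^ d = (1::complex)"
  by (simp add: power_mult_distrib)

text \<open>Base points are chosen only in the sheets and strips with index 1 and are carried to the
  others by \<open>A\<close>. Everything built from them is then equivariant without further
  choices.\<close>

definition "s j = (SOME x. x \<in> S j 1)"
definition "p = (SOME x. x \<in> P 1)"
definition "q = (SOME x. x \<in> Q 1)"

lemma s_in: "j < d \<Longrightarrow> s j \<in> S j 1"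
  unfolding s_def using S_nonempty[of j] by (simp add: some_in_eq)

lemma p_in: "p \<in> P 1"
  unfolding p_def using S_nonempty[OF d] S_sub_P[OF d, of 1] by (auto simp: some_in_eq)

lemma q_in: "q \<in> Q 1"
  unfolding q_def using S_nonempty[OF d] S_sub_Q[OF d, of 1] by (auto simp: some_in_eq)

lemma As_in: "j < d \<Longrightarrow> \<xi> ^ d = 1 \<Longrightarrow> A \<xi> (s j) \<in> S j \<xi>"
  using A_S[of j \<xi> 1, OF _ _ _ s_in] by simp

definition "\<alpha> j = (SOME \<sigma>. singular_simplex 1 (top_of_set (P 1)) \<sigma> \<and> \<sigma> (vtx 0) = p \<and> \<sigma> (vtx 1) = s j)"

definition "\<beta> j = (SOME \<sigma>. singular_simplex 1 (top_of_set (Q (unity_root d ^ j))) \<sigma> \<and>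
  \<sigma> (vtx 0) = A (unity_root d ^ j) q \<and> \<sigma> (vtx 1) = s j)"

lemma \<alpha>:
  assumes "j < d"
  shows "singular_simplex 1 (top_of_set (P 1)) (\<alpha> j)" "\<alpha> j (vtx 0) = p" "\<alpha> j (vtx 1) = s j"
proof -
  have "s j \<in> P 1" using s_in[OF assms] S_sub_P[OF assms, of 1] by auto
  then have "\<exists>\<sigma>. singular_simplex 1 (top_of_set (P 1)) \<sigma> \<and> \<sigma> (vtx 0) = p \<and> \<sigma> (vtx 1) = s j"
    using path_connected_simplex[OF contractible_imp_path_connected[OF P_contractible[of 1]] p_in]
    by (metis power_one)
  from someI_ex[OF this] show "singular_simplex 1 (top_of_set (P 1)) (\<alpha> j)"
    "\<alpha> j (vtx 0) = p" "\<alpha> j (vtx 1) = s j"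
    by (auto simp: \<alpha>_def)
qed

lemma \<beta>:
  assumes "j < d"
  shows "singular_simplex 1 (top_of_set (Q (unity_root d ^ j))) (\<beta> j)"
    "\<beta> j (vtx 0) = A (unity_root d ^ j) q" "\<beta> j (vtx 1) = s j"
proof -
  have 1: "s j \<in> Q (unity_root d ^ j)" using s_in[OF assms] S_sub_Q[OF assms, of 1] by auto
  have 2: "A (unity_root d ^ j) q \<in> Q (unity_root d ^ j)"
    using A_Q[of "unity_root d ^ j" 1 q] q_in by simp
  obtain \<sigma> where "singular_simplex 1 (top_of_set (Q (unity_root d ^ j))) \<sigma>"
      "\<sigma> (vtx 0) = A (unity_root d ^ j) q" "\<sigma> (vtx 1) = s j"
    by (rule path_connected_simplex[OF contractible_imp_path_connected[OF
          Q_contractible[OF unity_root_power_unity]] 2 1])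
  then have "\<exists>\<sigma>. singular_simplex 1 (top_of_set (Q (unity_root d ^ j))) \<sigma> \<and>
      \<sigma> (vtx 0) = A (unity_root d ^ j) q \<and> \<sigma> (vtx 1) = s j" by blast
  from someI_ex[OF this] show "singular_simplex 1 (top_of_set (Q (unity_root d ^ j))) (\<beta> j)"
    "\<beta> j (vtx 0) = A (unity_root d ^ j) q" "\<beta> j (vtx 1) = s j"
    by (auto simp: \<beta>_def)
qed

lemma simplex_map_A:
  assumes "\<xi> ^ d = 1" "singular_simplex 1 (top_of_set T) \<sigma>" "T \<subseteq> X" "A \<xi> ` T \<subseteq> T'"
  shows "singular_simplex 1 (top_of_set T') (simplex_map 1 (A \<xi>) \<sigma>)"
proof (rule singular_simplex_simplex_map[OF assms(2)])
  show "continuous_map (top_of_set T) (top_of_set T') (A \<xi>)"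
    using continuous_on_subset[OF A_continuous[OF assms(1)] assms(3)] assms(4) by auto
qed

lemma simplex_map_vtx [simp]: "i \<le> 1 \<Longrightarrow> simplex_map 1 f \<sigma> (vtx i) = f (\<sigma> (vtx i))"
  by (simp add: simplex_map_def)

text \<open>The value of \<phi> on the path from the base point of \<open>P \<xi>\<close> through
  the strip \<open>S j \<xi>\<close> to the base point of
  \<open>Q (\<xi> * unity_root d ^ j)\<close>. It involves no choice of primitives, hence it is
  linear in \<phi> and commutes with translations.\<close>

definition edge :: "('a chain \<Rightarrow> complex) \<Rightarrow> nat \<Rightarrow> complex \<Rightarrow> complex" where
  "edge \<phi> j \<xi> = \<phi> (frag_of (simplex_map 1 (A \<xi>) (\<alpha> j))) - \<phi> (frag_of (simplex_map 1 (A \<xi>) (\<beta> j)))"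

lemma A\<alpha>:
  assumes "j < d" "\<xi> ^ d = 1"
  shows "singular_simplex 1 (top_of_set (P \<xi>)) (simplex_map 1 (A \<xi>) (\<alpha> j))"
  by (rule simplex_map_A[OF assms(2) \<alpha>(1)[OF assms(1)]])
     (use P_sub[of 1] A_P[OF assms(2), of 1] in auto)

lemma A\<beta>:
  assumes "j < d" "\<xi> ^ d = 1"
  shows "singular_simplex 1 (top_of_set (Q (\<xi> * unity_root d ^ j))) (simplex_map 1 (A \<xi>) (\<beta> j))"
  by (rule simplex_map_A[OF assms(2) \<beta>(1)[OF assms(1)]])
     (use Q_sub[of "unity_root d ^ j"] A_Q[OF assms(2), of "unity_root d ^ j"] in
       \<open>auto simp: mult.commute\<close>)

lemma A\<alpha>_chain: "j < d \<Longrightarrow> \<xi> ^ d = 1 \<Longrightarrow>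
    singular_chain 1 (top_of_set X) (frag_of (simplex_map 1 (A \<xi>) (\<alpha> j)))"
  using singular_chain_of_subset[OF A\<alpha> P_sub] .

lemma A\<beta>_chain: "j < d \<Longrightarrow> \<xi> ^ d = 1 \<Longrightarrow>
    singular_chain 1 (top_of_set X) (frag_of (simplex_map 1 (A \<xi>) (\<beta> j)))"
  using singular_chain_of_subset[OF A\<beta> Q_sub] by (simp add: mult_unity)

definition primitives :: "('a chain \<Rightarrow> complex) \<Rightarrow> ('a \<Rightarrow> complex) \<Rightarrow> ('a \<Rightarrow> complex) \<Rightarrow> bool" where
  "primitives \<phi> fP fQ \<longleftrightarrow> (\<forall>\<xi> \<sigma>. \<xi> ^ d = 1 \<longrightarrow>
     (singular_simplex 1 (top_of_set (P \<xi>)) \<sigma> \<longrightarrow> \<phi> (frag_of \<sigma>) = fP (\<sigma> (vtx 1)) - fP (\<sigma> (vtx 0))) \<and>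
     (singular_simplex 1 (top_of_set (Q \<xi>)) \<sigma> \<longrightarrow> \<phi> (frag_of \<sigma>) = fQ (\<sigma> (vtx 1)) - fQ (\<sigma> (vtx 0))))"

lemma primitives_exist:
  assumes \<phi>: "\<phi> \<in> cocycles 1 (top_of_set X)"
  obtains fP fQ where "primitives \<phi> fP fQ"
proof -
  obtain fP where "\<And>\<xi> \<sigma>. \<xi> \<in> {\<xi>. \<xi> ^ d = 1} \<Longrightarrow> singular_simplex 1 (top_of_set (P \<xi>)) \<sigma> \<Longrightarrow>
    \<phi> (frag_of \<sigma>) = fP (\<sigma> (vtx 1)) - fP (\<sigma> (vtx 0))"
    by (rule cocycle_primitive_family[OF \<phi>, of "{\<xi>. \<xi> ^ d = 1}" P])
       (use P_sub P_contractible P_disjoint in auto)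
  moreover obtain fQ where "\<And>\<xi> \<sigma>. \<xi> \<in> {\<xi>. \<xi> ^ d = 1} \<Longrightarrow> singular_simplex 1 (top_of_set (Q \<xi>)) \<sigma> \<Longrightarrow>
    \<phi> (frag_of \<sigma>) = fQ (\<sigma> (vtx 1)) - fQ (\<sigma> (vtx 0))"
    by (rule cocycle_primitive_family[OF \<phi>, of "{\<xi>. \<xi> ^ d = 1}" Q])
       (use Q_sub Q_contractible Q_disjoint in auto)
  ultimately have "primitives \<phi> fP fQ" by (simp add: primitives_def)
  then show ?thesis by (rule that)
qed

text \<open>The first bracket is the jump between the primitives on the strip, the quantity of the
  Mayer--Vietoris argument. The second is a coboundary of the graph.\<close>

lemma edge_eq:
  assumes "primitives \<phi> fP fQ" "j < d" "\<xi> ^ d = 1"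
  shows "edge \<phi> j \<xi> = (fP (A \<xi> (s j)) - fQ (A \<xi> (s j)))
    + (fQ (A (\<xi> * unity_root d ^ j) q) - fP (A \<xi> p))"
proof -
  have "A \<xi> (A (unity_root d ^ j) q) = A (\<xi> * unity_root d ^ j) q"
    using A_mult[of \<xi> "unity_root d ^ j" q] assms Q_sub[of 1] q_in by (auto simp: mult.commute)
  moreover have "\<phi> (frag_of (simplex_map 1 (A \<xi>) (\<alpha> j))) = fP (A \<xi> (s j)) - fP (A \<xi> p)"
    using assms(1,3) A\<alpha>[OF assms(2,3)] \<alpha>[OF assms(2)] simplex_map_vtx
    unfolding primitives_def by (metis le_refl zero_le)
  moreover have "\<phi> (frag_of (simplex_map 1 (A \<xi>) (\<beta> j))) =
      fQ (A \<xi> (s j)) - fQ (A \<xi> (A (unity_root d ^ j) q))"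
    using assms(1) A\<beta>[OF assms(2,3)] \<beta>[OF assms(2)] mult_unity[OF assms(3) unity_root_power_unity]
      simplex_map_vtx
    unfolding primitives_def by (metis le_refl zero_le)
  ultimately show ?thesis by (simp add: edge_def)
qed

lemma edge_add:
  assumes "j < d" "\<xi> ^ d = 1"
  shows "edge (\<phi> \<oplus>\<^bsub>cochains 1 (top_of_set X)\<^esub> \<psi>) j \<xi> = edge \<phi> j \<xi> + edge \<psi> j \<xi>"
  using A\<alpha>_chain[OF assms] A\<beta>_chain[OF assms] by (simp add: edge_def cochains_simps(2) del: One_nat_def)

lemma edge_smult:
  assumes "j < d" "\<xi> ^ d = 1"
  shows "edge (a \<odot>\<^bsub>cochains 1 (top_of_set X)\<^esub> \<phi>) j \<xi> = a * edge \<phi> j \<xi>"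
  using A\<alpha>_chain[OF assms] A\<beta>_chain[OF assms]
  by (simp add: edge_def cochains_simps(4) right_diff_distrib del: One_nat_def)

lemma edge_pullback:
  assumes j: "j < d" and \<eta>: "\<eta> ^ d = 1" and \<xi>: "\<xi> ^ d = 1"
  shows "edge (cochain_pullback 1 (top_of_set X) (A \<xi>) \<phi>) j \<eta> = edge \<phi> j (\<eta> * \<xi>)"
proof -
  have "simplex_map 1 (A \<xi>) (simplex_map 1 (A \<eta>) \<sigma>) = simplex_map 1 (A (\<eta> * \<xi>)) \<sigma>"
    if "singular_simplex 1 (top_of_set T) \<sigma>" "T \<subseteq> X" for T \<sigma>
    using that A_mult[OF \<xi> \<eta>] by (auto simp: simplex_map_def singular_simplex_top_of_set fun_eq_iff)
  from this[OF \<alpha>(1)[OF j] P_sub] this[OF \<beta>(1)[OF j] Q_sub] show ?thesis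
    using A\<alpha>_chain[OF j \<eta>] A\<beta>_chain[OF j \<eta>]
    by (simp add: edge_def cochain_pullback_def del: One_nat_def)
qed

text \<open>A global primitive can be taken for both \<open>fP\<close> and \<open>fQ\<close>, so the
  jump in \<open>edge_eq\<close> vanishes and only the graph coboundary remains.\<close>

lemma edge_coboundary:
  assumes "\<phi> \<in> coboundaries 1 (top_of_set X)"
  obtains a b where "\<And>j \<xi>. j < d \<Longrightarrow> \<xi> ^ d = 1 \<Longrightarrow> edge \<phi> j \<xi> = a \<xi> - b (\<xi> * unity_root d ^ j)"
proof -
  obtain g where g: "g \<in> carrier (cochains 0 (top_of_set X))" "\<phi> = coboundary 0 (top_of_set X) g"
    using assms by (auto simp: coboundaries_def)
  define f where "f x = g (frag_of (point_simplex x))" for x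
  have "\<phi> (frag_of \<sigma>) = f (\<sigma> (vtx 1)) - f (\<sigma> (vtx 0))"
    if \<sigma>: "singular_simplex 1 (top_of_set X) \<sigma>" for \<sigma>
  proof -
    have "\<sigma> (vtx 0) \<in> X" "\<sigma> (vtx 1) \<in> X" using \<sigma> by (auto simp: singular_simplex_top_of_set)
    then have "singular_chain 0 (top_of_set X) (frag_of (point_simplex (\<sigma> (vtx 0))))"
      "singular_chain 0 (top_of_set X) (frag_of (point_simplex (\<sigma> (vtx 1))))"
      by (auto simp: singular_chain_of intro: singular_simplex_point)
    then have "g (chain_boundary 1 (frag_of \<sigma>)) = f (\<sigma> (vtx 1)) - f (\<sigma> (vtx 0))"
      unfolding chain_boundary_1 f_def by (rule cochain_diff[OF g(1), rotated])
    then show ?thesis using \<sigma> by (simp add: g(2) coboundary_def singular_chain_of)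
  qed
  then have "primitives \<phi> f f"
    using singular_simplex_subset P_sub Q_sub unfolding primitives_def by blast
  from edge_eq[OF this] show ?thesis
    by (intro that[of "\<lambda>\<xi>. - f (A \<xi> p)" "\<lambda>\<xi>. - f (A \<xi> q)"]) simp
qed

text \<open>The hypothesis says that the jumps on the strips are differences of constants attached
  to the sheets. Subtracting these constants makes the primitives agree wherever sheets meet, and
  the glued function \<open>f\<close> is a primitive on each set of the open cover by
  sheets.\<close>

lemma edge_kernel:
  assumes \<phi>: "\<phi> \<in> cocycles 1 (top_of_set X)"
    and ab: "\<And>j \<xi>. j < d \<Longrightarrow> \<xi> ^ d = 1 \<Longrightarrow> edge \<phi> j \<xi> = a \<xi> - b (\<xi> * unity_root d ^ j)"
  shows "\<phi> \<in> coboundaries 1 (top_of_set X)"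
proof -
  obtain fP fQ where f: "primitives \<phi> fP fQ" by (rule primitives_exist[OF \<phi>])
  \<comment> \<open>The added terms absorb the base point contribution in
    \<open>edge_eq\<close>.\<close>
  define a' where "a' \<xi> = a \<xi> + fP (A \<xi> p)" for \<xi>
  define b' where "b' \<xi> = b \<xi> + fQ (A \<xi> q)" for \<xi>
  \<comment> \<open>Both primitives compute \<phi> along a path inside the strip, so their
    difference is constant there and can be read off at the base point
    \<open>A \<xi> (s j)\<close>.\<close>
  have strip: "fP x - fQ x = a' \<xi> - b' (\<xi> * unity_root d ^ j)"
    if j: "j < d" and \<xi>: "\<xi> ^ d = 1" and x: "x \<in> S j \<xi>" for j \<xi> x
  proof -
    obtain \<sigma> where \<sigma>: "singular_simplex 1 (top_of_set (S j \<xi>)) \<sigma>" "\<sigma> (vtx 0) = A \<xi> (s j)" "\<sigma> (vtx 1) = x"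
      by (rule path_connected_simplex[OF S_connected[OF j \<xi>] As_in[OF j \<xi>] x])
    have "\<phi> (frag_of \<sigma>) = fP x - fP (A \<xi> (s j))"
      using f \<xi> singular_simplex_subset[OF \<sigma>(1) S_sub_P[OF j \<xi>]] \<sigma>(2,3)
      unfolding primitives_def by metis
    moreover have "\<phi> (frag_of \<sigma>) = fQ x - fQ (A \<xi> (s j))"
      using f mult_unity[OF \<xi> unity_root_power_unity] singular_simplex_subset[OF \<sigma>(1) S_sub_Q[OF j \<xi>]] \<sigma>(2,3)
      unfolding primitives_def by metis
    ultimately have "fP x - fQ x = fP (A \<xi> (s j)) - fQ (A \<xi> (s j))" by (simp add: algebra_simps)
    also have "\<dots> = edge \<phi> j \<xi> - (fQ (A (\<xi> * unity_root d ^ j) q) - fP (A \<xi> p))"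
      by (simp add: edge_eq[OF f j \<xi>])
    also have "\<dots> = a' \<xi> - b' (\<xi> * unity_root d ^ j)"
      by (simp add: ab[OF j \<xi>] a'_def b'_def)
    finally show ?thesis .
  qed
  define f where "f x = (if \<exists>\<xi>. \<xi> ^ d = 1 \<and> x \<in> P \<xi> then fP x - a' (THE \<xi>. \<xi> ^ d = 1 \<and> x \<in> P \<xi>)
    else fQ x - b' (THE \<xi>. \<xi> ^ d = 1 \<and> x \<in> Q \<xi>))" for x
  have P_the: "(THE \<xi>. \<xi> ^ d = 1 \<and> x \<in> P \<xi>) = \<xi>" if "\<xi> ^ d = 1" "x \<in> P \<xi>" for x \<xi>
    by (rule the_equality) (use that P_disjoint in auto)
  have Q_the: "(THE \<xi>. \<xi> ^ d = 1 \<and> x \<in> Q \<xi>) = \<xi>" if "\<xi> ^ d = 1" "x \<in> Q \<xi>" for x \<xi>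
    by (rule the_equality) (use that Q_disjoint in auto)
  have fP: "f x = fP x - a' \<xi>" if "\<xi> ^ d = 1" "x \<in> P \<xi>" for x \<xi>
    using that P_the[OF that] by (auto simp: f_def)
  have fQ: "f x = fQ x - b' \<eta>" if \<eta>: "\<eta> ^ d = 1" "x \<in> Q \<eta>" for x \<eta>
  proof (cases "\<exists>\<xi>. \<xi> ^ d = 1 \<and> x \<in> P \<xi>")
    case True
    then obtain \<xi> where \<xi>: "\<xi> ^ d = 1" "x \<in> P \<xi>" by blast
    obtain j where j: "j < d" "x \<in> S j \<xi>" using S_cover[OF \<xi>(1) \<eta>(1) \<xi>(2) \<eta>(2)] by blast
    have "\<eta> = \<xi> * unity_root d ^ j"
      using Q_disjoint[OF \<eta>(1) mult_unity[OF \<xi>(1) unity_root_power_unity] \<eta>(2)] S_sub_Q[OF j(1) \<xi>(1)] j(2)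
      by blast
    moreover have "f x = (fP x - fQ x) - a' \<xi> + fQ x"
      by (simp add: fP[OF \<xi>])
    ultimately show ?thesis
      by (simp add: strip[OF j(1) \<xi>(1) j(2)])
  next
    case False
    then show ?thesis using Q_the[OF \<eta>] by (auto simp: f_def)
  qed
  show ?thesis
  proof (rule coboundaryI_small[OF \<phi>, where f = f and
        \<C> = "P ` {\<xi>. \<xi> ^ d = 1} \<union> Q ` {\<xi>. \<xi> ^ d = 1}"])
    show "topspace (top_of_set X) \<subseteq> \<Union> (P ` {\<xi>. \<xi> ^ d = 1} \<union> Q ` {\<xi>. \<xi> ^ d = 1})"
      using cover by auto
    fix \<sigma> U assume \<sigma>: "singular_simplex 1 (top_of_set X) \<sigma>" "\<sigma> ` standard_simplex 1 \<subseteq> U"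
    assume "U \<in> P ` {\<xi>. \<xi> ^ d = 1} \<union> Q ` {\<xi>. \<xi> ^ d = 1}"
    then consider \<xi> where "\<xi> ^ d = 1" "U = P \<xi>" | \<xi> where "\<xi> ^ d = 1" "U = Q \<xi>" by blast
    then show "\<phi> (frag_of \<sigma>) = f (\<sigma> (vtx 1)) - f (\<sigma> (vtx 0))"
    proof cases
      case (1 \<xi>)
      then have \<sigma>P: "singular_simplex 1 (top_of_set (P \<xi>)) \<sigma>"
        using \<sigma> by (auto simp: singular_simplex_top_of_set)
      have "\<sigma> (vtx 0) \<in> P \<xi>" "\<sigma> (vtx 1) \<in> P \<xi>" using \<sigma> 1 by auto
      then show ?thesis
        using \<open>primitives \<phi> fP fQ\<close> \<sigma>P 1 by (simp add: fP primitives_def del: One_nat_def)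
    next
      case (2 \<xi>)
      then have \<sigma>Q: "singular_simplex 1 (top_of_set (Q \<xi>)) \<sigma>"
        using \<sigma> by (auto simp: singular_simplex_top_of_set)
      have "\<sigma> (vtx 0) \<in> Q \<xi>" "\<sigma> (vtx 1) \<in> Q \<xi>" using \<sigma> 2 by auto
      then show ?thesis
        using \<open>primitives \<phi> fP fQ\<close> \<sigma>Q 2 by (simp add: fQ primitives_def del: One_nat_def)
    qed
  qed (use P_open Q_open in auto)
qed

text \<open>The cocycle is the change of the logarithm of a function to \<open>\<complex> - {0}\<close> that winds once
  around \<open>0\<close> across the strip \<open>S j0 \<xi>0\<close> and is \<open>1\<close> off this strip.\<close>

lemma edge_indicator:
  assumes j0: "j0 < d" and \<xi>0: "\<xi>0 ^ d = 1"
  obtains \<phi> a b where "\<phi> \<in> cocycles 1 (top_of_set X)"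
    "\<And>j \<xi>. j < d \<Longrightarrow> \<xi> ^ d = 1 \<Longrightarrow>
      edge \<phi> j \<xi> = (if j = j0 \<and> \<xi> = \<xi>0 then 1 else 0) + (a \<xi> - b (\<xi> * unity_root d ^ j))"
proof -
  let ?M = "{\<xi>::complex. \<xi> ^ d = 1}"
  define C where "C = S j0 \<xi>0"
  define UP where "UP = (\<Union>\<xi>\<in>?M. P \<xi>)"
  define UQ where "UQ = (\<Union>\<xi>\<in>?M. Q \<xi>)"
  have openU: "openin (top_of_set X) UP" "openin (top_of_set X) UQ"
    unfolding UP_def UQ_def by (auto intro!: openin_Union P_open Q_open)
  have UX: "UP \<subseteq> X" "UQ \<subseteq> X"
    using P_sub Q_sub by (auto simp: UP_def UQ_def)
  have XU: "X \<subseteq> UP \<union> UQ"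
    using cover unfolding UP_def UQ_def by blast
  have SU: "S j \<xi> \<subseteq> UP \<inter> UQ" if "j < d" "\<xi> ^ d = 1" for j \<xi>
    using S_sub_P[OF that] S_sub_Q[OF that] mult_unity[OF that(2) unity_root_power_unity] that(2)
    by (auto simp: UP_def UQ_def)
  have CU: "C \<subseteq> UP \<inter> UQ" unfolding C_def by (rule SU[OF j0 \<xi>0])
  have in_C: "j = j0 \<and> \<xi> = \<xi>0" if "j < d" "\<xi> ^ d = 1" "x \<in> S j \<xi>" "x \<in> C" for j \<xi> x
  proof -
    have "\<xi> = \<xi>0"
      using P_disjoint[OF that(2) \<xi>0] S_sub_P[OF that(1,2)] S_sub_P[OF j0 \<xi>0] that(3,4) by (auto simp: C_def)
    then show ?thesis using S_disjoint[OF that(1) j0 \<xi>0] that(3,4) by (auto simp: C_def)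
  qed
  have "closedin (top_of_set X) (X - UQ)" "closedin (top_of_set X) (X - UP)"
    using openU by (auto intro!: closedin_diff)
  moreover have "(X - UQ) \<inter> (X - UP) = {}" using XU by auto
  \<comment> \<open>A height function that is 0 where only sheets of type \<open>P\<close> cover and
    1 where only sheets of type \<open>Q\<close> cover; all intermediate values occur on
    strips.\<close>
  ultimately obtain \<rho> :: "'a \<Rightarrow> real" where \<rho>: "continuous_on X \<rho>"
    "\<And>x. x \<in> X - UQ \<Longrightarrow> \<rho> x = 0" "\<And>x. x \<in> X - UP \<Longrightarrow> \<rho> x = 1"
    using Urysohn_local[of X "X - UQ" "X - UP" "0::real" 1] by metis
  \<comment> \<open>\<open>K\<close> is closed because its complement consists of the other strips,
    and \<open>L\<close> is closed because \<open>C\<close> is open. On \<open>K\<close> outside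
    \<open>C\<close> the function \<rho> is 0 or 1, so the exponential matches the constant 1 there
    and \<open>w\<close> is continuous.\<close>
  define K where "K = C \<union> (X - UP) \<union> (X - UQ)"
  define L where "L = X - C"
  have "X - K = (\<Union>(j, \<xi>)\<in>{..<d} \<times> ?M - {(j0, \<xi>0)}. S j \<xi>)" (is "_ = ?R")
  proof (intro equalityI subsetI)
    fix x assume x: "x \<in> X - K"
    then obtain \<xi> \<eta> where \<xi>: "\<xi> ^ d = 1" "x \<in> P \<xi>" and \<eta>: "\<eta> ^ d = 1" "x \<in> Q \<eta>"
      by (auto simp: K_def UP_def UQ_def)
    obtain j where "j < d" "x \<in> S j \<xi>" using S_cover[OF \<xi>(1) \<eta>(1) \<xi>(2) \<eta>(2)] by blast
    then show "x \<in> ?R" using x \<xi> by (auto simp: K_def C_def)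
  next
    fix x assume "x \<in> ?R"
    then obtain j \<xi> where j: "j < d" "\<xi> ^ d = 1" "x \<in> S j \<xi>" "(j, \<xi>) \<noteq> (j0, \<xi>0)" by auto
    then show "x \<in> X - K" using in_C[OF j(1-3)] SU[OF j(1,2)] UX by (auto simp: K_def)
  qed
  moreover have "openin (top_of_set X) ?R"
    by (auto intro!: openin_Union S_open)
  ultimately have "openin (top_of_set X) (X - K)" by simp
  moreover have KX: "K \<subseteq> X" using CU UX by (auto simp: K_def)
  ultimately have K: "closedin (top_of_set X) K"
    by (simp add: closedin_def)
  have L: "closedin (top_of_set X) L"
    using S_open[OF j0 \<xi>0] by (auto simp: L_def C_def intro!: closedin_diff)
  have KL: "X = K \<union> L" using KX by (auto simp: L_def K_def)
  have K0: "\<rho> x = 0" if "x \<in> UP" "x \<in> K" "x \<notin> C" for x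
    using that \<rho>(2) by (auto simp: K_def)
  have K1: "\<rho> x = 1" if "x \<in> UQ" "x \<in> K" "x \<notin> C" for x
    using that \<rho>(3) by (auto simp: K_def)
  have e1: "exp (2 * pi * \<i> * of_real (\<rho> x)) = 1" if "x \<in> K" "x \<notin> C" for x
  proof -
    have "\<rho> x = 0 \<or> \<rho> x = 1" using that K0 K1 XU KX by blast
    then show ?thesis by (auto simp: mult_ac)
  qed
  define w where "w x = (if x \<in> C then exp (2 * pi * \<i> * of_real (\<rho> x)) else 1)" for x
  \<comment> \<open>Logarithms of \<open>w\<close> divided by \<open>2 * pi * \<i>\<close>. At the
    rim of \<open>C\<close> the height \<rho> is 0 inside \<open>UP\<close> and 1 inside
    \<open>UQ\<close>; the shift by 1 in \<open>gQ\<close> makes each function continuous on its own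
    set. Their difference is the indicator function of \<open>C\<close>.\<close>
  define gP where "gP x = (if x \<in> C then \<rho> x else 0)" for x
  define gQ where "gQ x = (if x \<in> C then \<rho> x - 1 else 0)" for x
  have "continuous_on (K \<union> L) w"
    unfolding w_def
  proof (rule continuous_on_cases_local)
    show "closedin (top_of_set (K \<union> L)) K" "closedin (top_of_set (K \<union> L)) L"
      unfolding KL[symmetric] by (fact K L)+
    show "continuous_on K (\<lambda>x. exp (2 * pi * \<i> * of_real (\<rho> x)))"
      by (intro continuous_intros continuous_on_subset[OF \<rho>(1) KX])
    show "exp (2 * pi * \<i> * of_real (\<rho> x)) = 1" if "x \<in> K \<and> x \<notin> C \<or> x \<in> L \<and> x \<in> C" for x
      using that e1 unfolding L_def by blast
  qed simp
  then have w: "continuous_on X w" unfolding KL[symmetric] .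
  have restr: "closedin (top_of_set U) (U \<inter> Z)" if "closedin (top_of_set X) Z" "U \<subseteq> X" for U Z
    using that by (auto simp: closedin_closed)
  have "continuous_on ((UP \<inter> K) \<union> (UP \<inter> L)) gP"
    unfolding gP_def
  proof (rule continuous_on_cases_local)
    have "UP \<inter> K \<union> UP \<inter> L = UP" using KL UX by auto
    then show "closedin (top_of_set (UP \<inter> K \<union> UP \<inter> L)) (UP \<inter> K)"
      "closedin (top_of_set (UP \<inter> K \<union> UP \<inter> L)) (UP \<inter> L)"
      using restr[OF K] restr[OF L] UX by simp_all
    show "continuous_on (UP \<inter> K) \<rho>" by (rule continuous_on_subset[OF \<rho>(1)]) (use UX in auto)
  qed (use K0 in \<open>auto simp: L_def\<close>)
  moreover have "(UP \<inter> K) \<union> (UP \<inter> L) = UP" using KL UX by auto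
  ultimately have gP: "continuous_on UP gP" by simp
  have "continuous_on ((UQ \<inter> K) \<union> (UQ \<inter> L)) gQ"
    unfolding gQ_def
  proof (rule continuous_on_cases_local)
    have "UQ \<inter> K \<union> UQ \<inter> L = UQ" using KL UX by auto
    then show "closedin (top_of_set (UQ \<inter> K \<union> UQ \<inter> L)) (UQ \<inter> K)"
      "closedin (top_of_set (UQ \<inter> K \<union> UQ \<inter> L)) (UQ \<inter> L)"
      using restr[OF K] restr[OF L] UX by simp_all
    show "continuous_on (UQ \<inter> K) (\<lambda>x. \<rho> x - 1)"
      by (intro continuous_intros continuous_on_subset[OF \<rho>(1)]) (use UX in auto)
  qed (use K1 in \<open>auto simp: L_def\<close>)
  moreover have "(UQ \<inter> K) \<union> (UQ \<inter> L) = UQ" using KL UX by auto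
  ultimately have gQ: "continuous_on UQ gQ" by simp
  have wP: "w x = exp (2 * pi * \<i> * of_real (gP x))" for x
    by (simp add: w_def gP_def)
  have wQ: "w x = exp (2 * pi * \<i> * of_real (gQ x))" for x
    by (simp add: w_def gQ_def algebra_simps exp_diff)
  have w0: "w x \<noteq> 0" for x by (simp add: w_def)
  define \<theta> where "\<theta> = extend_cochain 1 (top_of_set X) (log_change w)"
  define \<phi> where "\<phi> = (1 / (2 * pi * \<i>)) \<odot>\<^bsub>cochains 1 (top_of_set X)\<^esub> \<theta>"
  have \<theta>Z: "\<theta> \<in> cocycles 1 (top_of_set X)"
    unfolding \<theta>_def using w w0 by (rule log_change_cocycle)
  have ev: "\<phi> (frag_of \<sigma>) = of_real (g (\<sigma> (vtx 1))) - of_real (g (\<sigma> (vtx 0)))"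
    if \<sigma>: "singular_simplex 1 (top_of_set U) \<sigma>" and g: "continuous_on U g" and U: "U \<subseteq> X"
      and wg: "\<And>x. w x = exp (2 * pi * \<i> * of_real (g x))" for \<sigma> U and g :: "'a \<Rightarrow> real"
  proof -
    have \<sigma>X: "singular_simplex 1 (top_of_set X) \<sigma>" by (rule singular_simplex_subset[OF \<sigma> U])
    have "continuous_on (standard_simplex 1) (\<lambda>x. g (\<sigma> x))"
      by (rule continuous_on_compose2[OF g]) (use \<sigma> in \<open>auto simp: singular_simplex_top_of_set\<close>)
    then have "log_change w \<sigma> = 2 * pi * \<i> * of_real (g (\<sigma> (vtx 1))) - 2 * pi * \<i> * of_real (g (\<sigma> (vtx 0)))"
      by (intro log_change_eq[where g = "\<lambda>x. 2 * pi * \<i> * of_real (g (\<sigma> x))"])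
         (auto simp: wg intro!: continuous_intros)
    then have "\<theta> (frag_of \<sigma>) = 2 * pi * \<i> * (of_real (g (\<sigma> (vtx 1))) - of_real (g (\<sigma> (vtx 0))))"
      using extend_cochain_of[OF \<sigma>X, of "log_change w"] by (simp add: \<theta>_def algebra_simps)
    then show ?thesis
      using \<sigma>X by (simp add: \<phi>_def cochains_simps(4) singular_chain_of del: One_nat_def)
  qed
  have prim: "primitives \<phi> (\<lambda>x. of_real (gP x)) (\<lambda>x. of_real (gQ x))"
    unfolding primitives_def
  proof (intro allI impI conjI)
    fix \<xi> :: complex and \<sigma> assume \<xi>: "\<xi> ^ d = 1"
    have sub: "P \<xi> \<subseteq> UP" "Q \<xi> \<subseteq> UQ" using \<xi> by (auto simp: UP_def UQ_def)
    show "\<phi> (frag_of \<sigma>) = of_real (gP (\<sigma> (vtx 1))) - of_real (gP (\<sigma> (vtx 0)))"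
      if "singular_simplex 1 (top_of_set (P \<xi>)) \<sigma>"
      by (rule ev[OF singular_simplex_subset[OF that sub(1)] gP UX(1) wP])
    show "\<phi> (frag_of \<sigma>) = of_real (gQ (\<sigma> (vtx 1))) - of_real (gQ (\<sigma> (vtx 0)))"
      if "singular_simplex 1 (top_of_set (Q \<xi>)) \<sigma>"
      by (rule ev[OF singular_simplex_subset[OF that sub(2)] gQ UX(2) wQ])
  qed
  have "edge \<phi> j \<xi> = (if j = j0 \<and> \<xi> = \<xi>0 then 1 else 0)
      + (- of_real (gP (A \<xi> p)) - (- of_real (gQ (A (\<xi> * unity_root d ^ j) q))))"
    if j: "j < d" and \<xi>: "\<xi> ^ d = 1" for j \<xi>
  proof -
    have "A \<xi> (s j) \<in> C \<longleftrightarrow> j = j0 \<and> \<xi> = \<xi>0"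
      using in_C[OF j \<xi> As_in[OF j \<xi>]] As_in[OF j0 \<xi>0] by (auto simp: C_def)
    then show ?thesis
      using edge_eq[OF prim j \<xi>] by (auto simp: gP_def gQ_def)
  qed
  then show ?thesis
    by (intro that[of \<phi> "\<lambda>\<xi>. - of_real (gP (A \<xi> p))" "\<lambda>\<xi>. - of_real (gQ (A \<xi> q))"])
       (auto simp: \<phi>_def simp del: One_nat_def intro: cocycles_smult \<theta>Z)
qed

text \<open>A linear combination of the cocycles of \<open>edge_indicator\<close>, built edge by
  edge; the graph coboundaries accumulate in \<open>a\<close> and \<open>b\<close>.\<close>

lemma edge_surj:
  obtains \<phi> a b where "\<phi> \<in> cocycles 1 (top_of_set X)"
    "\<And>j \<xi>. j < d \<Longrightarrow> \<xi> ^ d = 1 \<Longrightarrow> edge \<phi> j \<xi> = h j \<xi> + (a \<xi> - b (\<xi> * unity_root d ^ j))"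
proof -
  let ?M = "{\<xi>::complex. \<xi> ^ d = 1}"
  have fin: "finite ?M" using finite_roots_unity[of d] d by auto
  have "\<exists>\<phi> a b. \<phi> \<in> cocycles 1 (top_of_set X) \<and> (\<forall>j \<xi>. j < d \<longrightarrow> \<xi> ^ d = 1 \<longrightarrow>
      edge \<phi> j \<xi> = (if (j, \<xi>) \<in> I then h j \<xi> else 0) + (a \<xi> - b (\<xi> * unity_root d ^ j)))"
    if "finite I" "I \<subseteq> {..<d} \<times> ?M" for I
    using that
  proof (induction I rule: finite_induct)
    case empty
    have "extend_cochain 1 (top_of_set X) (\<lambda>_. 0) \<in> cocycles 1 (top_of_set X)"
      by (rule extend_cochain_cocycles) simp
    moreover have "edge (extend_cochain 1 (top_of_set X) (\<lambda>_. 0)) j \<xi> = 0"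
      if "j < d" "\<xi> ^ d = 1" for j \<xi>
      using A\<alpha>_chain[OF that] A\<beta>_chain[OF that] by (simp add: edge_def extend_cochain_def del: One_nat_def)
    ultimately show ?case
      by (intro exI[of _ "extend_cochain 1 (top_of_set X) (\<lambda>_. 0)"] exI[of _ "\<lambda>_. 0"]) simp
  next
    case (insert x I)
    obtain j0 \<xi>0 where x: "x = (j0, \<xi>0)" by (cases x)
    then have j0: "j0 < d" "\<xi>0 ^ d = 1" using insert.prems by auto
    obtain \<phi> a b where \<phi>: "\<phi> \<in> cocycles 1 (top_of_set X)" "\<And>j \<xi>. j < d \<Longrightarrow> \<xi> ^ d = 1 \<Longrightarrow>
        edge \<phi> j \<xi> = (if (j, \<xi>) \<in> I then h j \<xi> else 0) + (a \<xi> - b (\<xi> * unity_root d ^ j))"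
      using insert.IH insert.prems by blast
    obtain \<psi> a' b' where \<psi>: "\<psi> \<in> cocycles 1 (top_of_set X)" "\<And>j \<xi>. j < d \<Longrightarrow> \<xi> ^ d = 1 \<Longrightarrow>
        edge \<psi> j \<xi> = (if j = j0 \<and> \<xi> = \<xi>0 then 1 else 0) + (a' \<xi> - b' (\<xi> * unity_root d ^ j))"
      using edge_indicator[OF j0] by blast
    let ?c = "h j0 \<xi>0"
    let ?\<chi> = "\<phi> \<oplus>\<^bsub>cochains 1 (top_of_set X)\<^esub> (?c \<odot>\<^bsub>cochains 1 (top_of_set X)\<^esub> \<psi>)"
    have "?\<chi> \<in> cocycles 1 (top_of_set X)" by (intro cocycles_add cocycles_smult \<phi> \<psi>)
    moreover have "edge ?\<chi> j \<xi> = (if (j, \<xi>) \<in> insert x I then h j \<xi> else 0)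
        + ((a \<xi> + ?c * a' \<xi>) - (b (\<xi> * unity_root d ^ j) + ?c * b' (\<xi> * unity_root d ^ j)))"
      if "j < d" "\<xi> ^ d = 1" for j \<xi>
      using insert.hyps that
      by (auto simp: edge_add edge_smult \<phi>(2) \<psi>(2) x algebra_simps simp del: One_nat_def)
    ultimately show ?case
      by (intro exI[of _ ?\<chi>] exI[of _ "\<lambda>\<xi>. a \<xi> + ?c * a' \<xi>"] exI[of _ "\<lambda>\<xi>. b \<xi> + ?c * b' \<xi>"]) simp
  qed
  from this[of "{..<d} \<times> ?M"] fin obtain \<phi> a b where \<phi>: "\<phi> \<in> cocycles 1 (top_of_set X)"
    and e: "\<And>j \<xi>. j < d \<Longrightarrow> \<xi> ^ d = 1 \<Longrightarrow>
      edge \<phi> j \<xi> = (if (j, \<xi>) \<in> {..<d} \<times> ?M then h j \<xi> else 0) + (a \<xi> - b (\<xi> * unity_root d ^ j))"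
    by blast
  show ?thesis
    by (rule that[OF \<phi>, of a b]) (simp add: e)
qed

text \<open>The graph functionals of \<open>edge \<phi>\<close> are coordinates on the cohomology.
  They are enumerated by \<open>e\<close>, and \<open>fst (e k)\<close> is the exponent of the
  character on the \<open>k\<close>-th coordinate.\<close>

theorem has_grothendieck_class_sheet_cover:
  "has_grothendieck_class (mu d) (cohomology 1 (top_of_set X))
    (\<lambda>\<xi>. inv_into (carrier (cohomology 1 (top_of_set X))) (cohomology_pullback 1 (top_of_set X) (A \<xi>)))
    (grothendieck_class (mu d)
      (frag_cmul (int d - 1) (frag_of (mu_character 0)) +
       frag_cmul (int d - 2) (\<Sum>i=1..d-1. frag_of (mu_character i))))"
proof -
  define N where "N = card (graph_index d)"
  obtain e where e: "bij_betw e {..<N} (graph_index d)"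
    using ex_bij_betw_nat_finite[OF finite_graph_index[of d]] by (auto simp: N_def atLeast0LessThan)
  have eI: "e k \<in> graph_index d" if "k < N" for k
    using e that by (auto simp: bij_betw_def)
  define \<Phi> where "\<Phi> \<phi> = (\<lambda>k\<in>{..<N}. graph_functional d (edge \<phi>) (e k))" for \<phi>
  \<comment> \<open>\<open>edge_surj\<close> realises \<open>h\<close> only up to a graph
    coboundary, which the functionals do not see.\<close>
  have \<Phi>_cob: "graph_functional d (edge \<phi>) x = graph_functional d h x"
    if "\<And>j \<xi>. j < d \<Longrightarrow> \<xi> ^ d = 1 \<Longrightarrow> edge \<phi> j \<xi> = h j \<xi> + (a \<xi> - b (\<xi> * unity_root d ^ j))"
      and "x \<in> graph_index d" for \<phi> h a b x
  proof -
    have "graph_functional d (edge \<phi>) x =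
        graph_functional d (\<lambda>j \<xi>. h j \<xi> + (a \<xi> - b (\<xi> * unity_root d ^ j))) x"
      by (rule graph_functional_cong[OF that(2)]) (rule that(1))
    then show ?thesis
      by (simp add: graph_functional_add graph_functional_coboundary[OF d])
  qed
  let ?Z = "cocycles (Suc 0) (top_of_set X)"
  have "has_grothendieck_class (mu d) (cohomology (Suc 0) (top_of_set X))
    (\<lambda>\<xi>. inv_into (carrier (cohomology (Suc 0) (top_of_set X))) (cohomology_pullback (Suc 0) (top_of_set X) (A \<xi>)))
    (grothendieck_class (mu d) (\<Sum>k<N. frag_of (mu_character (fst (e k)))))"
  proof (rule has_grothendieck_class_cohomology[OF d, where \<Phi> = \<Phi>])
    show "\<Phi> \<phi> \<in> carrier (coord_space N)" for \<phi>
      by (simp add: \<Phi>_def coord_space_eq)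
    show "\<Phi> (\<phi> \<oplus>\<^bsub>cochains (Suc 0) (top_of_set X)\<^esub> \<psi>) = \<Phi> \<phi> \<oplus>\<^bsub>coord_space N\<^esub> \<Phi> \<psi>" for \<phi> \<psi>
    proof -
      have "graph_functional d (edge (\<phi> \<oplus>\<^bsub>cochains 1 (top_of_set X)\<^esub> \<psi>)) x =
          graph_functional d (\<lambda>j \<xi>. edge \<phi> j \<xi> + edge \<psi> j \<xi>) x" if "x \<in> graph_index d" for x
        by (rule graph_functional_cong[OF that]) (rule edge_add)
      then show ?thesis
        using eI by (auto simp: \<Phi>_def coord_space_eq graph_functional_add fun_eq_iff)
    qed
    show "\<Phi> (a \<odot>\<^bsub>cochains (Suc 0) (top_of_set X)\<^esub> \<phi>) = a \<odot>\<^bsub>coord_space N\<^esub> \<Phi> \<phi>" for a \<phi>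
    proof -
      have "graph_functional d (edge (a \<odot>\<^bsub>cochains 1 (top_of_set X)\<^esub> \<phi>)) x =
          graph_functional d (\<lambda>j \<xi>. a * edge \<phi> j \<xi>) x" if "x \<in> graph_index d" for x
        by (rule graph_functional_cong[OF that]) (rule edge_smult)
      then show ?thesis
        using eI by (auto simp: \<Phi>_def coord_space_eq graph_functional_cmult fun_eq_iff)
    qed
    show "carrier (coord_space N) \<subseteq> \<Phi> ` ?Z"
    proof
      fix v assume v: "v \<in> carrier (coord_space N)"
      obtain h where h: "\<And>x. x \<in> graph_index d \<Longrightarrow>
          graph_functional d h x = v (the_inv_into {..<N} e x)"
        by (rule graph_functional_surj[of d "\<lambda>x. v (the_inv_into {..<N} e x)"]) blast
      obtain \<phi> a b where \<phi>: "\<phi> \<in> cocycles 1 (top_of_set X)" "\<And>j \<xi>. j < d \<Longrightarrow> \<xi> ^ d = 1 \<Longrightarrow>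
          edge \<phi> j \<xi> = h j \<xi> + (a \<xi> - b (\<xi> * unity_root d ^ j))"
        using edge_surj[of h] by blast
      have "graph_functional d (edge \<phi>) (e k) = v k" if "k < N" for k
        using \<Phi>_cob[OF \<phi>(2) eI[OF that]] h[OF eI[OF that]] e that
        by (simp add: the_inv_into_f_f bij_betw_def)
      then have "v = \<Phi> \<phi>"
        using v by (auto simp: \<Phi>_def coord_space_eq PiE_iff extensional_def fun_eq_iff)
      then show "v \<in> \<Phi> ` ?Z" using \<phi>(1) by auto
    qed
    show "\<Phi> \<phi> = \<zero>\<^bsub>coord_space N\<^esub> \<longleftrightarrow> \<phi> \<in> coboundaries (Suc 0) (top_of_set X)" if \<phi>: "\<phi> \<in> ?Z" for \<phi>
    proof
      assume 0: "\<Phi> \<phi> = \<zero>\<^bsub>coord_space N\<^esub>"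
      have "graph_functional d (edge \<phi>) x = 0" if x: "x \<in> graph_index d" for x
      proof -
        obtain k where k: "k < N" "x = e k" using e x by (auto simp: bij_betw_def)
        show ?thesis using fun_cong[OF 0, of k] k by (simp add: \<Phi>_def coord_space_eq)
      qed
      then obtain a b where "\<And>j \<xi>. j < d \<Longrightarrow> \<xi> ^ d = 1 \<Longrightarrow> edge \<phi> j \<xi> = a \<xi> - b (\<xi> * unity_root d ^ j)"
        using graph_functional_eq_0D[OF d, of "edge \<phi>"] by metis
      then show "\<phi> \<in> coboundaries (Suc 0) (top_of_set X)"
        using edge_kernel \<phi> by auto
    next
      assume "\<phi> \<in> coboundaries (Suc 0) (top_of_set X)"
      then obtain a b where ab: "\<And>j \<xi>. j < d \<Longrightarrow> \<xi> ^ d = 1 \<Longrightarrow> edge \<phi> j \<xi> = a \<xi> - b (\<xi> * unity_root d ^ j)"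
        using edge_coboundary[of \<phi>] by (metis One_nat_def)
      have "graph_functional d (edge \<phi>) x = 0" if "x \<in> graph_index d" for x
      proof -
        have "graph_functional d (edge \<phi>) x =
            graph_functional d (\<lambda>j \<xi>. a \<xi> - b (\<xi> * unity_root d ^ j)) x"
          by (rule graph_functional_cong[OF that]) (rule ab)
        then show ?thesis by (simp add: graph_functional_coboundary[OF d])
      qed
      then show "\<Phi> \<phi> = \<zero>\<^bsub>coord_space N\<^esub>"
        using eI by (auto simp: \<Phi>_def coord_space_eq fun_eq_iff)
    qed
    show "continuous_map (top_of_set X) (top_of_set X) (A \<xi>)" if "\<xi> \<in> carrier (mu d)" for \<xi>
      using A_continuous A_X that by (auto simp: mu_def)
    show "\<xi> ^ fst (e k) * \<Phi> (cochain_pullback (Suc 0) (top_of_set X) (A \<xi>) \<phi>) k = \<Phi> \<phi> k"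
      if "\<xi> \<in> carrier (mu d)" "k < N" for \<xi> \<phi> k
    proof -
      have \<xi>: "\<xi> ^ d = 1" using that by (simp add: mu_def)
      have "graph_functional d (edge (cochain_pullback 1 (top_of_set X) (A \<xi>) \<phi>)) (e k) =
          graph_functional d (\<lambda>j \<eta>. edge \<phi> j (\<eta> * \<xi>)) (e k)"
        by (rule graph_functional_cong[OF eI[OF that(2)]]) (rule edge_pullback[OF _ _ \<xi>])
      then show ?thesis
        using that(2) graph_functional_shift[OF d \<xi>, of "e k" "edge \<phi>"] by (simp add: \<Phi>_def)
    qed
  qed
  moreover have "(\<Sum>k<N. frag_of (mu_character (fst (e k)))) =
      frag_cmul (int d - 1) (frag_of (mu_character 0)) +
       frag_cmul (int d - 2) (\<Sum>i=1..d-1. frag_of (mu_character i))"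
    using sum.reindex_bij_betw[OF e, of "\<lambda>x. frag_of (mu_character (fst x))"]
      sum_graph_index[OF d, of "\<lambda>i. frag_of (mu_character i)"] by simp
  ultimately show ?thesis by simp
qed

end

section \<open>Cyclic covers of the punctured plane\<close>

text \<open>Branches of the \<open>d\<close>-th root on the plane slit along the upward and the downward imaginary
  axis, which agree on the left half-plane.\<close>

definition root_up :: "nat \<Rightarrow> complex \<Rightarrow> complex" where
  "root_up d z = exp ((Ln (\<i> * z) - \<i> * pi / 2) / of_nat d)"

text \<open>The logarithm \<open>Ln (- (\<i> * z)) + \<i> * pi / 2\<close> of \<open>z\<close> is
  lowered by a full turn; this makes the branches agree on the left half-plane and puts the whole
  discrepancy on the right one.\<close>

definition root_down :: "nat \<Rightarrow> complex \<Rightarrow> complex" where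
  "root_down d z = exp ((Ln (- (\<i> * z)) - 3 * \<i> * pi / 2) / of_nat d)"

lemma root_up_power:
  assumes "d > 0" "z \<noteq> 0"
  shows "root_up d z ^ d = z"
proof -
  have "root_up d z ^ d = exp (Ln (\<i> * z) - \<i> * pi / 2)"
    using assms by (simp add: root_up_def flip: exp_of_nat_mult)
  also have "\<dots> = \<i> * z / exp (\<i> * pi / 2)"
    using assms by (simp add: exp_diff)
  also have "exp (\<i> * pi / 2) = \<i>"
    using Ln_ii exp_Ln[of \<i>] by simp
  finally show ?thesis by simp
qed

lemma root_down_power:
  assumes "d > 0" "z \<noteq> 0"
  shows "root_down d z ^ d = z"
proof -
  have "root_down d z ^ d = exp (Ln (- (\<i> * z)) - 3 * \<i> * pi / 2)"
    using assms by (simp add: root_down_def flip: exp_of_nat_mult)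
  also have "\<dots> = - (\<i> * z) / exp (3 * \<i> * pi / 2)"
    using assms by (simp add: exp_diff)
  also have "exp (3 * \<i> * pi / 2) = - \<i>"
  proof -
    have "3 * \<i> * pi / 2 = \<i> * pi + \<i> * pi / 2" by simp
    then have "exp (3 * \<i> * pi / 2) = exp (\<i> * pi) * exp (\<i> * pi / 2)"
      by (simp only: exp_add)
    then show ?thesis
      using Ln_ii exp_Ln[of \<i>] by simp
  qed
  finally show ?thesis by simp
qed

lemma root_up_eq_root_down:
  assumes "d > 0"
  shows "Re z < 0 \<Longrightarrow> root_up d z = root_down d z"
    and "Re z > 0 \<Longrightarrow> root_up d z = unity_root d * root_down d z"
proof -
  assume z: "Re z < 0"
  then have "Ln (- (\<i> * z)) = Ln (\<i> * z) + \<i> * pi"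
    by (subst Ln_minus) auto
  then have "Ln (- (\<i> * z)) - 3 * \<i> * pi / 2 = Ln (\<i> * z) - \<i> * pi / 2" by simp
  then show "root_up d z = root_down d z" by (simp add: root_up_def root_down_def)
next
  assume z: "Re z > 0"
  then have "Ln (- (\<i> * z)) = Ln (\<i> * z) - \<i> * pi"
    by (subst Ln_minus) auto
  then have "Ln (\<i> * z) - \<i> * pi / 2 = 2 * \<i> * pi + (Ln (- (\<i> * z)) - 3 * \<i> * pi / 2)" by simp
  then have "root_up d z = exp (2 * \<i> * pi / of_nat d) * root_down d z"
    unfolding root_up_def root_down_def by (simp only: add_divide_distrib exp_add)
  also have "exp (2 * \<i> * pi / of_nat d) = unity_root d"
    by (simp add: unity_root_def cis_conv_exp mult_ac)
  finally show "root_up d z = unity_root d * root_down d z" .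
qed

lemma continuous_on_root_up:
  assumes "continuous_on S f" "\<And>x. x \<in> S \<Longrightarrow> Re (f x) = 0 \<Longrightarrow> Im (f x) < 0"
  shows "continuous_on S (\<lambda>x. root_up d (f x))"
  unfolding root_up_def divide_inverse
  by (intro continuous_intros assms(1)) (use assms(2) in \<open>force simp: complex_nonpos_Reals_iff\<close>)

lemma continuous_on_root_down:
  assumes "continuous_on S f" "\<And>x. x \<in> S \<Longrightarrow> Re (f x) = 0 \<Longrightarrow> Im (f x) > 0"
  shows "continuous_on S (\<lambda>x. root_down d (f x))"
  unfolding root_down_def divide_inverse
  by (intro continuous_intros assms(1)) (use assms(2) in \<open>force simp: complex_nonpos_Reals_iff\<close>)

text \<open>The plane without the upward rays from the points \<open>a j\<close> if \<open>\<sigma> = 1\<close>, without the downward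
  rays if \<open>\<sigma> = - 1\<close>.\<close>

definition slit_plane :: "real \<Rightarrow> (nat \<Rightarrow> complex) \<Rightarrow> nat \<Rightarrow> complex set" where
  "slit_plane \<sigma> a n = {t. \<forall>j<n. Re t = Re (a j) \<longrightarrow> \<sigma> * Im t < \<sigma> * Im (a j)}"

text \<open>For \<open>a j\<close> ordered by real part, the vertical strip with exactly the first
  \<open>k\<close> points on its left; \<open>k\<close> takes one value more than there are
  points.\<close>

definition strip :: "(nat \<Rightarrow> complex) \<Rightarrow> nat \<Rightarrow> nat \<Rightarrow> complex set" where
  "strip a n k = {t. \<forall>j<n. if j < k then Re (a j) < Re t else Re t < Re (a j)}"

section \<open>Topology of slit planes and strips\<close>

lemma open_slit_plane: "open (slit_plane \<sigma> a n)"
proof -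
  have "slit_plane \<sigma> a n = (\<Inter>j\<in>{..<n}. {t. Re t \<noteq> Re (a j)} \<union> {t. \<sigma> * Im t < \<sigma> * Im (a j)})"
    by (auto simp: slit_plane_def)
  also have "open \<dots>"
    by (intro open_INT ballI open_Un open_Collect_neq open_Collect_less continuous_intros) auto
  finally show ?thesis .
qed

lemma open_strip: "open (strip a n k)"
proof -
  have "strip a n k = (\<Inter>j\<in>{..<n}. if j < k then {t. Re (a j) < Re t} else {t. Re t < Re (a j)})"
    by (auto simp: strip_def split: if_splits)
  also have "open \<dots>"
    by (intro open_INT ballI) (auto intro!: open_Collect_less continuous_intros)
  finally show ?thesis .
qed

lemma convex_strip: "convex (strip a n k)"
proof -
  have "strip a n k = (\<Inter>j\<in>{..<n}. if j < k then {t. Re t > Re (a j)} else {t. Re t < Re (a j)})"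
    by (auto simp: strip_def split: if_splits)
  also have "convex \<dots>"
    by (intro convex_INT) (auto simp: convex_halfspace_Re_gt convex_halfspace_Re_lt)
  finally show ?thesis .
qed

text \<open>A vertical motion away from the slits never meets them. It deforms the identity into a
  map with values in the half-plane \<open>T\<close> beyond all tips, which is convex, so that this
  map is homotopic to a constant.\<close>

lemma contractible_slit_plane:
  assumes \<sigma>: "\<sigma> = 1 \<or> \<sigma> = - 1"
  shows "contractible (slit_plane \<sigma> a n)"
proof -
  let ?U = "slit_plane \<sigma> a n"
  define R where "R = (\<Sum>j<n. \<bar>Im (a j)\<bar>)"
  \<comment> \<open>The distance is such that \<open>\<sigma> * Im (f t)\<close> is at most
    \<open>- R - 1\<close>, whatever the height of \<open>t\<close>.\<close>
  define f where "f t = t - \<i> * of_real (\<sigma> * (\<bar>Im t\<bar> + R + 1))" for t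
  define T where "T = {t. \<sigma> * Im t < - R}"
  have R: "\<bar>Im (a j)\<bar> \<le> R" if "j < n" for j
    unfolding R_def using member_le_sum[of j "{..<n}" "\<lambda>j. \<bar>Im (a j)\<bar>"] that by auto
  have R0: "R \<ge> 0" unfolding R_def by (rule sum_nonneg) simp
  have \<sigma>2: "\<sigma> * \<sigma> = 1" using \<sigma> by auto
  have TU: "T \<subseteq> ?U"
  proof
    fix t assume "t \<in> T"
    moreover have "- R \<le> \<sigma> * Im (a j)" if "j < n" for j
      using R[OF that] \<sigma> by auto
    ultimately show "t \<in> ?U" unfolding slit_plane_def T_def by fastforce
  qed
  have fT: "f t \<in> T" for t
  proof -
    have "\<sigma> * Im (f t) = \<sigma> * Im t - (\<sigma> * \<sigma>) * (\<bar>Im t\<bar> + R + 1)"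
      by (simp add: f_def algebra_simps)
    also have "\<dots> < - R" unfolding \<sigma>2 using \<sigma> by auto
    finally show ?thesis by (simp add: T_def)
  qed
  have "convex T"
    using \<sigma> convex_halfspace_Im_lt[of "- R"] convex_halfspace_Im_gt[of R] by (auto simp: T_def)
  have cf: "continuous_on ?U f" unfolding f_def by (intro continuous_intros)
  have "homotopic_with_canon (\<lambda>z. True) ?U ?U id f"
  proof (rule homotopic_with_linear)
    fix t assume t: "t \<in> ?U"
    show "closed_segment (id t) (f t) \<subseteq> ?U"
    proof
      fix z assume "z \<in> closed_segment (id t) (f t)"
      then obtain c where c: "0 \<le> c" "z = (1 - c) *\<^sub>R t + c *\<^sub>R f t"
        by (auto simp: closed_segment_def)
      then have z: "z = t - \<i> * of_real (c * \<sigma> * (\<bar>Im t\<bar> + R + 1))"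
        by (simp add: f_def algebra_simps scaleR_conv_of_real)
      have "Re z = Re t" by (simp add: z)
      moreover have "\<sigma> * Im z \<le> \<sigma> * Im t"
      proof -
        have "\<sigma> * Im z = \<sigma> * Im t - (\<sigma> * \<sigma>) * (c * (\<bar>Im t\<bar> + R + 1))"
          by (simp add: z algebra_simps)
        then show ?thesis unfolding \<sigma>2 using c R0 by simp
      qed
      ultimately show "z \<in> ?U" using t by (fastforce simp: slit_plane_def)
    qed
  qed (use cf in \<open>auto simp: id_def\<close>)
  moreover obtain c where "homotopic_with_canon (\<lambda>h. True) ?U ?U (id \<circ> f) (\<lambda>x. c)"
    by (rule nullhomotopic_through_contractible[OF cf, of T id ?U])
       (use fT TU convex_imp_contractible[OF \<open>convex T\<close>] in auto)
  ultimately have "homotopic_with_canon (\<lambda>z. True) ?U ?U id (\<lambda>x. c)"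
    using homotopic_with_trans by fastforce
  then show ?thesis unfolding contractible_def by blast
qed

text \<open>An abstract copy of the curve without its ramification points, which
  \<open>uc x \<noteq> 0\<close> excludes: \<open>uc\<close> and \<open>tc\<close> are the
  coordinates, \<open>pt\<close> recovers the point from them, and \<open>A\<close> is the group of
  deck transformations over \<open>tc\<close>.\<close>

locale cyclic_curve =
  fixes X :: "'a::euclidean_space set" and d :: nat and a :: "nat \<Rightarrow> complex" and \<kappa> :: complex
    and uc tc :: "'a \<Rightarrow> complex" and pt :: "complex \<Rightarrow> complex \<Rightarrow> 'a" and A :: "complex \<Rightarrow> 'a \<Rightarrow> 'a"
  assumes d: "d > 0" and \<kappa>: "\<kappa> \<noteq> 0"
    and a: "i < j \<Longrightarrow> j < d - 1 \<Longrightarrow> Re (a i) < Re (a j)"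
    and uc: "continuous_on X uc" and tc: "continuous_on X tc"
    and pt: "continuous_on {(u, t). u \<noteq> 0} (\<lambda>(u, t). pt u t)"
    and X: "x \<in> X \<Longrightarrow> uc x \<noteq> 0 \<and> uc x ^ d = \<kappa> * (\<Prod>j<d-1. tc x - a j) \<and> pt (uc x) (tc x) = x"
    and pt_X: "u \<noteq> 0 \<Longrightarrow> u ^ d = \<kappa> * (\<Prod>j<d-1. t - a j) \<Longrightarrow>
      pt u t \<in> X \<and> uc (pt u t) = u \<and> tc (pt u t) = t"
    and A: "\<xi> ^ d = 1 \<Longrightarrow> x \<in> X \<Longrightarrow> A \<xi> x \<in> X \<and> uc (A \<xi> x) = \<xi> * uc x \<and> tc (A \<xi> x) = tc x"
    and A_cont: "\<xi> ^ d = 1 \<Longrightarrow> continuous_on X (A \<xi>)"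
begin

section \<open>The two branches and their sheets\<close>

definition "U = slit_plane 1 a (d - 1)"
definition "V = slit_plane (- 1) a (d - 1)"
definition "\<kappa>0 = exp (Ln \<kappa> / of_nat d)"
definition "rU t = \<kappa>0 * (\<Prod>j<d-1. root_up d (t - a j))"
definition "rV t = \<kappa>0 * (\<Prod>j<d-1. root_down d (t - a j))"

definition "sheet W r \<xi> = {x \<in> X. tc x \<in> W \<and> uc x = \<xi> * r (tc x)}"

lemma \<kappa>0: "\<kappa>0 ^ d = \<kappa>"
  using d \<kappa> by (simp add: \<kappa>0_def flip: exp_of_nat_mult)

lemma rU_nonzero: "rU t \<noteq> 0"
  by (simp add: rU_def \<kappa>0_def root_up_def)

lemma rV_nonzero: "rV t \<noteq> 0"
  by (simp add: rV_def \<kappa>0_def root_down_def)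

lemma rU_power: "t \<in> U \<Longrightarrow> rU t ^ d = \<kappa> * (\<Prod>j<d-1. t - a j)"
  unfolding rU_def power_mult_distrib \<kappa>0 prod_power_distrib
  by (intro arg_cong2[of _ _ _ _ "(*)"] prod.cong refl root_up_power[OF d]) (auto simp: U_def slit_plane_def)

lemma rV_power: "t \<in> V \<Longrightarrow> rV t ^ d = \<kappa> * (\<Prod>j<d-1. t - a j)"
  unfolding rV_def power_mult_distrib \<kappa>0 prod_power_distrib
  by (intro arg_cong2[of _ _ _ _ "(*)"] prod.cong refl root_down_power[OF d]) (auto simp: V_def slit_plane_def)

lemma rU_cont: "continuous_on U rU"
  unfolding rU_def
  by (intro continuous_intros continuous_on_root_up) (auto simp: U_def slit_plane_def)

lemma rV_cont: "continuous_on V rV"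
  unfolding rV_def
  by (intro continuous_intros continuous_on_root_down) (auto simp: V_def slit_plane_def)

lemma strip_sub: "strip a (d - 1) k \<subseteq> U" "strip a (d - 1) k \<subseteq> V"
proof -
  have "Re t \<noteq> Re (a j)" if "t \<in> strip a (d - 1) k" "j < d - 1" for t j
    using that by (cases "j < k") (force simp: strip_def)+
  then show "strip a (d - 1) k \<subseteq> U" "strip a (d - 1) k \<subseteq> V"
    unfolding U_def V_def slit_plane_def by blast+
qed

text \<open>The factors with \<open>j < k\<close> see \<open>t\<close> on the right of
  \<open>a j\<close>, where the branches differ by the primitive root; the other factors agree. This
  produces the incidence \<open>S_sub_Q\<close> of the graph.\<close>

lemma rU_eq_rV:
  assumes "t \<in> strip a (d - 1) k" "k < d"
  shows "rU t = unity_root d ^ k * rV t"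
proof -
  have "(\<Prod>j<d-1. root_up d (t - a j)) =
      (\<Prod>j<d-1. (if j < k then unity_root d else 1) * root_down d (t - a j))"
  proof (rule prod.cong[OF refl])
    fix j assume "j \<in> {..<d-1}"
    then show "root_up d (t - a j) = (if j < k then unity_root d else 1) * root_down d (t - a j)"
      using assms(1) root_up_eq_root_down[OF d, of "t - a j"] by (auto simp: strip_def)
  qed
  also have "\<dots> = (\<Prod>j<d-1. if j < k then unity_root d else 1) * (\<Prod>j<d-1. root_down d (t - a j))"
    by (rule prod.distrib)
  also have "(\<Prod>j<d-1. if j < k then unity_root d else 1) = unity_root d ^ k"
  proof -
    have "{..<d - 1} \<inter> {j. j < k} = {..<k}" using assms(2) by auto
    then show ?thesis by (simp add: prod.If_cases)
  qed
  finally show ?thesis by (simp add: rU_def rV_def)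
qed

lemma in_strip:
  assumes "t \<in> U" "t \<in> V"
  shows "\<exists>k<d. t \<in> strip a (d - 1) k"
proof -
  \<comment> \<open>The number of punctures to the left of \<open>t\<close>, as the first index that
    fails to be one; \<open>d - 1\<close> is the fallback when all of them lie on the left.\<close>
  define k where "k = (LEAST k. \<not> (k < d - 1 \<and> Re (a k) < Re t))"
  have k: "\<not> (k < d - 1 \<and> Re (a k) < Re t)"
    unfolding k_def by (rule LeastI[of _ "d - 1"]) simp
  have less: "j < d - 1 \<and> Re (a j) < Re t" if "j < k" for j
    using not_less_Least[of j] that unfolding k_def by blast
  have "k < d"
  proof (rule ccontr)
    assume "\<not> k < d"
    then have "d - 1 < k" using d by linarith
    from less[OF this] show False by simp
  qed
  moreover have "Re t < Re (a j)" if "j < d - 1" "\<not> j < k" for j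
  proof -
    have "Re t \<noteq> Re (a j)" using assms that by (force simp: U_def V_def slit_plane_def)
    moreover have "Re t \<le> Re (a k)" using k that by auto
    moreover have "Re (a k) \<le> Re (a j)" using a[of k j] that by (cases "k = j") auto
    ultimately show ?thesis by simp
  qed
  ultimately show ?thesis
    using less by (auto simp: strip_def)
qed

lemma strip_nonempty:
  assumes "k < d"
  shows "strip a (d - 1) k \<noteq> {}"
proof -
  have "\<exists>r. \<forall>j<d-1. if j < k then Re (a j) < r else r < Re (a j)"
  proof -
    have mono: "Re (a i) \<le> Re (a j)" if "i \<le> j" "j < d - 1" for i j
      using a[of i j] that by (cases "i = j") auto
    consider "d = 1" | "d > 1" "k = 0" | "d > 1" "k = d - 1" "k > 0" | "k > 0" "k < d - 1"
      using assms by linarith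
    then show ?thesis
    proof cases
      case 2
      show ?thesis
        by (rule exI[of _ "Re (a 0) - 1"]) (use 2 mono[of 0] in force)
    next
      case 3
      show ?thesis
      proof (intro exI[of _ "Re (a (d - 2)) + 1"] allI impI)
        fix j assume j: "j < d - 1"
        have "Re (a j) \<le> Re (a (d - 2))"
          by (rule mono) (use 3 j in linarith)+
        then show "if j < k then Re (a j) < Re (a (d - 2)) + 1 else Re (a (d - 2)) + 1 < Re (a j)"
          using 3 j by auto
      qed
    next
      case 4
      have lt: "Re (a (k - 1)) < Re (a k)" using a[of "k - 1" k] 4 by simp
      have "Re (a j) < (Re (a (k - 1)) + Re (a k)) / 2" if "j < k" for j
      proof -
        have "Re (a j) \<le> Re (a (k - 1))"
          by (rule mono) (use that 4 in linarith)+
        then show ?thesis using lt by simp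
      qed
      moreover have "(Re (a (k - 1)) + Re (a k)) / 2 < Re (a j)" if "\<not> j < k" "j < d - 1" for j
        using mono[of k j] lt that by simp
      ultimately show ?thesis by (intro exI[of _ "(Re (a (k - 1)) + Re (a k)) / 2"]) auto
    qed auto
  qed
  then obtain r where "\<forall>j<d-1. if j < k then Re (a j) < r else r < Re (a j)" by blast
  then have "of_real r \<in> strip a (d - 1) k" by (auto simp: strip_def)
  then show ?thesis by blast
qed

lemma strip_disjoint:
  assumes "t \<in> strip a (d - 1) k" "t \<in> strip a (d - 1) k'" "k < d" "k' < d"
  shows "k = k'"
proof -
  have False if "t \<in> strip a (d - 1) i" "t \<in> strip a (d - 1) j" "i < j" "j < d" for i j
  proof -
    have "i < d - 1" using that by linarith
    then have "Re t < Re (a i)" "Re (a i) < Re t" using that by (auto simp: strip_def)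
    then show False by simp
  qed
  then show ?thesis using assms by (metis linorder_neqE_nat)
qed

text \<open>A point missing from both slit planes lies on or above some \<open>a i\<close> and on or
  below some \<open>a j\<close> with the same real part. Distinctness of the real parts gives
  \<open>i = j\<close>, so the point is a puncture, where \<open>uc\<close> would vanish.\<close>

lemma tc_UV:
  assumes "x \<in> X"
  shows "tc x \<in> U \<or> tc x \<in> V"
proof (rule ccontr)
  assume "\<not> ?thesis"
  then obtain i j where i: "i < d - 1" "Re (tc x) = Re (a i)" "Im (tc x) \<ge> Im (a i)"
    and j: "j < d - 1" "Re (tc x) = Re (a j)" "Im (tc x) \<le> Im (a j)"
    by (force simp: U_def V_def slit_plane_def)
  then have "i = j" using a[of i j] a[of j i] by (metis linorder_neqE_nat less_irrefl)
  then have "tc x = a i" using i j by (simp add: complex_eq_iff)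
  then have "(\<Prod>j<d-1. tc x - a j) = 0"
    by (intro prod_zero) (use i in auto)
  then have "uc x ^ d = 0" using X[OF assms] by (metis mult_zero_right)
  moreover have "uc x \<noteq> 0" using X[OF assms] by blast
  ultimately show False using power_not_zero by blast
qed

text \<open>Over \<open>W\<close> the quotient of \<open>uc\<close> by the branch is continuous with
  values in the finite set of \<open>d\<close>-th roots of unity. The sheet is the preimage of one
  of them, equivalently of the open complement of the others.\<close>

lemma openin_sheet:
  assumes W: "open W" "continuous_on W r" and r: "\<And>t. r t \<noteq> 0"
    and p: "\<And>t. t \<in> W \<Longrightarrow> r t ^ d = \<kappa> * (\<Prod>j<d-1. t - a j)" and \<xi>: "\<xi> ^ d = 1"
  shows "openin (top_of_set X) (sheet W r \<xi>)"
proof -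
  define XW where "XW = X \<inter> tc -` W"
  have XW: "openin (top_of_set X) XW"
    unfolding XW_def by (rule continuous_openin_preimage_gen[OF tc W(1)])
  define q where "q x = uc x / r (tc x)" for x
  have "continuous_on XW q"
    unfolding q_def
    by (intro continuous_intros continuous_on_subset[OF uc] continuous_on_compose2[OF W(2)]
        continuous_on_subset[OF tc]) (auto simp: XW_def r)
  moreover have "open (- ({z. z ^ d = 1} - {\<xi>}))"
    using finite_roots_unity[of d] d by (intro open_Compl finite_imp_closed) auto
  ultimately have "openin (top_of_set XW) (XW \<inter> q -` (- ({z. z ^ d = 1} - {\<xi>})))"
    by (rule continuous_openin_preimage_gen)
  moreover have "XW \<inter> q -` (- ({z. z ^ d = 1} - {\<xi>})) = sheet W r \<xi>"
  proof -
    have "q x ^ d = 1" if "x \<in> XW" for x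
    proof -
      have "uc x ^ d = r (tc x) ^ d" using X[of x] p[of "tc x"] that by (simp add: XW_def)
      then show ?thesis using r[of "tc x"] by (simp add: q_def power_divide)
    qed
    then show ?thesis
      using r \<xi> by (auto simp: XW_def sheet_def q_def field_simps)
  qed
  ultimately show ?thesis using openin_trans XW by metis
qed

lemma sheet_param:
  assumes W: "continuous_on W r" and r: "\<And>t. r t \<noteq> 0"
    and p: "\<And>t. t \<in> W \<Longrightarrow> r t ^ d = \<kappa> * (\<Prod>j<d-1. t - a j)" and \<xi>: "\<xi> ^ d = 1"
  shows "homeomorphism (sheet W r \<xi>) W tc (\<lambda>t. pt (\<xi> * r t) t)"
proof
  have \<xi>0: "\<xi> \<noteq> 0" using root_of_unity_nonzero[OF d \<xi>] .
  have pt': "pt (\<xi> * r t) t \<in> X \<and> uc (pt (\<xi> * r t) t) = \<xi> * r t \<and> tc (pt (\<xi> * r t) t) = t"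
    if "t \<in> W" for t
    by (rule pt_X) (use \<xi>0 r \<xi> p[OF that] in \<open>auto simp: power_mult_distrib\<close>)
  show "continuous_on (sheet W r \<xi>) tc"
    by (rule continuous_on_subset[OF tc]) (auto simp: sheet_def)
  show "continuous_on W (\<lambda>t. pt (\<xi> * r t) t)"
  proof -
    have "continuous_on W (\<lambda>t. (\<xi> * r t, t))" by (intro continuous_intros W)
    moreover have "(\<lambda>t. (\<xi> * r t, t)) ` W \<subseteq> {(u, t). u \<noteq> 0}" using \<xi>0 r by auto
    ultimately show ?thesis using continuous_on_compose2[OF pt] by fastforce
  qed
  show "tc ` sheet W r \<xi> \<subseteq> W" by (auto simp: sheet_def)
  show "(\<lambda>t. pt (\<xi> * r t) t) ` W \<subseteq> sheet W r \<xi>" using pt' by (auto simp: sheet_def)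
  show "pt (\<xi> * r (tc x)) (tc x) = x" if "x \<in> sheet W r \<xi>" for x
    using X[of x] that by (auto simp: sheet_def)
  show "tc (pt (\<xi> * r t) t) = t" if "t \<in> W" for t using pt'[OF that] by simp
qed

lemma sheet_disjoint: "(\<And>t. r t \<noteq> 0) \<Longrightarrow> x \<in> sheet W r \<xi> \<Longrightarrow> x \<in> sheet W r \<eta> \<Longrightarrow> \<xi> = \<eta>"
  by (auto simp: sheet_def)

lemma in_sheet:
  assumes "x \<in> X" "tc x \<in> W" "\<And>t. r t \<noteq> 0"
    and p: "\<And>t. t \<in> W \<Longrightarrow> r t ^ d = \<kappa> * (\<Prod>j<d-1. t - a j)"
  shows "\<exists>\<xi>. \<xi> ^ d = 1 \<and> x \<in> sheet W r \<xi>"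
proof (intro exI[of _ "uc x / r (tc x)"] conjI)
  have "uc x ^ d = r (tc x) ^ d" using X[of x] p[of "tc x"] assms(1,2) by simp
  then show "(uc x / r (tc x)) ^ d = 1" using assms(3)[of "tc x"] by (simp add: power_divide)
qed (use assms in \<open>simp add: sheet_def\<close>)

lemma A_sheet:
  assumes "\<xi> ^ d = 1" "x \<in> sheet W r \<eta>"
  shows "A \<xi> x \<in> sheet W r (\<eta> * \<xi>)"
  using assms A[OF assms(1), of x] by (auto simp: sheet_def)

lemma openU: "open U" and openV: "open V"
  by (simp_all add: U_def V_def open_slit_plane)

lemma rU_strip: "continuous_on (strip a (d - 1) k) rU"
  "t \<in> strip a (d - 1) k \<Longrightarrow> rU t ^ d = \<kappa> * (\<Prod>j<d-1. t - a j)"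
  using continuous_on_subset[OF rU_cont strip_sub(1)] rU_power strip_sub(1) by auto

text \<open>A piece over a strip inherits the index of the sheet over \<open>U\<close> that contains
  it, and \<open>rU_eq_rV\<close> translates this index for \<open>V\<close>.\<close>

sublocale sheet_cover X d A "sheet U rU" "sheet V rV" "\<lambda>k. sheet (strip a (d - 1) k) rU"
proof
  show "d > 0" by (rule d)
  fix \<xi> :: complex assume \<xi>: "\<xi> ^ d = 1"
  show "openin (top_of_set X) (sheet U rU \<xi>)"
    by (rule openin_sheet[OF openU rU_cont rU_nonzero rU_power \<xi>])
  show "openin (top_of_set X) (sheet V rV \<xi>)"
    by (rule openin_sheet[OF openV rV_cont rV_nonzero rV_power \<xi>])
  have "sheet U rU \<xi> homeomorphic U"
    using sheet_param[OF rU_cont rU_nonzero rU_power \<xi>] unfolding homeomorphic_def by blast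
  then show "contractible (sheet U rU \<xi>)"
    using contractible_slit_plane[of 1 a "d - 1"] homeomorphic_contractible_eq by (fastforce simp: U_def)
  have "sheet V rV \<xi> homeomorphic V"
    using sheet_param[OF rV_cont rV_nonzero rV_power \<xi>] unfolding homeomorphic_def by blast
  then show "contractible (sheet V rV \<xi>)"
    using contractible_slit_plane[of "- 1" a "d - 1"] homeomorphic_contractible_eq by (fastforce simp: V_def)
  show "continuous_on X (A \<xi>)" by (rule A_cont[OF \<xi>])
  fix \<eta> :: complex assume \<eta>: "\<eta> ^ d = 1"
  fix x
  show "x \<in> sheet U rU \<xi> \<Longrightarrow> x \<in> sheet U rU \<eta> \<Longrightarrow> \<xi> = \<eta>"
    by (rule sheet_disjoint[OF rU_nonzero])
  show "x \<in> sheet V rV \<xi> \<Longrightarrow> x \<in> sheet V rV \<eta> \<Longrightarrow> \<xi> = \<eta>"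
    by (rule sheet_disjoint[OF rV_nonzero])
  show "\<exists>j<d. x \<in> sheet (strip a (d - 1) j) rU \<xi>" if "x \<in> sheet U rU \<xi>" "x \<in> sheet V rV \<eta>"
    using that in_strip[of "tc x"] by (auto simp: sheet_def)
  show "A \<xi> x \<in> sheet U rU (\<eta> * \<xi>)" if "x \<in> sheet U rU \<eta>"
    by (rule A_sheet[OF \<xi> that])
  show "A \<xi> x \<in> sheet V rV (\<eta> * \<xi>)" if "x \<in> sheet V rV \<eta>"
    by (rule A_sheet[OF \<xi> that])
  \<comment> \<open>Points are recovered from their coordinates by \<open>pt\<close>, so it suffices
    to compare \<open>uc\<close> and \<open>tc\<close>.\<close>
  show "A \<xi> (A \<eta> x) = A (\<eta> * \<xi>) x" if x: "x \<in> X"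
  proof -
    have "(\<eta> * \<xi>) ^ d = 1" using \<xi> \<eta> by (simp add: power_mult_distrib)
    then show ?thesis
      using A[OF \<eta> x] A[OF \<xi>, of "A \<eta> x"] A[of "\<eta> * \<xi>" x] x X[of "A \<xi> (A \<eta> x)"] X[of "A (\<eta> * \<xi>) x"]
      by (auto simp: mult_ac)
  qed
next
  fix x assume x: "x \<in> X"
  show "\<exists>\<xi>. \<xi> ^ d = 1 \<and> (x \<in> sheet U rU \<xi> \<or> x \<in> sheet V rV \<xi>)"
    using tc_UV[OF x] in_sheet[OF x _ rU_nonzero rU_power] in_sheet[OF x _ rV_nonzero rV_power] by blast
  show "A \<xi> x \<in> X" if "\<xi> ^ d = 1" for \<xi> using A[OF that x] by simp
next
  fix k assume k: "k < d"
  have par: "homeomorphism (sheet (strip a (d - 1) k) rU \<xi>) (strip a (d - 1) k) tc (\<lambda>t. pt (\<xi> * rU t) t)"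
    if "\<xi> ^ d = 1" for \<xi>
    by (rule sheet_param[OF rU_strip(1) rU_nonzero rU_strip(2) that])
  show "sheet (strip a (d - 1) k) rU 1 \<noteq> {}"
    using homeomorphism_image1[OF par[of 1]] strip_nonempty[OF k] by auto
  fix \<xi> :: complex assume \<xi>: "\<xi> ^ d = 1"
  show "sheet (strip a (d - 1) k) rU \<xi> \<subseteq> sheet U rU \<xi>"
    using strip_sub by (auto simp: sheet_def)
  show "sheet (strip a (d - 1) k) rU \<xi> \<subseteq> sheet V rV (\<xi> * unity_root d ^ k)"
    using strip_sub rU_eq_rV[OF _ k] by (auto simp: sheet_def)
  show "openin (top_of_set X) (sheet (strip a (d - 1) k) rU \<xi>)"
    by (rule openin_sheet[OF open_strip rU_strip(1) rU_nonzero rU_strip(2) \<xi>])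
  show "path_connected (sheet (strip a (d - 1) k) rU \<xi>)"
    using homeomorphism_image2[OF par[OF \<xi>]] homeomorphism_cont2[OF par[OF \<xi>]]
      path_connected_continuous_image convex_imp_path_connected[OF convex_strip] by metis
  show "k = k'" if "k' < d" "x \<in> sheet (strip a (d - 1) k) rU \<xi>" "x \<in> sheet (strip a (d - 1) k') rU \<xi>" for k' x
    using that strip_disjoint[OF _ _ k that(1)] by (auto simp: sheet_def)
  show "A \<eta> x \<in> sheet (strip a (d - 1) k) rU (\<xi> * \<eta>)"
    if "\<eta> ^ d = 1" "x \<in> sheet (strip a (d - 1) k) rU \<xi>" for \<eta> x
    by (rule A_sheet[OF that])
qed

end

section \<open>The fibre of a product of linear forms in the plane\<close>

lemma generate_GL_empty: "generate (GL :: (complex^'n^'n) monoid) {} = {\<one>\<^bsub>GL\<^esub>}"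
proof (intro equalityI subsetI)
  fix g :: "complex^'n^'n" assume "g \<in> generate GL {}"
  then show "g \<in> {\<one>\<^bsub>GL\<^esub>}"
    by induction (auto simp: GL_def matrix_mul_lid)
qed (auto intro: generate.one)

text \<open>Secures \<open>d > 0\<close>. Without reflections the group is generated by the empty
  set, hence trivial, and the line \<open>W\<close> is invariant.\<close>

lemma arrangement_nonempty:
  fixes G :: "(complex^2^2) set"
  assumes G: "finite_reflection_group G" and irr: "irreducible_linear_group G"
  shows "arrangement G \<noteq> {}"
proof
  assume "arrangement G = {}"
  then have "{s \<in> G. complex_reflection s} = {}" by (simp add: arrangement_def)
  then have "G = {\<one>\<^bsub>GL\<^esub>}"
    using G generate_GL_empty unfolding finite_reflection_group_def by metis
  then have G1: "G = {Finite_Cartesian_Product.mat 1}" by (simp add: GL_def)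
  define W :: "(complex^2) set" where "W = {v. v $ 1 = 0}"
  have "vec.subspace W" by (auto simp: vec.subspace_def W_def)
  moreover have "\<forall>g\<in>G. (*v) g ` W \<subseteq> W" by (auto simp: G1)
  ultimately have "W = {0} \<or> W = UNIV" using irr by (simp add: irreducible_linear_group_def)
  moreover have "axis 2 1 \<in> W" "axis 2 1 \<noteq> (0 :: complex^2)" "axis 1 1 \<notin> W"
    by (auto simp: W_def axis_def vec_eq_iff)
  ultimately show False by auto
qed

lemma arrangement_proper:
  fixes G :: "(complex^2^2) set"
  assumes "H \<in> arrangement G"
  shows "H \<noteq> UNIV"
proof
  assume "H = UNIV"
  then obtain g :: "complex^2^2" where "complex_reflection g" "fixed_space g = UNIV"
    using assms by (auto simp: arrangement_def)
  then have "vec.dim (UNIV :: (complex^2) set) + 1 = 2" by (simp add: complex_reflection_def)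
  then show False by (simp add: card_cart_basis)
qed

text \<open>The real part of \<open>Complex 1 \<tau> * z\<close> is
  \<open>Re z - \<tau> * Im z\<close>. Two distinct points collide only if \<tau> is the quotient
  attached to their difference, and there are finitely many such quotients.\<close>

lemma ex_inj_Re:
  fixes B :: "complex set"
  assumes "finite B"
  obtains \<theta> where "\<theta> \<noteq> 0" "inj_on (\<lambda>z. Re (\<theta> * z)) B"
proof -
  \<comment> \<open>Pairs with equal imaginary part contribute the default value 0 of division by
    zero; distinct points of this kind never collide.\<close>
  define bad where "bad = (\<lambda>(z, w). Re (z - w) / Im (z - w)) ` (B \<times> B)"
  have "finite bad" using assms by (simp add: bad_def)
  then obtain \<tau> :: real where \<tau>: "\<tau> \<notin> bad"
    using ex_new_if_finite[OF infinite_UNIV_char_0] by blast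
  have "z = w" if "z \<in> B" "w \<in> B" "Re (Complex 1 \<tau> * z) = Re (Complex 1 \<tau> * w)" for z w
  proof (rule ccontr)
    assume "z \<noteq> w"
    have e: "Re (z - w) = \<tau> * Im (z - w)" using that(3) by (simp add: algebra_simps)
    have "Im (z - w) \<noteq> 0"
    proof
      assume "Im (z - w) = 0"
      with e have "z - w = 0" by (simp add: complex_eq_iff)
      then show False using \<open>z \<noteq> w\<close> by simp
    qed
    then have "\<tau> = Re (z - w) / Im (z - w)" using e by (simp add: field_simps)
    then show False using \<tau> that(1,2) by (auto simp: bad_def)
  qed
  then have "inj_on (\<lambda>z. Re (Complex 1 \<tau> * z)) B" by (auto intro: inj_onI)
  moreover have "Complex 1 \<tau> \<noteq> 0" by (simp add: complex_eq_iff)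
  ultimately show ?thesis by (rule that[rotated])
qed

lemma ex_enum_Re:
  fixes B :: "complex set"
  assumes fin: "finite B" and inj: "inj_on Re B"
  obtains a where "bij_betw a {..<card B} B" "\<And>i j. i < j \<Longrightarrow> j < card B \<Longrightarrow> Re (a i) < Re (a j)"
proof -
  define r where "r = sorted_list_of_set (Re ` B)"
  have len: "length r = card B" by (simp add: r_def card_image[OF inj])
  have set: "set r = Re ` B" using fin by (simp add: r_def)
  have srt: "sorted_wrt (<) r" by (simp add: r_def)
  define a where "a i = the_inv_into B Re (r ! i)" for i
  have r: "r ! i \<in> Re ` B" if "i < card B" for i
    using that len set nth_mem by metis
  have Re_a: "Re (a i) = r ! i" if "i < card B" for i
    unfolding a_def by (rule f_the_inv_into_f[OF inj r[OF that]])
  show ?thesis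
  proof (rule that[of a])
    show lt: "Re (a i) < Re (a j)" if "i < j" "j < card B" for i j
      using sorted_wrt_nth_less[OF srt that(1)] that len Re_a by simp
    have "inj_on a {..<card B}"
    proof (rule inj_onI)
      fix i j assume ij: "i \<in> {..<card B}" "j \<in> {..<card B}" "a i = a j"
      then show "i = j" using lt[of i j] lt[of j i] by (cases i j rule: linorder_cases) auto
    qed
    moreover have "a ` {..<card B} \<subseteq> B"
      using the_inv_into_into[OF inj r] by (auto simp: a_def)
    ultimately show "bij_betw a {..<card B} B"
      using fin by (simp add: bij_betw_def card_image card_subset_eq)
  qed
qed

text \<open>Brings the fibre into the form of \<open>cyclic_curve\<close>: each hyperplane other
  than \<open>H0\<close> becomes one puncture in the coordinate \<open>tc\<close>.\<close>

lemma has_grothendieck_class_F\<^sub>0: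
  fixes G :: "(complex^2^2) set" and l :: "(complex^2) set \<Rightarrow> complex^2 \<Rightarrow> complex"
  assumes fin: "finite (arrangement G)" and ne: "arrangement G \<noteq> {}"
    and l: "defining_forms G l" and d: "d = card (arrangement G)"
  shows "has_grothendieck_class (mu d) (cohomology 1 (top_of_set (F\<^sub>0 G l)))
    (\<lambda>\<xi>. inv_into (carrier (cohomology 1 (top_of_set (F\<^sub>0 G l))))
      (cohomology_pullback 1 (top_of_set (F\<^sub>0 G l)) (\<Gamma>_act (\<one>\<^bsub>GL\<^esub>, \<xi>))))
    (grothendieck_class (mu d)
      (frag_cmul (int d - 1) (frag_of (mu_character 0)) +
       frag_cmul (int d - 2) (\<Sum>i=1..d-1. frag_of (mu_character i))))"
proof -
  obtain H0 where H0: "H0 \<in> arrangement G" using ne by blast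
  define \<H> where "\<H> = arrangement G - {H0}"
  have fin\<H>: "finite \<H>" using fin by (simp add: \<H>_def)
  have d0: "d > 0" using fin ne d by (simp add: card_gt_0_iff)
  have card\<H>: "card \<H> = d - 1" using fin H0 d by (simp add: \<H>_def)
  have ker: "{v. l H v = 0} = H" if "H \<in> arrangement G" for H
    using l that by (simp add: defining_forms_def)
  have lin_add: "l H (v + w) = l H v + l H w" and lin_smult: "l H (c *s v) = c * l H v"
    if "H \<in> arrangement G" for H v w c
    using l that module_hom.add[of "(*s)" "(*)" "l H"] module_hom.scale[of "(*s)" "(*)" "l H"]
    by (auto simp: defining_forms_def Vector_Spaces.linear_def)
  define p where "p = l H0 (axis 1 1)"
  define q where "q = l H0 (axis 2 1)"
  have l0: "l H0 v = p * v $ 1 + q * v $ 2" for v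
  proof -
    have "v = (v $ 1) *s axis 1 1 + (v $ 2) *s axis 2 1"
      by (simp add: vec_eq_iff forall_2 axis_def)
    then have "l H0 v = l H0 ((v $ 1) *s axis 1 1 + (v $ 2) *s axis 2 1)" by simp
    then show ?thesis by (simp add: lin_add[OF H0] lin_smult[OF H0] p_def q_def mult.commute)
  qed
  have "p \<noteq> 0 \<or> q \<noteq> 0"
  proof (rule ccontr)
    assume "\<not> ?thesis"
    then have "{v. l H0 v = 0} = UNIV" by (simp add: l0)
    then show False using ker[OF H0] arrangement_proper[OF H0] by simp
  qed
  then obtain \<alpha>1 \<alpha>2 where \<alpha>12: "p * \<alpha>1 + q * \<alpha>2 = 1"
  proof
    assume "p \<noteq> 0" then show ?thesis by (intro that[of "1 / p" 0]) simp
  next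
    assume "q \<noteq> 0" then show ?thesis by (intro that[of 0 "1 / q"]) simp
  qed
  \<comment> \<open>\<alpha>, \<beta> is the basis dual to the coordinates \<open>l H0\<close> and
    \<open>m\<close>, and \<beta> spans \<open>H0\<close>. The form \<open>m\<close> is any
    complement to \<open>l H0\<close>; it need not define a hyperplane of the arrangement.\<close>
  define \<alpha> :: "complex^2" where "\<alpha> = vector [\<alpha>1, \<alpha>2]"
  define \<beta> :: "complex^2" where "\<beta> = vector [q, - p]"
  define m where "m v = \<alpha>2 * v $ 1 - \<alpha>1 * v $ 2" for v :: "complex^2"
  have l0\<alpha>: "l H0 \<alpha> = 1" "l H0 \<beta> = 0" using \<alpha>12 by (simp_all add: l0 \<alpha>_def \<beta>_def vector_2)
  have m\<alpha>: "m \<alpha> = 0" "m \<beta> = 1" using \<alpha>12 by (simp_all add: m_def \<alpha>_def \<beta>_def vector_2 algebra_simps)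
  have decomp: "v = l H0 v *s \<alpha> + m v *s \<beta>" for v
  proof -
    have "(p * \<alpha>1 + q * \<alpha>2) * v $ 1 = l H0 v * \<alpha>1 + m v * q"
      "(p * \<alpha>1 + q * \<alpha>2) * v $ 2 = l H0 v * \<alpha>2 - m v * p"
      by (simp_all add: l0 m_def algebra_simps)
    then show ?thesis
      unfolding \<alpha>12 by (simp add: vec_eq_iff forall_2 \<alpha>_def \<beta>_def vector_2)
  qed
  have lH: "l H v = l H0 v * l H \<alpha> + m v * l H \<beta>" if "H \<in> arrangement G" for H v
    by (subst decomp[of v]) (simp only: lin_add[OF that] lin_smult[OF that])
  \<comment> \<open>A form that vanishes at \<beta> is a multiple of \<open>l H0\<close>, so its
    kernel is \<open>H0\<close> or the whole plane, and neither can be \<open>H\<close>.\<close>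
  have l\<beta>: "l H \<beta> \<noteq> 0" if H: "H \<in> \<H>" for H
  proof
    have HA: "H \<in> arrangement G" "H \<noteq> H0" using H by (auto simp: \<H>_def)
    assume "l H \<beta> = 0"
    then have e: "l H v = l H0 v * l H \<alpha>" for v using lH[OF HA(1), of v] by simp
    show False
    proof (cases "l H \<alpha> = 0")
      case True
      have "l H v = 0" for v using e[of v] True by simp
      then have "{v. l H v = 0} = UNIV" by blast
      then show False using ker[OF HA(1)] arrangement_proper[OF HA(1)] by simp
    next
      case False
      have "l H v = 0 \<longleftrightarrow> l H0 v = 0" for v using e[of v] False by simp
      then have "{v. l H v = 0} = {v. l H0 v = 0}" by blast
      then show False using ker[OF HA(1)] ker[OF H0] HA(2) by simp
    qed
  qed
  \<comment> \<open>In these coordinates \<open>H\<close> is the line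
    \<open>m v = b H * l H0 v\<close>, so \<open>b H\<close> is its slope and
    \<open>\<theta> * b H\<close> will be its puncture.\<close>
  define b where "b H = - l H \<alpha> / l H \<beta>" for H
  have lb: "l H v = l H \<beta> * (m v - b H * l H0 v)" if "H \<in> \<H>" for H v
    using lH[of H v] l\<beta>[OF that] that by (simp add: \<H>_def b_def field_simps)
  have lb0: "l H v = 0 \<longleftrightarrow> m v = b H * l H0 v" if "H \<in> \<H>" for H v
    using lb[OF that, of v] l\<beta>[OF that] by simp
  have inj_b: "inj_on b \<H>"
  proof (rule inj_onI)
    fix H H' assume H: "H \<in> \<H>" "H' \<in> \<H>" "b H = b H'"
    then have "{v. l H v = 0} = {v. l H' v = 0}" by (simp add: lb0)
    then show "H = H'" using ker[of H] ker[of H'] H by (simp add: \<H>_def)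
  qed
  obtain \<theta> where \<theta>: "\<theta> \<noteq> 0" "inj_on (\<lambda>z. Re (\<theta> * z)) (b ` \<H>)"
    by (rule ex_inj_Re[of "b ` \<H>"]) (use fin\<H> in auto)
  define B where "B = (\<lambda>H. \<theta> * b H) ` \<H>"
  have inj_B: "inj_on (\<lambda>H. \<theta> * b H) \<H>"
    using inj_b \<theta>(1) by (auto simp: inj_on_def)
  have "inj_on Re B"
    using \<theta>(2) by (auto simp: B_def inj_on_def)
  moreover have "finite B" using fin\<H> by (simp add: B_def)
  moreover have cardB: "card B = d - 1" using card_image[OF inj_B] card\<H> by (simp add: B_def)
  ultimately obtain a where a: "bij_betw a {..<d-1} B" "\<And>i j. i < j \<Longrightarrow> j < d - 1 \<Longrightarrow> Re (a i) < Re (a j)"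
    by (metis ex_enum_Re)
  \<comment> \<open>The division by \<theta> compensates for the use of \<open>\<theta> * m\<close>
    in place of \<open>m\<close> in \<open>tc\<close>.\<close>
  define \<kappa> where "\<kappa> = (\<Prod>H\<in>\<H>. l H \<beta> / \<theta>)"
  have \<kappa>: "\<kappa> \<noteq> 0" using fin\<H> l\<beta> \<theta>(1) by (simp add: \<kappa>_def)
  have prodB: "(\<Prod>H\<in>\<H>. t - \<theta> * b H) = (\<Prod>j<d-1. t - a j)" for t
  proof -
    have "(\<Prod>H\<in>\<H>. t - \<theta> * b H) = (\<Prod>z\<in>B. t - z)"
      unfolding B_def by (simp add: prod.reindex[OF inj_B])
    also have "\<dots> = (\<Prod>j<d-1. t - a j)"
      by (rule prod.reindex_bij_betw[OF a(1), symmetric])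
    finally show ?thesis .
  qed
  have Q: "Q\<^sub>0 G l v = l H0 v * (\<Prod>H\<in>\<H>. l H \<beta> * (m v - b H * l H0 v))" for v
  proof -
    have "Q\<^sub>0 G l v = l H0 v * (\<Prod>H\<in>\<H>. l H v)"
      unfolding Q\<^sub>0_def \<H>_def using fin H0 by (rule prod.remove)
    also have "(\<Prod>H\<in>\<H>. l H v) = (\<Prod>H\<in>\<H>. l H \<beta> * (m v - b H * l H0 v))"
      by (intro prod.cong refl lb)
    finally show ?thesis .
  qed
  define uc where "uc v = inverse (l H0 v)" for v
  define tc where "tc v = \<theta> * m v / l H0 v" for v
  define pt :: "complex \<Rightarrow> complex \<Rightarrow> complex^2"
    where "pt u t = inverse u *s \<alpha> + (t / (\<theta> * u)) *s \<beta>" for u t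
  have Q_eq: "Q\<^sub>0 G l v = l H0 v ^ d * (\<kappa> * (\<Prod>j<d-1. tc v - a j))" if x: "l H0 v \<noteq> 0" for v
  proof -
    have "(\<Prod>H\<in>\<H>. l H \<beta> * (m v - b H * l H0 v)) =
        (\<Prod>H\<in>\<H>. l H0 v * (l H \<beta> / \<theta> * (tc v - \<theta> * b H)))"
      by (rule prod.cong) (use x \<theta>(1) in \<open>auto simp: tc_def field_simps\<close>)
    also have "\<dots> = l H0 v ^ (d - 1) * (\<kappa> * (\<Prod>j<d-1. tc v - a j))"
      by (simp only: prod.distrib prod_constant card\<H> \<kappa>_def prodB)
    finally show ?thesis
      using d0 by (simp add: Q power_eq_if)
  qed
  have F_iff: "v \<in> F\<^sub>0 G l \<longleftrightarrow> uc v \<noteq> 0 \<and> uc v ^ d = \<kappa> * (\<Prod>j<d-1. tc v - a j)" for v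
  \<comment> \<open>On \<open>H0\<close> both sides fail: the product is 0 instead of 1, and
    \<open>uc v\<close> is 0 by the convention for \<open>inverse 0\<close>.\<close>
  proof (cases "l H0 v = 0")
    case True
    then show ?thesis by (simp add: F\<^sub>0_def Q uc_def)
  next
    case False
    then have "v \<in> F\<^sub>0 G l \<longleftrightarrow> l H0 v ^ d * (\<kappa> * (\<Prod>j<d-1. tc v - a j)) = 1"
      by (simp add: F\<^sub>0_def Q_eq)
    also have "\<dots> \<longleftrightarrow> uc v ^ d = \<kappa> * (\<Prod>j<d-1. tc v - a j)"
      using False by (auto simp: uc_def power_inverse field_simps)
    finally show ?thesis using False by (simp add: uc_def)
  qed
  have l0_pt: "l H0 (pt u t) = inverse u" for u t
    by (simp add: pt_def lin_add[OF H0] lin_smult[OF H0] l0\<alpha>)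
  have m_add: "m (v + w) = m v + m w" and m_smult: "m (c *s v) = c * m v" for v w c
    by (simp_all add: m_def algebra_simps)
  have m_pt: "m (pt u t) = t / (\<theta> * u)" for u t
    by (simp add: pt_def m_add m_smult m\<alpha>)
  have act: "\<Gamma>_act (\<one>\<^bsub>GL\<^esub>, \<xi>) v = inverse \<xi> *s v" for \<xi> and v :: "complex^2"
    by (simp add: \<Gamma>_act_def GL_def)
  have cont_l: "continuous_on S (l H0)" for S
  proof -
    have "l H0 = (\<lambda>v. p * v $ 1 + q * v $ 2)" by (rule ext) (rule l0)
    then show ?thesis by (simp only:) (intro continuous_intros)
  qed
  have cont_m: "continuous_on S m" for S
    unfolding m_def by (intro continuous_intros)
  interpret cyclic_curve "F\<^sub>0 G l" d a \<kappa> uc tc pt "\<lambda>\<xi>. \<Gamma>_act (\<one>\<^bsub>GL\<^esub>, \<xi>)"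
  proof
    show "continuous_on (F\<^sub>0 G l) uc" "continuous_on (F\<^sub>0 G l) tc"
      unfolding uc_def tc_def
      by (intro continuous_intros cont_l cont_m; use F_iff uc_def in force)+
    show "continuous_on {(u, t). u \<noteq> 0} (\<lambda>(u, t). pt u t)"
      unfolding pt_def case_prod_unfold vector_scalar_mult_def
      by (intro continuous_intros) (use \<theta>(1) in auto)
    fix v assume v: "v \<in> F\<^sub>0 G l"
    then have x: "l H0 v \<noteq> 0" using F_iff[of v] by (auto simp: uc_def)
    have "pt (uc v) (tc v) = l H0 v *s \<alpha> + m v *s \<beta>"
      using x \<theta>(1) by (simp add: pt_def uc_def tc_def)
    then show "uc v \<noteq> 0 \<and> uc v ^ d = \<kappa> * (\<Prod>j<d-1. tc v - a j) \<and> pt (uc v) (tc v) = v"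
      using decomp[of v] F_iff v by simp
  next
    fix u t :: complex assume u: "u \<noteq> 0" "u ^ d = \<kappa> * (\<Prod>j<d-1. t - a j)"
    have "uc (pt u t) = u" "tc (pt u t) = t"
      using u(1) \<theta>(1) by (simp_all add: uc_def tc_def l0_pt m_pt)
    then show "pt u t \<in> F\<^sub>0 G l \<and> uc (pt u t) = u \<and> tc (pt u t) = t"
      using u by (simp add: F_iff)
  next
    fix \<xi> :: complex assume \<xi>: "\<xi> ^ d = 1"
    then have \<xi>0: "\<xi> \<noteq> 0" by (rule root_of_unity_nonzero[OF d0])
    show "continuous_on (F\<^sub>0 G l) (\<Gamma>_act (\<one>\<^bsub>GL\<^esub>, \<xi>))"
      unfolding act vector_scalar_mult_def by (intro continuous_intros)
    fix v assume v: "v \<in> F\<^sub>0 G l"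
    \<comment> \<open>The inverse in the action cancels against the one in \<open>uc\<close>, so
      that \<xi> itself multiplies the coordinate, as \<open>cyclic_curve\<close> requires.\<close>
    have "uc (inverse \<xi> *s v) = \<xi> * uc v" "tc (inverse \<xi> *s v) = tc v"
      using \<xi>0 by (simp_all add: uc_def tc_def lin_smult[OF H0] m_smult)
    then show "\<Gamma>_act (\<one>\<^bsub>GL\<^esub>, \<xi>) v \<in> F\<^sub>0 G l \<and> uc (\<Gamma>_act (\<one>\<^bsub>GL\<^esub>, \<xi>) v) = \<xi> * uc v \<and>
        tc (\<Gamma>_act (\<one>\<^bsub>GL\<^esub>, \<xi>) v) = tc v"
      using v \<xi> \<xi>0 by (simp add: act F_iff power_mult_distrib)
  qed (use d0 \<kappa> a in auto)
  show ?thesis by (rule has_grothendieck_class_sheet_cover)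
qed

theorem proposition3p7:
  fixes G :: "(complex^2^2) set" and e d :: nat
    and l :: "(complex^2) set \<Rightarrow> complex^2 \<Rightarrow> complex"
  assumes "finite_reflection_group G" and "irreducible_linear_group G" and "uniform G e"
    and "defining_forms G l" and "d = card (arrangement G)"
  shows "has_grothendieck_class (mu d) (H_F\<^sub>0 1 G l)
           (\<lambda>\<xi>. \<Gamma>\<^sub>0_act_H 1 G l (\<one>\<^bsub>GL\<^esub>, \<xi>))
           (grothendieck_class (mu d)
              (frag_cmul (int d - 1) (frag_of (mu_character 0)) +
               frag_cmul (int d - 2) (\<Sum>i=1..d-1. frag_of (mu_character i))))"
proof -
  have "finite (arrangement G)"
    using assms(1) by (simp add: finite_reflection_group_def arrangement_def)
  from has_grothendieck_class_F\<^sub>0[OF this arrangement_nonempty[OF assms(1,2)] assms(4,5)]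
  show ?thesis
    by (simp only: H_F\<^sub>0_def \<Gamma>\<^sub>0_act_H_def)
qed

end
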